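(* Let $M=(m_i)$ and $L=(l_i)$ be infinite subsets of $\mathbb{N}$ (enumerated increasingly) such that $m_1>6$, $m_i^2<m_{i+1}$ for all $i$, $l_1>4$ and $2^{l_i}>m_i$ for all $i$. Suppose $N=(n_i)$ is an $M$-good infinite subset of $\mathbb{N}$. Then there exists a set $\mathcal{M}$ of finitely supported signed measures on $\mathbb{N}$ satisfying (a) $e_n^*\in\mathcal{M}$ for all $n\in\mathbb{N}$, where $e_n^*$ is the point mass measure at $n$; (b) $\mathcal{M}$ is symmetric, i.e. $\mu\in\mathcal{M}$ implies $-\mu\in\mathcal{M}$; (c) $\mu(\{n\})\le1$ for every $\mu\in\mathcal{M}$ and $n\in\mathbb{N}$; (d) if $\mu\in\mathcal{M}$ and $n\in\mathbb{N}$ then $\mu|\{1,\dots,n\}\in\mathcal{M}$; and such that the following properties are fulfilled: (1) $(e_n)$ is a $1$-unconditional, shrinking, bimonotone basis for $X_{\mathcal{M}}$. (2) $X_{\mathcal{M}}$ satisfies the $(6,N,P,\mathbf{a})$ distortion property (with respect to $(e_n)$), where $P=(f_i^N+2)_{i=1}^\infty$ and $\mathbf{a}=(\frac{1}{m_i})_{i=1}^\infty$.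
   Context: All Banach spaces are real and infinite dimensional. For a set $\mathcal{M}$ of finitely supported signed measures on $\mathbb{N}$ satisfying (a)–(d), $X_{\mathcal{M}}$ is the completion of $c_{00}$ (finitely supported real sequences, unit vector basis $(e_i)$) under the norm $\|\sum_ia_ie_i\|_{\mathcal{M}}=\sup\{\sum_ia_i\mu(\{i\}):\mu\in\mathcal{M}\}$. $\mu|J$ denotes the restriction of $\mu$ to $J$. $M$-good sets: for an infinite set $N=(n_i)\subset\mathbb{N}$ put $f_1^N=1$ and, for $j\ge2$, $f_j^N=\max\{\sum_{i<j}\rho_in_i:\ \rho_i\in\mathbb{N}\cup\{0\}\ (i<j),\ \prod_{i<j}m_i^{\rho_i}<m_j^3\}$. $N$ is $M$-good if $l_j(f_j^N+1)<n_j$ for all $j\in\mathbb{N}$. Schreier families: $S_0=\{\{n\}:n\in\mathbb{N}\}\cup\{\emptyset\}$ and, for $\xi<\omega$, $S_{\xi+1}=\{\bigcup_{i=1}^n F_i: n\in\mathbb{N},\ n\le\min F_1,\ F_1<\cdots<F_n,\ F_i\in S_\xi\ (i\le n)\}\cup\{\emptyset\}$, where $E<F$ means $\max E<\min F$. For a basis $(e_n)$ of $X$, a block basis of $(e_n)$ is a sequence of (non-zero) vectors $u_n=\sum_{i\in F_n}a_ie_i$ with $F_1<F_2<\cdots$ finite subsets of $\mathbb{N}$; a block subspace is the closed linear span of a block basis. A normalized sequence $(x_n)$ is an $\epsilon$-$\ell_1^\xi$ spreading model ($\epsilon>0$) if $\|\sum_{i\in F}a_ix_i\|\ge\epsilon\sum_{i\in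 F}|a_i|$ for every $F\in S_\xi$ and all scalars $(a_i)_{i\in F}$. A space $X$ with basis $(e_n)$ is asymptotic $\epsilon$-$\ell_1^\xi$ if every normalized block basis of $(e_n)$ is an $\epsilon$-$\ell_1^\xi$ spreading model. For $\delta>0$, $\tau(X,\delta)$ is the supremum of all $\zeta<\omega$ such that every normalized block basis of $(e_n)$ has a subsequence which is a $\delta$-$\ell_1^\zeta$ spreading model. For a block subspace $U$ of $X$, $\tau(U,\delta)$ is computed with respect to the block basis generating $U$. Distortion property: let $N=(n_i)$, $P=(p_i)$ be infinite subsets of $\mathbb{N}$ (enumerated increasingly) with $p_i<n_i/2$ for every $i\ge1$ and $n_{i-1}\le p_i$ for every $i\ge2$; let $\mathbf{a}=(\delta_i)$ be a decreasing null sequence of (positive) scalars and $d>1$. A space $X$ with basis $(e_i)$ satisfies the $(d,N,P,\mathbf{a})$ distortion property if for every $j\in\mathbb{N}$, $X$ is an asymptotic $\delta_j$-$\ell_1^{n_j}$ space and $\tau(U,d\delta_j)<p_j$ for every block subspace $U$ of $X$. *)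

theory Defs
  imports
    "HOL-Analysis.Analysis"
    "HOL-Library.Poly_Mapping"
    "HOL-Library.Extended_Nat"
    "HOL-Probability.Discrete_Topology"
begin

text \<open>Throughout, the natural numbers of the mathematics start at 1. Sequences are functions on
  \<^typ>\<open>nat\<close> whose value at 0 is never used, and sets of natural numbers do not contain 0; this
  matters for the Schreier families.\<close>

subsection \<open>Infinite sets of positive integers\<close>

definition inf_pos_set :: "nat set \<Rightarrow> bool" where
  "inf_pos_set A \<longleftrightarrow> infinite A \<and> 0 \<notin> A"

text \<open>The \<open>i\<close>-th element (\<open>i \<ge> 1\<close>) in increasing order; \<^const>\<open>enumerate\<close> counts from 0.\<close>

definition elt :: "nat set \<Rightarrow> nat \<Rightarrow> nat" where
  "elt A i = enumerate A (i - 1)"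

text \<open>The set whose maximum is taken is finite as soon as all elements of \<open>M\<close> are at least 2.\<close>

definition good_f :: "nat set \<Rightarrow> nat set \<Rightarrow> nat \<Rightarrow> nat" where
  "good_f M N j =
     (if j = 1 then 1
      else Max {(\<Sum>i\<in>{1..<j}. \<rho> i * elt N i) | \<rho> :: nat \<Rightarrow> nat.
                  (\<Prod>i\<in>{1..<j}. elt M i ^ \<rho> i) < elt M j ^ 3})"

definition good_set :: "nat set \<Rightarrow> nat set \<Rightarrow> nat set \<Rightarrow> bool" where
  "good_set M L N \<longleftrightarrow> (\<forall>j\<ge>1. elt L j * (good_f M N j + 1) < elt N j)"

subsection \<open>Schreier families\<close>

primrec schreier :: "nat \<Rightarrow> nat set set" where
  "schreier 0 = {{n} | n. n \<ge> 1} \<union> {{}}"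
| "schreier (Suc \<xi>) =
     {(\<Union>i\<in>{1..n}. F i) | (n :: nat) (F :: nat \<Rightarrow> nat set).
        n \<ge> 1 \<and> (\<forall>i\<in>{1..n}. F i \<in> schreier \<xi> \<and> F i \<noteq> {}) \<and>
        n \<le> Min (F 1) \<and> (\<forall>i\<in>{1..<n}. Max (F i) < Min (F (Suc i)))} \<union> {{}}"

subsection \<open>Bases\<close>

text \<open>A Banach space is given as a closed subspace \<open>X\<close> of an ambient complete normed space, which
  carries the norm.\<close>

definition expansion :: "(nat \<Rightarrow> 'a::real_normed_vector) \<Rightarrow> (nat \<Rightarrow> real) \<Rightarrow> 'a \<Rightarrow> bool" where
  "expansion e a x \<longleftrightarrow> (\<lambda>n. \<Sum>i\<in>{1..n}. a i *\<^sub>R e i) \<longlonglongrightarrow> x"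

text \<open>The condition \<open>a 0 = 0\<close> only pins down the unused coefficient.\<close>

definition schauder_basis :: "'a::real_normed_vector set \<Rightarrow> (nat \<Rightarrow> 'a) \<Rightarrow> bool" where
  "schauder_basis X e \<longleftrightarrow>
     (\<forall>i\<ge>1. e i \<in> X) \<and> (\<forall>x\<in>X. \<exists>!a. a 0 = 0 \<and> expansion e a x)"

definition unconditional :: "real \<Rightarrow> (nat \<Rightarrow> 'a::real_normed_vector) \<Rightarrow> bool" where
  "unconditional K e \<longleftrightarrow>
     (\<forall>a x (\<epsilon> :: nat \<Rightarrow> real). expansion e a x \<longrightarrow> (\<forall>i. \<epsilon> i \<in> {-1, 1}) \<longrightarrow>
        (\<exists>y. expansion e (\<lambda>i. \<epsilon> i * a i) y \<and> norm y \<le> K * norm x))"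

text \<open>The basis projections onto all intervals, finite or infinite, have norm at most one.\<close>

definition bimonotone :: "(nat \<Rightarrow> 'a::real_normed_vector) \<Rightarrow> bool" where
  "bimonotone e \<longleftrightarrow>
     (\<forall>a x. expansion e a x \<longrightarrow>
        (\<forall>m\<ge>1. \<forall>n. norm (\<Sum>i\<in>{m..n}. a i *\<^sub>R e i) \<le> norm x) \<and>
        (\<forall>n. norm (x - (\<Sum>i\<in>{1..n}. a i *\<^sub>R e i)) \<le> norm x))"

definition bounded_functional_on :: "'a::real_normed_vector set \<Rightarrow> ('a \<Rightarrow> real) \<Rightarrow> bool" where
  "bounded_functional_on X f \<longleftrightarrow>
     (\<forall>x\<in>X. \<forall>y\<in>X. f (x + y) = f x + f y) \<and>
     (\<forall>c. \<forall>x\<in>X. f (c *\<^sub>R x) = c * f x) \<and>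
     (\<exists>K. \<forall>x\<in>X. \<bar>f x\<bar> \<le> K * norm x)"

text \<open>The norm of every functional restricted to the closed span of the tail
  \<open>(e i)\<close>, \<open>i > n\<close>, tends to zero.\<close>

definition shrinking :: "'a::real_normed_vector set \<Rightarrow> (nat \<Rightarrow> 'a) \<Rightarrow> bool" where
  "shrinking X e \<longleftrightarrow>
     (\<forall>f. bounded_functional_on X f \<longrightarrow>
        (\<lambda>n. SUP x\<in>{x \<in> closure (span (e ` {n<..})). norm x \<le> 1}. \<bar>f x\<bar>) \<longlonglongrightarrow> 0)"

definition normalized :: "(nat \<Rightarrow> 'a::real_normed_vector) \<Rightarrow> bool" where
  "normalized x \<longleftrightarrow> (\<forall>n\<ge>1. norm (x n) = 1)"

definition block_basis :: "(nat \<Rightarrow> 'a::real_normed_vector) \<Rightarrow> (nat \<Rightarrow> 'a) \<Rightarrow> bool" where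
  "block_basis e u \<longleftrightarrow>
     (\<exists>(F :: nat \<Rightarrow> nat set) (a :: nat \<Rightarrow> real). \<forall>n\<ge>1.
        finite (F n) \<and> F n \<noteq> {} \<and> 0 \<notin> F n \<and> Max (F n) < Min (F (Suc n)) \<and>
        u n = (\<Sum>i\<in>F n. a i *\<^sub>R e i) \<and> u n \<noteq> 0)"

definition subseq_of :: "(nat \<Rightarrow> 'a) \<Rightarrow> (nat \<Rightarrow> 'a) \<Rightarrow> bool" where
  "subseq_of x y \<longleftrightarrow>
     (\<exists>s :: nat \<Rightarrow> nat. strict_mono_on {1..} s \<and> (\<forall>k\<ge>1. s k \<ge> 1 \<and> y k = x (s k)))"

subsection \<open>Spreading models and the distortion property\<close>

definition l1_spreading_model :: "real \<Rightarrow> nat \<Rightarrow> (nat \<Rightarrow> 'a::real_normed_vector) \<Rightarrow> bool" where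
  "l1_spreading_model \<epsilon> \<xi> x \<longleftrightarrow>
     \<epsilon> > 0 \<and> normalized x \<and>
     (\<forall>F\<in>schreier \<xi>. \<forall>a :: nat \<Rightarrow> real.
        norm (\<Sum>i\<in>F. a i *\<^sub>R x i) \<ge> \<epsilon> * (\<Sum>i\<in>F. \<bar>a i\<bar>))"

definition asymptotic_l1 :: "real \<Rightarrow> nat \<Rightarrow> (nat \<Rightarrow> 'a::real_normed_vector) \<Rightarrow> bool" where
  "asymptotic_l1 \<epsilon> \<xi> e \<longleftrightarrow>
     (\<forall>x. block_basis e x \<and> normalized x \<longrightarrow> l1_spreading_model \<epsilon> \<xi> x)"

text \<open>The supremum of a set of finite ordinals, which is \<open>\<infinity>\<close> if the set is unbounded. For a block
  subspace \<open>U\<close> the argument \<open>e\<close> is the block basis generating \<open>U\<close>.\<close>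

definition tau :: "(nat \<Rightarrow> 'a::real_normed_vector) \<Rightarrow> real \<Rightarrow> enat" where
  "tau e \<delta> =
     Sup {enat \<zeta> | \<zeta>. \<forall>x. block_basis e x \<and> normalized x \<longrightarrow>
                          (\<exists>y. subseq_of x y \<and> l1_spreading_model \<delta> \<zeta> y)}"

text \<open>The standing requirements on the parameters \<open>d, N, P, \<delta>\<close> are part of the property.\<close>

definition distortion_property ::
  "real \<Rightarrow> nat set \<Rightarrow> nat set \<Rightarrow> (nat \<Rightarrow> real) \<Rightarrow> 'a::real_normed_vector set \<Rightarrow> (nat \<Rightarrow> 'a) \<Rightarrow> bool"
where
  "distortion_property d N P \<delta> X e \<longleftrightarrow>
     d > 1 \<and> inf_pos_set N \<and> inf_pos_set P \<and>
     (\<forall>i\<ge>1. real (elt P i) < real (elt N i) / 2) \<and> (\<forall>i\<ge>2. elt N (i - 1) \<le> elt P i) \<and>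
     (\<forall>i\<ge>1. \<delta> i > 0 \<and> \<delta> (Suc i) < \<delta> i) \<and> \<delta> \<longlonglongrightarrow> 0 \<and>
     schauder_basis X e \<and>
     (\<forall>j\<ge>1. asymptotic_l1 (\<delta> j) (elt N j) e \<and>
             (\<forall>u. block_basis e u \<longrightarrow> tau u (d * \<delta> j) < enat (elt P j)))"

subsection \<open>The space defined by a set of measures\<close>

text \<open>A finitely supported signed measure is given by its point masses:
  \<open>lookup \<mu> n\<close> is \<open>\<mu>({n})\<close>. Vectors of \<open>c_00\<close> have the same type.\<close>

abbreviation lk :: "(nat \<Rightarrow>\<^sub>0 real) \<Rightarrow> nat \<Rightarrow> real" where
  "lk \<equiv> Poly_Mapping.lookup"

definition c00 :: "(nat \<Rightarrow>\<^sub>0 real) set" where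
  "c00 = {x. 0 \<notin> Poly_Mapping.keys x}"

definition unit_vec :: "nat \<Rightarrow> (nat \<Rightarrow>\<^sub>0 real)" where
  "unit_vec n = Poly_Mapping.single n 1"

definition restr :: "(nat \<Rightarrow>\<^sub>0 real) \<Rightarrow> nat set \<Rightarrow> (nat \<Rightarrow>\<^sub>0 real)" where
  "restr \<mu> J = Poly_Mapping.mapp (\<lambda>n v. if n \<in> J then v else 0) \<mu>"

definition admissible :: "(nat \<Rightarrow>\<^sub>0 real) set \<Rightarrow> bool" where
  "admissible \<M> \<longleftrightarrow>
     (\<forall>\<mu>\<in>\<M>. 0 \<notin> Poly_Mapping.keys \<mu>) \<and>
     (\<forall>n\<ge>1. unit_vec n \<in> \<M>) \<and>
     (\<forall>\<mu>\<in>\<M>. - \<mu> \<in> \<M>) \<and>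
     (\<forall>\<mu>\<in>\<M>. \<forall>n\<ge>1. lk \<mu> n \<le> 1) \<and>
     (\<forall>\<mu>\<in>\<M>. \<forall>n\<ge>1. restr \<mu> {1..n} \<in> \<M>)"

definition pairing :: "(nat \<Rightarrow>\<^sub>0 real) \<Rightarrow> (nat \<Rightarrow>\<^sub>0 real) \<Rightarrow> real" where
  "pairing \<mu> x = (\<Sum>i\<in>Poly_Mapping.keys x. lk x i * lk \<mu> i)"

definition norm_of :: "(nat \<Rightarrow>\<^sub>0 real) set \<Rightarrow> (nat \<Rightarrow>\<^sub>0 real) \<Rightarrow> real" where
  "norm_of \<M> x = (SUP \<mu>\<in>\<M>. pairing \<mu> x)"

text \<open>The completion of \<open>(c00, norm_of \<M>)\<close> is realized as the closure of its canonical image,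
  \<open>x \<mapsto> (pairing \<mu> x)\<close> for \<open>\<mu> \<in> \<M>\<close>, in the space of bounded functions on the set of all measures.
  Here \<open>discrete\<close> makes every function continuous, so that bounded continuous functions are
  just bounded functions. That the map is linear and isometric and its range closure complete is
  proved below.\<close>

type_synonym ambient = "(nat \<Rightarrow>\<^sub>0 real) discrete \<Rightarrow>\<^sub>C real"

definition embed :: "(nat \<Rightarrow>\<^sub>0 real) set \<Rightarrow> (nat \<Rightarrow>\<^sub>0 real) \<Rightarrow> ambient" where
  "embed \<M> x = Bcontfun (\<lambda>\<mu>. if of_discrete \<mu> \<in> \<M> then pairing (of_discrete \<mu>) x else 0)"

definition X_space :: "(nat \<Rightarrow>\<^sub>0 real) set \<Rightarrow> ambient set" where
  "X_space \<M> = closure (embed \<M> ` c00)"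

definition X_basis :: "(nat \<Rightarrow>\<^sub>0 real) set \<Rightarrow> nat \<Rightarrow> ambient" where
  "X_basis \<M> n = embed \<M> (unit_vec n)"

lemma restr_lookup: "lk (restr \<mu> J) n = (if n \<in> J then lk \<mu> n else 0)"
  by (simp add: restr_def lookup_mapp when_def in_keys_iff)

lemma pairing_superset:
  assumes "finite A" "Poly_Mapping.keys x \<subseteq> A"
  shows "pairing \<mu> x = (\<Sum>i\<in>A. lk x i * lk \<mu> i)"
  unfolding pairing_def using assms by (intro sum.mono_neutral_left) (auto simp: in_keys_iff)

lemma pairing_add: "pairing \<mu> (x + y) = pairing \<mu> x + pairing \<mu> y"
proof -
  let ?A = "Poly_Mapping.keys x \<union> Poly_Mapping.keys y"
  show ?thesis
    using Poly_Mapping.keys_add[of x y]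
    by (simp add: pairing_superset[of ?A] lookup_add distrib_right sum.distrib)
qed

lemma pairing_scale: "pairing \<mu> (Poly_Mapping.map ((*) c) x) = c * pairing \<mu> x"
proof -
  have "Poly_Mapping.keys (Poly_Mapping.map ((*) c) x) \<subseteq> Poly_Mapping.keys x"
    by (auto simp: in_keys_iff Poly_Mapping.map.rep_eq when_def)
  then show ?thesis
    by (simp add: pairing_superset[of "Poly_Mapping.keys x"] Poly_Mapping.map.rep_eq when_def
        sum_distrib_left mult.assoc in_keys_iff)
qed

lemma pairing_uminus: "pairing (- \<mu>) x = - pairing \<mu> x"
  by (simp add: pairing_def sum_negf)

lemma admissible_mass:
  assumes "admissible \<M>" "\<mu> \<in> \<M>"
  shows "\<bar>lk \<mu> n\<bar> \<le> 1"
proof (cases "n = 0")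
  case True
  then show ?thesis using assms by (auto simp: admissible_def in_keys_iff)
next
  case False
  moreover have "- \<mu> \<in> \<M>"
    using assms by (simp add: admissible_def)
  ultimately have "lk \<mu> n \<le> 1" "lk (- \<mu>) n \<le> 1"
    using assms unfolding admissible_def by (meson less_one linorder_not_less)+
  then show ?thesis by simp
qed

lemma pairing_bound:
  assumes "admissible \<M>" "\<mu> \<in> \<M>"
  shows "\<bar>pairing \<mu> x\<bar> \<le> (\<Sum>i\<in>Poly_Mapping.keys x. \<bar>lk x i\<bar>)"
  unfolding pairing_def
  using admissible_mass[OF assms]
  by (intro order.trans[OF sum_abs] sum_mono) (simp add: abs_mult mult_left_le)

lemma embed_apply:
  assumes "admissible \<M>"
  shows "apply_bcontfun (embed \<M> x) \<mu> =
    (if of_discrete \<mu> \<in> \<M> then pairing (of_discrete \<mu>) x else 0)"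
proof -
  let ?f = "\<lambda>\<mu>. if of_discrete \<mu> \<in> \<M> then pairing (of_discrete \<mu>) x else 0"
  have "continuous_on UNIV ?f"
    by (auto simp: continuous_on_open_vimage open_discrete)
  then have "?f \<in> bcontfun"
    using pairing_bound[OF assms, of _ x]
    by (intro bcontfun_normI[of _ "\<Sum>i\<in>Poly_Mapping.keys x. \<bar>lk x i\<bar>"]) (auto intro: sum_nonneg)
  then show ?thesis
    unfolding embed_def by (simp add: Bcontfun_inverse)
qed

lemma embed_add:
  assumes "admissible \<M>"
  shows "embed \<M> (x + y) = embed \<M> x + embed \<M> y"
  by (rule bcontfun_eqI) (simp add: embed_apply[OF assms] pairing_add)

lemma embed_scale:
  assumes "admissible \<M>"
  shows "embed \<M> (Poly_Mapping.map ((*) c) x) = c *\<^sub>R embed \<M> x"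
  by (rule bcontfun_eqI) (simp add: embed_apply[OF assms] pairing_scale)

lemma norm_embed:
  assumes "admissible \<M>"
  shows "norm (embed \<M> x) = norm_of \<M> x"
proof (rule antisym)
  have bdd: "bdd_above ((\<lambda>\<mu>. pairing \<mu> x) ` \<M>)"
    using pairing_bound[OF assms, of _ x]
    by (intro bdd_aboveI2[of _ _ "\<Sum>i\<in>Poly_Mapping.keys x. \<bar>lk x i\<bar>"]) (simp add: abs_le_iff)
  have abs_le: "\<bar>pairing \<mu> x\<bar> \<le> norm_of \<M> x" if "\<mu> \<in> \<M>" for \<mu>
  proof -
    have "- \<mu> \<in> \<M>" using assms that by (simp add: admissible_def)
    then have "pairing (- \<mu>) x \<le> norm_of \<M> x" "pairing \<mu> x \<le> norm_of \<M> x"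
      unfolding norm_of_def using that bdd by (auto intro: cSUP_upper)
    then show ?thesis by (simp add: pairing_uminus)
  qed
  have ne: "unit_vec 1 \<in> \<M>" using assms by (simp add: admissible_def)
  then have "0 \<le> norm_of \<M> x" using abs_le by fastforce
  then show "norm (embed \<M> x) \<le> norm_of \<M> x"
    using abs_le by (intro norm_bound) (simp add: embed_apply[OF assms])
  show "norm_of \<M> x \<le> norm (embed \<M> x)"
    unfolding norm_of_def
  proof (rule cSUP_least)
    fix \<mu> assume "\<mu> \<in> \<M>"
    then show "pairing \<mu> x \<le> norm (embed \<M> x)"
      using norm_bounded[of "embed \<M> x" "discrete \<mu>"]
      by (simp add: embed_apply[OF assms] discrete_inverse)
  qed (use ne in auto)
qed

lemma complete_X_space: "complete (X_space \<M>)"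
  by (simp add: X_space_def complete_eq_closed)

end

theory Submission
  imports Defs
begin

text \<open>The norming set is the mixed Tsirelson one: the smallest set containing \<open>\<plusminus>e\<^sub>n\<^sup>*\<close> and 0 and closed under
  \<open>(\<mu>\<^sub>1 + \<dots> + \<mu>\<^sub>d) / m\<^sub>j\<close> for successive \<open>\<mu>\<^sub>i\<close> whose supports start on a Schreier set of order \<open>n\<^sub>j\<close>. The lower
  \<open>\<ell>\<^sub>1\<close> estimates, unconditionality and bimonotonicity are immediate from this.

  For the upper bound on \<open>\<tau>\<close>, every block sequence has normalized blocks that are at most twice a special convex
  combination of order \<open>f\<^sub>J\<close>; otherwise \<open>l\<^sub>J\<close> rounds of averaging would contradict the lower
  estimate of order \<open>n\<^sub>J\<close>, since \<open>2 ^ l\<^sub>J > m\<^sub>J\<close>. On such a block a measure of weight \<open>m\<^sub>i\<close> with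
  \<open>i < J\<close> is at most \<open>3 / m\<^sub>i\<close>. With \<open>J\<close> growing fast this gives a sequence on which each weight \<open>m\<^sub>i\<close>,
  \<open>i \<ge> j\<close>, acts by at most \<open>3 / m\<^sub>j\<close> with one exception. Following the tree of a measure down through
  the weights below \<open>m\<^sub>j\<close> until their product reaches \<open>m\<^sub>j\<close> costs at most \<open>f\<^sub>j\<close> in Schreier complexity, so
  the exceptional blocks carry little mass in a special convex combination of order \<open>f\<^sub>j\<close>, whose
  norm is therefore at most \<open>4 / m\<^sub>j < 6 / m\<^sub>j\<close>. The same sequences rule out \<open>\<ell>\<^sub>1\<close> blocks, hence the
  basis is shrinking.\<close>

section \<open>Schreier families\<close>

text \<open>The tree of a measure does not respect blocks: an operation may cut a block in two. A
  cut block contains a point of the Schreier set of that operation to the right of its left end.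
  Moving this point on to the right end is a spreading, so the blocks cut by one node form a set of
  order \<open>n i\<close>, read off from right ends. Orders of nested nodes add, so a branch with
  \<open>\<rho> i\<close> operations of weight \<open>m i\<close> has order at most the sum of the
  \<open>\<rho> i * n i\<close>, the quantity maximized in \<open>f j\<close>. A branch is continued
  only while its product is below \<open>m j\<close>; one more factor \<open>m i < m j\<close> keeps
  it below \<open>m j ^ 2\<close>, within the cubic constraint of \<open>f j\<close>. The product at
  least doubles at each level, so \<open>m j\<close> levels suffice.

  Constants: testing an average against weight \<open>m i\<close> gives at most
  \<open>1 / m i + 1 / (2 * m J)\<close>, hence at most \<open>3 / 2 / m i\<close>; normalizing
  costs a factor at most 2, whence 3. The \<open>m j\<close> exceptional levels have mass at most
  \<open>1 / m j ^ 2\<close> each and add \<open>1 / m j\<close>, whence 4.\<close>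

lemma schreier_empty [simp]: "{} \<in> schreier \<xi>"
  by (cases \<xi>) auto

lemma schreier_finite_pos: "F \<in> schreier \<xi> \<Longrightarrow> finite F \<and> 0 \<notin> F"
proof (induction \<xi> arbitrary: F)
  case 0
  then show ?case by auto
next
  case (Suc \<xi>)
  show ?case
  proof (cases "F = {}")
    case False
    then obtain n :: nat and G where "F = (\<Union>i\<in>{1..n}. G i)" "\<forall>i\<in>{1..n}. G i \<in> schreier \<xi>"
      using Suc.prems by auto
    then show ?thesis using Suc.IH by blast
  qed simp
qed

lemma schreier_finite: "F \<in> schreier \<xi> \<Longrightarrow> finite F"
  using schreier_finite_pos by blast

lemma schreier_pos: "F \<in> schreier \<xi> \<Longrightarrow> x \<in> F \<Longrightarrow> 1 \<le> x"
  using schreier_finite_pos by (metis One_nat_def Suc_leI bot_nat_0.not_eq_extremum)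

text \<open>Empty pieces appear as soon as a set is intersected or split. Dropping them only lowers
  the number of pieces, which the definition bounds from above, so its numbering by non-empty pieces
  can be rebuilt.\<close>

lemma schreier_Suc_chain:
  assumes "\<And>i. i < d \<Longrightarrow> P i \<in> schreier \<xi>"
    and "\<And>i j x y. i < j \<Longrightarrow> j < d \<Longrightarrow> x \<in> P i \<Longrightarrow> y \<in> P j \<Longrightarrow> x < y"
  shows "(\<Union>i<d. P i) = {} \<or> (\<exists>n G. n \<ge> 1 \<and> n \<le> d \<and> (\<Union>i<d. P i) = (\<Union>i\<in>{1..n}. G i) \<and>
      (\<forall>i\<in>{1..n}. G i \<in> schreier \<xi> \<and> G i \<noteq> {}) \<and>
      (\<forall>i\<in>{1..<n}. Max (G i) < Min (G (Suc i))))"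
  using assms
proof (induction d)
  case 0
  then show ?case by simp
next
  case (Suc d)
  have IH: "(\<Union>i<d. P i) = {} \<or> (\<exists>n G. n \<ge> 1 \<and> n \<le> d \<and> (\<Union>i<d. P i) = (\<Union>i\<in>{1..n}. G i) \<and>
      (\<forall>i\<in>{1..n}. G i \<in> schreier \<xi> \<and> G i \<noteq> {}) \<and>
      (\<forall>i\<in>{1..<n}. Max (G i) < Min (G (Suc i))))"
  proof (rule Suc.IH)
    show "P i \<in> schreier \<xi>" if "i < d" for i using Suc.prems(1) that by simp
    show "x < y" if "i < j" "j < d" "x \<in> P i" "y \<in> P j" for i j x y
      using Suc.prems(2)[OF that(1) _ that(3,4)] that(2) by simp
  qed
  have un: "(\<Union>i<Suc d. P i) = (\<Union>i<d. P i) \<union> P d"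
    by (auto simp: less_Suc_eq)
  show ?case
  proof (cases "P d = {}")
    case True
    then show ?thesis using IH unfolding un by (simp only: Un_empty_right) (meson le_SucI)
  next
    case ne: False
    show ?thesis
    proof (cases "(\<Union>i<d. P i) = {}")
      case True
      have "P d \<in> schreier \<xi>" using Suc.prems by auto
      then show ?thesis unfolding un True
        by (intro disjI2 exI[of _ 1] exI[of _ "\<lambda>_. P d"]) (use ne in auto)
    next
      case False
      then obtain n G where G: "n \<ge> 1" "n \<le> d" "(\<Union>i<d. P i) = (\<Union>i\<in>{1..n}. G i)"
        "\<forall>i\<in>{1..n}. G i \<in> schreier \<xi> \<and> G i \<noteq> {}"
        "\<forall>i\<in>{1..<n}. Max (G i) < Min (G (Suc i))"
        using IH by blast
      define H where "H = G(Suc n := P d)"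
      have fin: "finite (P d)" "finite (G n)" "G n \<noteq> {}"
        using Suc.prems(1)[of d] G(1,4) schreier_finite[of "P d" \<xi>] schreier_finite[of "G n" \<xi>] by auto
      have "Max (G n) < Min (P d)"
      proof -
        have "Max (G n) \<in> G n" using fin by auto
        then have "Max (G n) \<in> (\<Union>i<d. P i)" unfolding G(3) using G(1) by auto
        moreover have "Min (P d) \<in> P d" using fin ne by auto
        ultimately show ?thesis using Suc.prems(2) by blast
      qed
      moreover have "(\<Union>i\<in>{1..Suc n}. H i) = (\<Union>i<d. P i) \<union> P d"
        unfolding G(3) H_def by (auto simp: atLeastAtMostSuc_conv split: if_splits)
      moreover have "P d \<in> schreier \<xi>" using Suc.prems by auto
      ultimately show ?thesis unfolding un using G ne
        by (intro disjI2 exI[of _ "Suc n"] exI[of _ H]) (auto simp: H_def less_Suc_eq le_Suc_eq)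
    qed
  qed
qed

text \<open>Order between neighbours propagates to all pairs because the pieces are non-empty, and
  the bound on the first minimum to every point. The empty set is the case
  \<open>d = 0\<close>.\<close>

lemma schreier_SucE:
  assumes "F \<in> schreier (Suc \<xi>)"
  obtains d P where "F = (\<Union>i<d. P i)" "\<And>i. i < d \<Longrightarrow> P i \<in> schreier \<xi>" "\<And>x. x \<in> F \<Longrightarrow> d \<le> x"
    "\<And>i j x y. i < j \<Longrightarrow> j < d \<Longrightarrow> x \<in> P i \<Longrightarrow> y \<in> P j \<Longrightarrow> x < y"
proof -
  from assms consider "F = {}" | n G where "F = (\<Union>i\<in>{1..n::nat}. G i)" "n \<ge> 1"
    "\<forall>i\<in>{1..n}. G i \<in> schreier \<xi> \<and> G i \<noteq> {}" "n \<le> Min (G 1)"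
    "\<forall>i\<in>{1..<n}. Max (G i) < Min (G (Suc i))"
    by auto
  then show ?thesis
  proof cases
    case 1
    then show ?thesis by (intro that[of "\<lambda>_. {}" 0]) auto
  next
    case (2 n G)
    have fin: "finite (G i) \<and> G i \<noteq> {}" if "i \<in> {1..n}" for i
      using 2 that schreier_finite by blast
    have ord: "x < y" if "1 \<le> i" "i < j" "j \<le> n" "x \<in> G i" "y \<in> G j" for i j x y
      using that(2,3,5)
    proof (induction j arbitrary: y)
      case (Suc j)
      have st: "Max (G j) < Min (G (Suc j))" using 2(5) Suc.prems that(1) by auto
      have f: "finite (G j)" "G j \<noteq> {}" "finite (G (Suc j))"
        using fin[of j] fin[of "Suc j"] Suc.prems that(1) by auto
      have "Max (G j) < y" using st Min_le[OF f(3) Suc.prems(3)] by simp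
      moreover have "x \<le> Max (G j)"
      proof (cases "i = j")
        case True
        then show ?thesis using that f by auto
      next
        case False
        then have "x < Max (G j)" using Suc f by (intro Suc.IH) auto
        then show ?thesis by simp
      qed
      ultimately show ?case by simp
    qed simp
    have ge: "n \<le> x" if x: "x \<in> F" for x
    proof -
      obtain i where i: "i \<in> {1..n}" "x \<in> G i" using x 2 by auto
      have m1: "Min (G 1) \<in> G 1" using fin[of 1] 2(2) by auto
      have "Min (G 1) \<le> x"
      proof (cases "i = 1")
        case True
        then show ?thesis using i fin[of 1] by auto
      next
        case False
        then show ?thesis using ord[OF _ _ _ m1 i(2)] i by auto
      qed
      then show ?thesis using 2(4) by simp
    qed
    show ?thesis
    proof (rule that[of "\<lambda>i. G (Suc i)" n])
      show "F = (\<Union>i<n. G (Suc i))"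
        unfolding 2(1) image_Suc_lessThan[symmetric] by (simp add: image_image)
      show "x < y" if "i < j" "j < n" "x \<in> G (Suc i)" "y \<in> G (Suc j)" for i j x y
        using ord[of "Suc i" "Suc j" x y] that by simp
      show "G (Suc i) \<in> schreier \<xi>" if "i < n" for i using 2(3) that by simp
    qed (rule ge)
  qed
qed

text \<open>Unlike in the definition, pieces may be empty here.\<close>

lemma schreier_SucI:
  assumes "F = (\<Union>i<d. P i)" "\<And>i. i < d \<Longrightarrow> P i \<in> schreier \<xi>" "\<And>x. x \<in> F \<Longrightarrow> d \<le> x"
    "\<And>i j x y. i < j \<Longrightarrow> j < d \<Longrightarrow> x \<in> P i \<Longrightarrow> y \<in> P j \<Longrightarrow> x < y"
  shows "F \<in> schreier (Suc \<xi>)"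
proof (cases "F = {}")
  case False
  have "(\<Union>i<d. P i) = {} \<or> (\<exists>n G. n \<ge> 1 \<and> n \<le> d \<and> (\<Union>i<d. P i) = (\<Union>i\<in>{1..n}. G i) \<and>
      (\<forall>i\<in>{1..n}. G i \<in> schreier \<xi> \<and> G i \<noteq> {}) \<and>
      (\<forall>i\<in>{1..<n}. Max (G i) < Min (G (Suc i))))"
    by (rule schreier_Suc_chain[OF assms(2,4)])
  then obtain n G where G: "n \<ge> 1" "n \<le> d" "F = (\<Union>i\<in>{1..n}. G i)"
      "\<forall>i\<in>{1..n}. G i \<in> schreier \<xi> \<and> G i \<noteq> {}"
      "\<forall>i\<in>{1..<n}. Max (G i) < Min (G (Suc i))"
    using False unfolding assms(1) by (elim disjE exE conjE) simp
  have "finite (G 1)" "G 1 \<noteq> {}" using G(1,4) schreier_finite[of "G 1" \<xi>] by auto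
  then have "Min (G 1) \<in> G 1" by simp
  then have "Min (G 1) \<in> F" using G(1,3) by auto
  then have "n \<le> Min (G 1)" using G(2) assms(3) by (meson order.trans)
  then show ?thesis using G by auto
qed simp

declare schreier.simps [simp del]

lemma schreier_0: "F \<in> schreier 0 \<longleftrightarrow> F = {} \<or> (\<exists>n\<ge>1. F = {n})"
  by (auto simp: schreier.simps)

lemma schreier_subset: "F \<in> schreier \<xi> \<Longrightarrow> G \<subseteq> F \<Longrightarrow> G \<in> schreier \<xi>"
proof (induction \<xi> arbitrary: F G)
  case 0
  then show ?case by (auto simp: schreier_0 subset_singleton_iff)
next
  case (Suc \<xi>)
  from Suc.prems(1) show ?case
  proof (rule schreier_SucE)
    fix d P assume P: "F = (\<Union>i<d. P i)" "\<And>i. i < d \<Longrightarrow> P i \<in> schreier \<xi>" "\<And>x. x \<in> F \<Longrightarrow> d \<le> x"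
      "\<And>i j x y. i < j \<Longrightarrow> j < d \<Longrightarrow> x \<in> P i \<Longrightarrow> y \<in> P j \<Longrightarrow> x < y"
    show ?case
    proof (rule schreier_SucI[of _ "\<lambda>i. P i \<inter> G" d])
      show "P i \<inter> G \<in> schreier \<xi>" if "i < d" for i 
        using Suc.IH[OF P(2)[OF that], of "P i \<inter> G"] by simp
      show "G = (\<Union>i<d. P i \<inter> G)" using P(1) Suc.prems(2) by auto
      show "d \<le> x" if "x \<in> G" for x using P(3) Suc.prems(2) that by auto
      show "x < y" if "i < j" "j < d" "x \<in> P i \<inter> G" "y \<in> P j \<inter> G" for i j x y
        using P(4)[OF that(1,2)] that(3,4) by simp
    qed
  qed
qed

lemma schreier_spread:
  assumes "F \<in> schreier \<xi>" "strict_mono_on F q" "\<And>x. x \<in> F \<Longrightarrow> x \<le> q x"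
  shows "q ` F \<in> schreier \<xi>"
  using assms
proof (induction \<xi> arbitrary: F)
  case 0
  then show ?case by (auto simp: schreier_0 intro: order.trans)
next
  case (Suc \<xi>)
  from Suc.prems(1) show ?case
  proof (rule schreier_SucE)
    fix d P assume P: "F = (\<Union>i<d. P i)" "\<And>i. i < d \<Longrightarrow> P i \<in> schreier \<xi>" "\<And>x. x \<in> F \<Longrightarrow> d \<le> x"
      "\<And>i j x y. i < j \<Longrightarrow> j < d \<Longrightarrow> x \<in> P i \<Longrightarrow> y \<in> P j \<Longrightarrow> x < y"
    have sub: "P i \<subseteq> F" if "i < d" for i using P(1) that by blast
    show ?case
    proof (rule schreier_SucI[of _ "\<lambda>i. q ` P i" d])
      show "q ` P i \<in> schreier \<xi>" if "i < d" for i
        using P(2)[OF that] sub[OF that] Suc.prems(2,3)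
        by (intro Suc.IH) (auto intro: monotone_on_subset)
      show "d \<le> x" if "x \<in> q ` F" for x
        using that P(3) Suc.prems(3) order.trans by blast
      show "x < y" if ij: "i < j" "j < d" and xy: "x \<in> q ` P i" "y \<in> q ` P j" for i j x y
      proof -
        obtain x' y' where x': "x = q x'" "y = q y'" "x' \<in> P i" "y' \<in> P j" using xy by blast
        moreover have "x' < y'" using P(4)[OF ij x'(3,4)] .
        moreover have "x' \<in> F" "y' \<in> F" using sub[of i] sub[of j] ij x' by auto
        ultimately show "x < y" using Suc.prems(2) by (simp add: strict_mono_onD)
      qed
    qed (use P(1) in blast)
  qed
qed

text \<open>A set is a single piece of itself; \<open>d = 1\<close> is admissible because 0 is
  excluded.\<close>

lemma schreier_Suc: "F \<in> schreier \<xi> \<Longrightarrow> F \<in> schreier (Suc \<xi>)"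
  using schreier_pos[of F \<xi>] by (intro schreier_SucI[of F "\<lambda>_. F" 1]) auto

lemma schreier_mono: "F \<in> schreier \<xi> \<Longrightarrow> \<xi> \<le> \<zeta> \<Longrightarrow> F \<in> schreier \<zeta>"
  by (rule lift_Suc_mono_le[of schreier, THEN subsetD]) (auto intro: schreier_Suc)

lemma schreier_singleton: "1 \<le> x \<Longrightarrow> {x} \<in> schreier \<xi>"
  by (rule schreier_mono[of _ 0]) (auto simp: schreier_0)

text \<open>Convolution of Schreier families: the number of pieces is bounded by points of
  \<open>T\<close>, and these lie below the sets \<open>B t\<close>. Additivity of orders is what
  later turns nested operations into a sum of terms \<open>\<rho> i * n i\<close>.\<close>

lemma schreier_union:
  assumes "T \<in> schreier \<xi>" "\<And>t. t \<in> T \<Longrightarrow> B t \<in> schreier \<zeta>"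
    and "\<And>t x. t \<in> T \<Longrightarrow> x \<in> B t \<Longrightarrow> t \<le> x"
    and "\<And>s t x y. s \<in> T \<Longrightarrow> t \<in> T \<Longrightarrow> s < t \<Longrightarrow> x \<in> B s \<Longrightarrow> y \<in> B t \<Longrightarrow> x < y"
  shows "(\<Union>t\<in>T. B t) \<in> schreier (\<xi> + \<zeta>)"
  using assms
proof (induction \<xi> arbitrary: T)
  case 0
  then show ?case by (auto simp: schreier_0)
next
  case (Suc \<xi>)
  from Suc.prems(1) show ?case
  proof (rule schreier_SucE)
    fix d P assume P: "T = (\<Union>i<d. P i)" "\<And>i. i < d \<Longrightarrow> P i \<in> schreier \<xi>" "\<And>x. x \<in> T \<Longrightarrow> d \<le> x"
      "\<And>i j x y. i < j \<Longrightarrow> j < d \<Longrightarrow> x \<in> P i \<Longrightarrow> y \<in> P j \<Longrightarrow> x < y"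
    have sub: "t \<in> T" if "i < d" "t \<in> P i" for i t using P(1) that by blast
    show ?case unfolding add_Suc
    proof (rule schreier_SucI[of _ "\<lambda>i. \<Union>t\<in>P i. B t" d])
      show "(\<Union>t\<in>P i. B t) \<in> schreier (\<xi> + \<zeta>)" if i: "i < d" for i
      proof (rule Suc.IH[OF P(2)[OF i]])
        show "B t \<in> schreier \<zeta>" if "t \<in> P i" for t using Suc.prems(2) sub[OF i that] .
        show "t \<le> x" if "t \<in> P i" "x \<in> B t" for t x using Suc.prems(3)[OF sub[OF i that(1)] that(2)] .
        show "x < y" if "s \<in> P i" "t \<in> P i" "s < t" "x \<in> B s" "y \<in> B t" for s t x y
          using Suc.prems(4)[OF sub[OF i that(1)] sub[OF i that(2)] that(3,4,5)] .
      qed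
      show "d \<le> x" if "x \<in> (\<Union>t\<in>T. B t)" for x
      proof -
        obtain t where t: "t \<in> T" "x \<in> B t" using \<open>x \<in> _\<close> by blast
        show ?thesis using P(3)[OF t(1)] Suc.prems(3)[OF t] by simp
      qed
      show "x < y" if ij: "i < j" "j < d" and xy: "x \<in> (\<Union>t\<in>P i. B t)" "y \<in> (\<Union>t\<in>P j. B t)" for i j x y
      proof -
        obtain s t where st: "s \<in> P i" "t \<in> P j" "x \<in> B s" "y \<in> B t" using xy by blast
        have "i < d" using ij by simp
        show "x < y"
          using Suc.prems(4)[OF sub[OF \<open>i < d\<close> st(1)] sub[OF ij(2) st(2)] P(4)[OF ij st(1,2)] st(3,4)] .
      qed
    qed (use P(1) in blast)
  qed
qed

section \<open>Special convex combinations\<close>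

lemma sum_UN_le:
  fixes f :: "'a \<Rightarrow> real"
  assumes "finite A" "\<And>i. i \<in> A \<Longrightarrow> finite (C i)" "\<And>k. 0 \<le> f k"
  shows "(\<Sum>k\<in>(\<Union>i\<in>A. C i). f k) \<le> (\<Sum>i\<in>A. \<Sum>k\<in>C i. f k)"
  using assms(1,2)
proof (induction A rule: finite_induct)
  case (insert i A)
  have "(\<Sum>k\<in>(\<Union>i\<in>insert i A. C i). f k) \<le> (\<Sum>k\<in>C i. f k) + (\<Sum>k\<in>(\<Union>i\<in>A. C i). f k)"
    using insert assms(3) by (simp add: sum_Un sum_nonneg)
  also have "\<dots> \<le> (\<Sum>k\<in>C i. f k) + (\<Sum>i\<in>A. \<Sum>k\<in>C i. f k)" using insert by simp
  finally show ?case using insert by simp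
qed simp

text \<open>Flattens a combination of combinations: the coefficient of \<open>k\<close> collects the
  contributions of all \<open>i\<close> with \<open>k \<in> E i\<close>.\<close>

lemma sum_UN_swap:
  fixes h :: "'i \<Rightarrow> 'k \<Rightarrow> 'b::comm_monoid_add"
  assumes "finite F" "\<And>i. i \<in> F \<Longrightarrow> finite (E i)"
  shows "(\<Sum>k\<in>(\<Union>i\<in>F. E i). \<Sum>i\<in>F. if k \<in> E i then h i k else 0) = (\<Sum>i\<in>F. \<Sum>k\<in>E i. h i k)"
proof (subst sum.swap, rule sum.cong[OF refl])
  fix i assume i: "i \<in> F"
  have "(\<Sum>k\<in>(\<Union>i\<in>F. E i). if k \<in> E i then h i k else 0)
      = (\<Sum>k\<in>E i. if k \<in> E i then h i k else 0)"
    using assms i by (intro sum.mono_neutral_right) auto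
  then show "(\<Sum>k\<in>(\<Union>i\<in>F. E i). if k \<in> E i then h i k else 0) = (\<Sum>k\<in>E i. h i k)" by simp
qed

lemma successive_less:
  fixes F :: "nat \<Rightarrow> nat set"
  assumes "\<And>i. F i \<noteq> {}" "\<And>i x y. x \<in> F i \<Longrightarrow> y \<in> F (Suc i) \<Longrightarrow> x < y"
    and "i < j" "x \<in> F i" "y \<in> F j"
  shows "x < y"
  using assms(3-)
proof (induction j arbitrary: y)
  case (Suc j)
  show ?case
  proof (cases "i = j")
    case True
    then show ?thesis using assms(2) Suc.prems by blast
  next
    case False
    obtain z where z: "z \<in> F j" using assms(1) by blast
    have "x < z" using Suc.IH[OF _ Suc.prems(2) z] Suc.prems(1) False by simp
    also have "z < y" using assms(2)[OF z Suc.prems(3)] .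
    finally show ?thesis .
  qed
qed simp

text \<open>Repeated averages: the uniform average of \<open>n\<close> successive special convex combinations of
  order \<open>\<xi>\<close>, each one chosen so small on order-\<open>\<xi>\<close> sets that the number of pieces of an
  order-\<open>\<xi> + 1\<close> set, which is controlled by the first block it meets, does not matter.\<close>

lemma special_convex:
  fixes q :: "nat \<Rightarrow> nat"
  assumes q: "strict_mono_on {1..} q" and "\<epsilon> > 0"
  shows "\<exists>F a. F \<in> schreier (Suc \<xi>) \<and> F \<noteq> {} \<and> (\<forall>k\<in>F. n0 < k) \<and> (\<forall>k. 0 \<le> a k) \<and>
     (\<forall>k. k \<notin> F \<longrightarrow> a k = 0) \<and> (\<Sum>k\<in>F. a k) = (1::real) \<and>
     (\<forall>G\<subseteq>F. q ` G \<in> schreier \<xi> \<longrightarrow> (\<Sum>k\<in>G. a k) \<le> \<epsilon>)"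
  using \<open>\<epsilon> > 0\<close>
proof (induction \<xi> arbitrary: \<epsilon> n0)
  case 0
  obtain n :: nat where n: "n > 0" "1 / real n < \<epsilon>"
    using 0 nat_approx_posE by (metis One_nat_def of_nat_Suc zero_less_Suc)
  \<comment> \<open>Lying beyond \<open>n\<close>, these \<open>n\<close> points may be split into
    \<open>n\<close> singletons, so the set has order 1; a test set of order 0 catches at most one
    of them, of mass \<open>1 / n\<close>.\<close>
  define F where "F = {n + n0 + 1..<n + n0 + 1 + n}"
  have cF: "card F = n" "finite F" unfolding F_def by auto
  show ?case
  proof (intro exI[of _ F] exI[of _ "\<lambda>k. if k \<in> F then 1 / real n else 0"] conjI)
    show "F \<in> schreier (Suc 0)"
    proof (rule schreier_SucI[of _ "\<lambda>i. {n + n0 + 1 + i}" n])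
      have "F = (\<lambda>i. n + n0 + 1 + i) ` {..<n}"
        unfolding F_def lessThan_atLeast0 by (subst image_add_atLeastLessThan) (simp add: ac_simps)
      then show "F = (\<Union>i<n. {n + n0 + 1 + i})" by auto
    qed (auto simp: F_def schreier_0)
    show "(\<Sum>k\<in>F. if k \<in> F then 1 / real n else 0) = 1" using cF n by simp
    show "\<forall>G\<subseteq>F. q ` G \<in> schreier 0 \<longrightarrow> (\<Sum>k\<in>G. if k \<in> F then 1 / real n else 0) \<le> \<epsilon>"
    proof (intro allI impI)
      fix G assume G: "G \<subseteq> F" "q ` G \<in> schreier 0"
      have "inj_on q G" using q G(1)
        by (intro strict_mono_on_imp_inj_on monotone_on_subset[OF q]) (auto simp: F_def)
      moreover have "card (q ` G) \<le> 1" using G(2) by (auto simp: schreier_0)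
      ultimately have "card G \<le> 1" by (simp add: card_image)
      moreover have "(\<Sum>k\<in>G. if k \<in> F then 1 / real n else 0) = (\<Sum>k\<in>G. 1 / real n)"
        using G by (intro sum.cong) auto
      moreover have "real (card G) * (1 / real n) \<le> 1 * (1 / real n)"
        using \<open>card G \<le> 1\<close> by (intro mult_right_mono) auto
      ultimately show "(\<Sum>k\<in>G. if k \<in> F then 1 / real n else 0) \<le> \<epsilon>" using n by simp
    qed
  qed (use n in \<open>auto simp: F_def\<close>)
next
  case (Suc \<xi>)
  obtain n :: nat where n: "n > 0" "1 / real n < \<epsilon> / 2"
    using Suc.prems nat_approx_posE[of "\<epsilon> / 2"] by (metis half_gt_zero of_nat_Suc zero_less_Suc)
  \<comment> \<open>Points beyond \<open>n\<close> leave room for a union of \<open>n\<close> blocks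
    in the next order.\<close>
  define P where "P = (\<lambda>(_::nat) (F, a). F \<in> schreier (Suc \<xi>) \<and> F \<noteq> {} \<and> (\<forall>k\<in>F. n + n0 < k) \<and>
     (\<forall>k. 0 \<le> a k) \<and> (\<forall>k. k \<notin> F \<longrightarrow> a k = 0) \<and> (\<Sum>k\<in>F. a k) = (1::real))"
  \<comment> \<open>A test set of order \<open>Suc \<xi>\<close> that starts at or before
    \<open>q x\<close> has at most \<open>q x\<close> pieces. The next block is so small on each
    piece that this number does not matter.\<close>
  define Q where "Q = (\<lambda>(_::nat) (F, a :: nat \<Rightarrow> real) (F', a'). (\<forall>x\<in>F. \<forall>y\<in>F'. x < y) \<and>
     (\<forall>x\<in>F. \<forall>G\<subseteq>F'. q ` G \<in> schreier \<xi> \<longrightarrow> real (q x) * (\<Sum>k\<in>G. a' k) \<le> \<epsilon> / 2))"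
  have "\<exists>Z. \<forall>i. P i (Z i) \<and> Q i (Z i) (Z (Suc i))"
  proof (rule dependent_nat_choice)
    obtain F a where "F \<in> schreier (Suc \<xi>)" "F \<noteq> {}" "\<forall>k\<in>F. n + n0 < k" "\<forall>k. 0 \<le> a k"
      "\<forall>k. k \<notin> F \<longrightarrow> a k = 0" "(\<Sum>k\<in>F. a k) = (1::real)"
      using Suc.IH[OF zero_less_one, of "n + n0"] by (elim exE conjE)
    then show "\<exists>x. P 0 x" unfolding P_def by (intro exI[of _ "(F, a)"]) simp
    fix x i assume "P i x"
    obtain F a where x: "x = (F, a)" by fastforce
    have FS: "F \<in> schreier (Suc \<xi>)" "F \<noteq> {}" using \<open>P i x\<close> unfolding x P_def by simp_all
    then have fF: "finite F" using schreier_finite by simp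
    define \<delta> where "\<delta> = \<epsilon> / 2 / (real (q (Max F)) + 1)"
    have "\<delta> > 0" using Suc.prems by (simp add: \<delta>_def)
    from Suc.IH[OF this, of "n + n0 + Max F"] obtain F' a' where F':
      "F' \<in> schreier (Suc \<xi>)" "F' \<noteq> {}" "\<forall>k\<in>F'. n + n0 + Max F < k" "\<forall>k. 0 \<le> a' k"
      "\<forall>k. k \<notin> F' \<longrightarrow> a' k = 0" "(\<Sum>k\<in>F'. a' k) = (1::real)"
      "\<forall>G\<subseteq>F'. q ` G \<in> schreier \<xi> \<longrightarrow> (\<Sum>k\<in>G. a' k) \<le> \<delta>" by (elim exE conjE)
    have "real (q z) * (\<Sum>k\<in>G. a' k) \<le> \<epsilon> / 2"
      if z: "z \<in> F" and G: "G \<subseteq> F'" "q ` G \<in> schreier \<xi>" for z G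
    proof -
      have "z \<le> Max F" "1 \<le> z" using Max_ge[OF fF z] schreier_pos[OF FS(1) z] by simp_all
      then have "q z \<le> q (Max F)" using q by (simp add: strict_mono_on_leD)
      then have "real (q z) * (\<Sum>k\<in>G. a' k) \<le> (real (q (Max F)) + 1) * \<delta>"
        using F'(4,7) G by (intro mult_mono sum_nonneg) simp_all
      also have "(real (q (Max F)) + 1) * \<delta> = \<epsilon> / 2"
        unfolding \<delta>_def by (subst times_divide_eq_right, rule nonzero_mult_div_cancel_left) linarith
      finally show ?thesis .
    qed
    moreover have "z < y" if "z \<in> F" "y \<in> F'" for z y
    proof -
      have "z \<le> Max F" "n + n0 + Max F < y" using that Max_ge[OF fF] F'(3) by simp_all
      then show ?thesis by simp
    qed
    moreover have "\<forall>k\<in>F'. n + n0 < k" using F'(3) by auto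
    ultimately have "P (Suc i) (F', a') \<and> Q i x (F', a')"
      using F' unfolding x P_def Q_def by simp
    then show "\<exists>y. P (Suc i) y \<and> Q i x y" by blast
  qed
  then obtain Z where Z: "\<And>i. P i (Z i)" "\<And>i. Q i (Z i) (Z (Suc i))" by blast
  define F where "F i = fst (Z i)" for i
  define b where "b i = snd (Z i)" for i
  have F: "F i \<in> schreier (Suc \<xi>)" "F i \<noteq> {}" "\<And>k. k \<in> F i \<Longrightarrow> n + n0 < k" "0 \<le> b i k"
    "k \<notin> F i \<Longrightarrow> b i k = 0" "(\<Sum>k\<in>F i. b i k) = 1" for i k
    using Z(1)[of i] unfolding P_def F_def b_def case_prod_beta by auto
  have step: "x < y" if "x \<in> F i" "y \<in> F (Suc i)" for i x y
    using Z(2)[of i] that unfolding Q_def F_def case_prod_beta by blast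
  have small: "real (q x) * (\<Sum>k\<in>G. b (Suc i) k) \<le> \<epsilon> / 2"
    if "x \<in> F i" "G \<subseteq> F (Suc i)" "q ` G \<in> schreier \<xi>" for i x G
    using Z(2)[of i] that unfolding Q_def F_def b_def case_prod_beta by blast
  have ord: "x < y" if "i < j" "x \<in> F i" "y \<in> F j" for i j x y
    using F(2) step that by (rule successive_less)
  have fin: "finite (F i)" for i using F(1) schreier_finite by blast
  define U where "U = (\<Union>i<n. F i)"
  define a where "a k = (\<Sum>i<n. b i k) / real n" for k
  have finU: "finite U" unfolding U_def using fin by blast
  have sum_a: "(\<Sum>k\<in>G. a k) = (\<Sum>i<n. \<Sum>k\<in>G \<inter> F i. b i k) / real n" if "G \<subseteq> U" for G
  proof -
    have finG: "finite G" using that finU finite_subset by blast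
    have "(\<Sum>k\<in>G. a k) = (\<Sum>i<n. \<Sum>k\<in>G. b i k) / real n"
      unfolding a_def sum_divide_distrib[symmetric] by (subst sum.swap) simp
    also have "(\<Sum>i<n. \<Sum>k\<in>G. b i k) = (\<Sum>i<n. \<Sum>k\<in>G \<inter> F i. b i k)"
      using finG F(5) by (intro sum.cong sum.mono_neutral_right) auto
    finally show ?thesis .
  qed
  have "(\<Sum>k\<in>G. a k) \<le> \<epsilon>" if G: "G \<subseteq> U" "q ` G \<in> schreier (Suc \<xi>)" for G
  proof (cases "G = {}")
    case True
    then show ?thesis using Suc.prems by simp
  next
    case False
    \<comment> \<open>The first block met is charged its whole mass 1, every later one at most
      \<open>\<epsilon> / 2\<close>. Dividing by \<open>n\<close>, with
      \<open>1 / n < \<epsilon> / 2\<close>, gives at most \<open>\<epsilon>\<close>.\<close>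
    define i0 where "i0 = (LEAST i. G \<inter> F i \<noteq> {})"
    have "\<exists>i. G \<inter> F i \<noteq> {}" using False G(1) unfolding U_def by blast
    then have i0: "G \<inter> F i0 \<noteq> {}" unfolding i0_def by (rule LeastI_ex)
    have before: "G \<inter> F i = {}" if "i < i0" for i
      using not_less_Least[of i "\<lambda>i. G \<inter> F i \<noteq> {}"] that unfolding i0_def by blast
    obtain d B where B: "q ` G = (\<Union>l<d. B l)" "\<And>l. l < d \<Longrightarrow> B l \<in> schreier \<xi>" "\<And>x. x \<in> q ` G \<Longrightarrow> d \<le> x"
      using schreier_SucE[OF G(2)] by metis
    have late: "(\<Sum>k\<in>G \<inter> F i. b i k) \<le> \<epsilon> / 2" if i: "i0 < i" for i
    proof -
      obtain i' where i': "i = Suc i'" using i by (cases i) auto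
      obtain z where z: "z \<in> G" "z \<in> F i0" using i0 by blast
      \<comment> \<open>Smallness was arranged between consecutive blocks only, so \<open>z\<close>
        is replaced by a point of the immediate predecessor of block \<open>i\<close>; since
        \<open>q z \<le> q x\<close>, \<open>q x\<close> still bounds the number of pieces.\<close>
      obtain x where x: "x \<in> F i'" "z \<le> x"
      proof (cases "i0 = i'")
        case True
        then show ?thesis using that z by blast
      next
        case False
        then have "i0 < i'" using i i' by simp
        moreover obtain x where "x \<in> F i'" using F(2) by blast
        ultimately show ?thesis using that ord z(2) less_imp_le by metis
      qed
      have "z \<ge> 1" using F(3)[OF z(2)] by simp
      then have "q z \<le> q x" using q x(2) by (simp add: strict_mono_on_leD)
      then have d: "real d \<le> real (q x)" using B(3) z(1) by fastforce
      define C where "C l = {k \<in> G \<inter> F i. q k \<in> B l}" for l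
      have finC: "finite (C l)" for l unfolding C_def using fin by simp
      have C: "real (q x) * (\<Sum>k\<in>C l. b i k) \<le> \<epsilon> / 2" if "l < d" for l
      proof -
        have "q ` C l \<in> schreier \<xi>"
          by (rule schreier_subset[OF B(2)[OF that]]) (auto simp: C_def)
        moreover have "C l \<subseteq> F (Suc i')" by (auto simp: C_def i')
        ultimately show ?thesis unfolding i' by (intro small[OF x(1)])
      qed
      have "(\<Sum>k\<in>G \<inter> F i. b i k) = (\<Sum>k\<in>(\<Union>l<d. C l). b i k)"
        using B(1) by (intro sum.cong) (auto simp: C_def)
      also have "\<dots> \<le> (\<Sum>l<d. \<Sum>k\<in>C l. b i k)"
        using finC F(4) by (intro sum_UN_le) auto
      finally have le: "(\<Sum>k\<in>G \<inter> F i. b i k) \<le> (\<Sum>l<d. \<Sum>k\<in>C l. b i k)" .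
      show ?thesis
      proof (cases "d = 0")
        case True
        then show ?thesis using le Suc.prems by simp
      next
        case False
        have "real (q x) * (\<Sum>k\<in>G \<inter> F i. b i k) \<le> (\<Sum>l<d. real (q x) * (\<Sum>k\<in>C l. b i k))"
          unfolding sum_distrib_left[symmetric] using le by (intro mult_left_mono) auto
        also have "\<dots> \<le> real d * (\<epsilon> / 2)"
          using sum_bounded_above[of "{..<d}" _ "\<epsilon> / 2"] C by simp
        also have "\<dots> \<le> real (q x) * (\<epsilon> / 2)" using d Suc.prems by (intro mult_right_mono) auto
        finally show ?thesis using d False by simp
      qed
    qed
    have "(\<Sum>i<n. \<Sum>k\<in>G \<inter> F i. b i k) \<le> (\<Sum>i<n. (if i = i0 then 1 else 0) + \<epsilon> / 2)"
    proof (rule sum_mono)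
      fix i
      consider "i < i0" | "i = i0" | "i0 < i" by linarith
      then show "(\<Sum>k\<in>G \<inter> F i. b i k) \<le> (if i = i0 then 1 else 0) + \<epsilon> / 2"
      proof cases
        case 2
        have "(\<Sum>k\<in>G \<inter> F i. b i k) \<le> (\<Sum>k\<in>F i. b i k)"
          using fin F(4) by (intro sum_mono2) auto
        then show ?thesis using 2 F(6) Suc.prems by simp
      qed (use late before Suc.prems in auto)
    qed
    also have "\<dots> \<le> 1 + real n * (\<epsilon> / 2)" by (simp add: sum.distrib)
    finally have "(\<Sum>k\<in>G. a k) \<le> (1 + real n * (\<epsilon> / 2)) / real n"
      unfolding sum_a[OF G(1)] by (intro divide_right_mono) auto
    also have "\<dots> \<le> \<epsilon>" using n by (simp add: field_simps)
    finally show ?thesis .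
  qed
  moreover have "U \<in> schreier (Suc (Suc \<xi>))" 
  proof (rule schreier_SucI[of _ F n])
    show "n \<le> x" if "x \<in> U" for x using F(3) that unfolding U_def by fastforce
    show "x < y" if "i < j" "j < n" "x \<in> F i" "y \<in> F j" for i j x y
      using ord[OF that(1,3,4)] .
  qed (use F(1) U_def in simp_all)
  moreover have "U \<noteq> {}" using F(2) n(1) unfolding U_def by blast
  moreover have "\<forall>k\<in>U. n0 < k" using F(3) unfolding U_def by fastforce
  moreover have "0 \<le> a k" for k using F(4) unfolding a_def by (simp add: sum_nonneg)
  moreover have "a k = 0" if "k \<notin> U" for k using F(5) that unfolding a_def U_def by simp
  moreover have "(\<Sum>k\<in>U. a k) = 1"
  proof -
    have "(\<Sum>k\<in>U \<inter> F i. b i k) = 1" if "i < n" for i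
    proof -
      have "U \<inter> F i = F i" using that unfolding U_def by blast
      then show ?thesis using F(6) by simp
    qed
    then show ?thesis using sum_a[of U] n by simp
  qed
  ultimately show ?case by (intro exI[of _ U] exI[of _ a]) blast
qed

section \<open>The norming measures\<close>

text \<open>The points of \<open>T\<close> need not be the minima of the supports of the \<open>h t\<close>, only lower bounds; as
  Schreier families are spreading, this gives the same operation. Together with the coefficient 0
  below, it makes the measures closed under restriction to arbitrary sets.\<close>

definition placed :: "nat set \<Rightarrow> (nat \<Rightarrow> nat \<Rightarrow> real) \<Rightarrow> bool" where
  "placed T h \<longleftrightarrow> (\<forall>t\<in>T. \<forall>k. h t k \<noteq> 0 \<longrightarrow> t \<le> k \<and> (\<forall>s\<in>T. t < s \<longrightarrow> k < s))"

inductive meas :: "(nat \<Rightarrow> nat) \<Rightarrow> (nat \<Rightarrow> nat) \<Rightarrow> (nat \<Rightarrow> real) \<Rightarrow> bool" for m n where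
  point: "i \<ge> 1 \<Longrightarrow> c \<in> {-1, 0, 1} \<Longrightarrow> meas m n (\<lambda>k. if k = i then c else 0)"
| oper: "i \<ge> 1 \<Longrightarrow> T \<in> schreier (n i) \<Longrightarrow> placed T h \<Longrightarrow> (\<And>t. t \<in> T \<Longrightarrow> meas m n (h t)) \<Longrightarrow>
    meas m n (\<lambda>k. (\<Sum>t\<in>T. h t k) / real (m i))"

text \<open>Existential because one measure can have several representations, the zero measure even
  one for each weight; an estimate for \<open>weighted\<close> covers them all.\<close>

definition weighted :: "(nat \<Rightarrow> nat) \<Rightarrow> (nat \<Rightarrow> nat) \<Rightarrow> nat \<Rightarrow> (nat \<Rightarrow> real) \<Rightarrow> bool" where
  "weighted m n i g \<longleftrightarrow> (\<exists>T h. T \<in> schreier (n i) \<and> placed T h \<and> (\<forall>t\<in>T. meas m n (h t)) \<and>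
     g = (\<lambda>k. (\<Sum>t\<in>T. h t k) / real (m i)))"

lemma weighted_meas: "weighted m n i g \<Longrightarrow> 1 \<le> i \<Longrightarrow> meas m n g"
  unfolding weighted_def using meas.oper by blast

text \<open>If no point of \<open>T\<close> lies in the interval after its left end, only the
  summand of the last point of \<open>T\<close> up to there can live on the interval. With
  \<open>a = b = k\<close> this says that supports are disjoint.\<close>

lemma placed_sum_eq:
  assumes h: "placed T h" and fin: "finite T" and gap: "\<And>s. s \<in> T \<Longrightarrow> a < s \<Longrightarrow> b < s"
    and k: "a \<le> k" "k \<le> b"
  shows "(\<Sum>s\<in>T. h s k) = (if {s \<in> T. s \<le> a} = {} then 0 else h (Max {s \<in> T. s \<le> a}) k)"
proof -
  let ?S = "{s \<in> T. s \<le> a}"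
  have le: "s \<in> ?S" if "s \<in> T" "h s k \<noteq> 0" for s
  proof -
    have "s \<le> k" using h that unfolding placed_def by simp
    then have "s \<le> a" using gap[OF that(1)] k(2) by (cases "a < s") simp_all
    then show ?thesis using that by simp
  qed
  show ?thesis
  proof (cases "?S = {}")
    case True
    then have "h s k = 0" if "s \<in> T" for s using le[OF that] by blast
    then show ?thesis using True by simp
  next
    case False
    have finS: "finite ?S" using fin by simp
    have t: "Max ?S \<in> ?S" using finS False by (rule Max_in)
    have "h s k = 0" if s: "s \<in> T - {Max ?S}" for s
    proof (rule ccontr)
      assume nz: "h s k \<noteq> 0"
      then have "s \<in> ?S" using le s by blast
      then have "s \<le> Max ?S" using finS by simp
      then have "s < Max ?S" using s by simp
      then have "k < Max ?S" using h nz s t unfolding placed_def by blast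
      then show False using t k by simp
    qed
    then have "(\<Sum>s\<in>T - {Max ?S}. h s k) = 0" by (intro sum.neutral) blast
    moreover have "(\<Sum>s\<in>T. h s k) = h (Max ?S) k + (\<Sum>s\<in>T - {Max ?S}. h s k)"
      using t fin by (intro sum.remove) auto
    ultimately show ?thesis unfolding if_not_P[OF False] by simp
  qed
qed

lemma placed_sum_bound:
  assumes "placed T h" "finite T" "\<And>t k. t \<in> T \<Longrightarrow> \<bar>h t k\<bar> \<le> 1"
  shows "\<bar>\<Sum>s\<in>T. h s k\<bar> \<le> 1"
proof (cases "{s \<in> T. s \<le> k} = {}")
  case True
  then show ?thesis using placed_sum_eq[OF assms(1,2), of k k k] by simp
next
  case False
  then have "Max {s \<in> T. s \<le> k} \<in> {s \<in> T. s \<le> k}" using assms(2) by (intro Max_in) auto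
  then have "Max {s \<in> T. s \<le> k} \<in> T" by simp
  then show ?thesis using placed_sum_eq[OF assms(1,2), of k k k] False assms(3) by simp
qed

lemma meas_bound:
  assumes "meas m n g" and m: "\<And>i. 1 \<le> i \<Longrightarrow> 1 \<le> m i"
  shows "\<bar>g k\<bar> \<le> 1"
  using assms(1)
proof (induction arbitrary: k rule: meas.induct)
  case (oper i T h)
  have "\<bar>\<Sum>t\<in>T. h t k\<bar> \<le> 1"
    using oper by (intro placed_sum_bound schreier_finite[of T "n i"]) simp_all
  moreover have "1 \<le> real (m i)" using m[OF oper(1)] by simp
  ultimately show ?case by (simp add: divide_le_eq)
qed auto

text \<open>Why heavy weights are harmless on a fixed vector: all point masses are small at once,
  and \<open>coef_bound\<close> transfers this to the functional.\<close>

lemma weighted_bound: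
  assumes "weighted m n i g" and "\<And>i. 1 \<le> i \<Longrightarrow> 1 \<le> m i"
  shows "\<bar>g k\<bar> \<le> 1 / real (m i)"
proof -
  obtain T h where T: "T \<in> schreier (n i)" "placed T h" "\<forall>t\<in>T. meas m n (h t)"
    "g = (\<lambda>k. (\<Sum>t\<in>T. h t k) / real (m i))"
    using assms(1) unfolding weighted_def by (elim exE conjE)
  have "\<bar>\<Sum>t\<in>T. h t k\<bar> \<le> 1"
    using T(2) schreier_finite[OF T(1)]
    by (rule placed_sum_bound) (rule meas_bound[OF T(3)[rule_format] assms(2)])
  then show ?thesis unfolding T(4) by (simp add: divide_right_mono)
qed

lemma meas_finite: "meas m n g \<Longrightarrow> finite {k. g k \<noteq> 0} \<and> g 0 = 0"
proof (induction rule: meas.induct)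
  case (point i c)
  have "{k. (if k = i then c else 0) \<noteq> 0} \<subseteq> {i}" by auto
  then show ?case using point by (auto intro: finite_subset)
next
  case (oper i T h)
  have "{k. (\<Sum>t\<in>T. h t k) / real (m i) \<noteq> 0} \<subseteq> (\<Union>t\<in>T. {k. h t k \<noteq> 0})"
    by (auto elim: sum.not_neutral_contains_not_neutral)
  moreover have "finite (\<Union>t\<in>T. {k. h t k \<noteq> 0})"
    using oper schreier_finite[of T "n i"] by auto
  ultimately show ?case using oper by (auto intro: finite_subset)
qed

text \<open>Multipliers can be pushed down the tree to the leaves, where the coefficients -1, 0 and
  1 are available. Signs give symmetry and unconditionality, indicators give restrictions and
  bimonotonicity.\<close>

lemma meas_mult:
  assumes "meas m n g" and s: "\<And>k. \<sigma> k \<in> {-1, 0, 1}"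
  shows "meas m n (\<lambda>k. \<sigma> k * g k)"
  using assms(1)
proof (induction rule: meas.induct)
  case (point i c)
  have "meas m n (\<lambda>k. if k = i then \<sigma> i * c else 0)"
    using point s[of i] by (intro meas.point) auto
  moreover have "(\<lambda>k. if k = i then \<sigma> i * c else 0) = (\<lambda>k. \<sigma> k * (if k = i then c else 0))" by auto
  ultimately show ?case by simp
next
  case (oper i T h)
  have "meas m n (\<lambda>k. (\<Sum>t\<in>T. (\<lambda>t k. \<sigma> k * h t k) t k) / real (m i))"
    using oper by (intro meas.oper) (auto simp: placed_def)
  moreover have "(\<lambda>k. (\<Sum>t\<in>T. (\<lambda>t k. \<sigma> k * h t k) t k) / real (m i))
      = (\<lambda>k. \<sigma> k * ((\<Sum>t\<in>T. h t k) / real (m i)))"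
    by (simp add: sum_distrib_left)
  ultimately show ?case by simp
qed

section \<open>Spaces normed by the measures\<close>

text \<open>Isolates what the estimates use of the completion: the functional
  \<open>\<phi> g\<close> of a measure, its values on the basis, and norming on finite combinations.
  The strict \<open>c < norm x\<close> allows for a supremum that is not attained.\<close>

locale tree_space =
  fixes m n :: "nat \<Rightarrow> nat" and e :: "nat \<Rightarrow> 'a::{real_normed_vector, complete_space}"
    and \<phi> :: "(nat \<Rightarrow> real) \<Rightarrow> 'a \<Rightarrow> real"
  assumes m_ge: "1 \<le> i \<Longrightarrow> 2 \<le> m i"
    and m_less: "1 \<le> i \<Longrightarrow> i < j \<Longrightarrow> m i < m j"
    and lin: "meas m n g \<Longrightarrow> linear (\<phi> g)"
    and phi_e: "meas m n g \<Longrightarrow> 1 \<le> i \<Longrightarrow> \<phi> g (e i) = g i"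
    and phi_le: "meas m n g \<Longrightarrow> \<bar>\<phi> g x\<bar> \<le> norm x"
    and norming: "x \<in> span (e ` {1..}) \<Longrightarrow> c < norm x \<Longrightarrow> \<exists>g. meas m n g \<and> c < \<phi> g x"
begin

text \<open>Supports are recorded by intervals that may be larger than necessary, and vectors may
  vanish; the index set is arbitrary so that subfamilies are again \<open>blocks\<close>.\<close>

definition blocks :: "nat set \<Rightarrow> (nat \<Rightarrow> nat) \<Rightarrow> (nat \<Rightarrow> nat) \<Rightarrow> (nat \<Rightarrow> 'a) \<Rightarrow> bool" where
  "blocks K lo hi x \<longleftrightarrow> (\<forall>k\<in>K. 1 \<le> lo k \<and> lo k \<le> hi k \<and> x k \<in> span (e ` {lo k..hi k})) \<and>
     (\<forall>k\<in>K. \<forall>l\<in>K. k < l \<longrightarrow> hi k < lo l)"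

lemma blocksD:
  assumes "blocks K lo hi x" "k \<in> K"
  shows "1 \<le> lo k" "lo k \<le> hi k" "x k \<in> span (e ` {lo k..hi k})"
    "l \<in> K \<Longrightarrow> k < l \<Longrightarrow> hi k < lo l"
  using assms unfolding blocks_def by simp_all

lemma blocks_subset: "blocks K lo hi x \<Longrightarrow> K' \<subseteq> K \<Longrightarrow> blocks K' lo hi x"
  unfolding blocks_def by (meson subsetD)

lemma blocks_hi_mono: "blocks {1..} lo hi x \<Longrightarrow> strict_mono_on {1..} hi"
proof (rule strict_mono_onI)
  fix k l :: nat assume bl: "blocks {1..} lo hi x" and "k \<in> {1..}" "l \<in> {1..}" "k < l"
  then show "hi k < hi l" using blocksD(4)[OF bl, of k l] blocksD(2)[OF bl, of l] by simp
qed

lemma m_pos: "1 \<le> i \<Longrightarrow> 0 < real (m i)" and m_one: "1 \<le> i \<Longrightarrow> 1 \<le> m i"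
  using m_ge[of i] by simp_all

lemma m_le: "1 \<le> i \<Longrightarrow> i \<le> j \<Longrightarrow> m i \<le> m j"
  using m_less[of i j] by (cases "i = j") simp_all

lemma phi_scale: "meas m n g \<Longrightarrow> \<phi> g (c *\<^sub>R x) = c * \<phi> g x"
  using lin[of g] by (simp add: linear_scale)

lemma phi_sum: "meas m n g \<Longrightarrow> \<phi> g (\<Sum>k\<in>I. a k *\<^sub>R x k) = (\<Sum>k\<in>I. a k * \<phi> g (x k))"
  using lin[of g] by (simp add: linear_sum linear_scale)

lemma phi_cong:
  assumes "meas m n g" "meas m n g'" "x \<in> span (e ` I)" "\<And>i. i \<in> I \<Longrightarrow> 1 \<le> i"
    and "\<And>i. i \<in> I \<Longrightarrow> g i = c * g' i"
  shows "\<phi> g x = c * \<phi> g' x"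
proof (rule linear_eq_on[where f = "\<phi> g" and g = "\<lambda>x. c * \<phi> g' x"])
  show "linear (\<phi> g)" using assms(1) by (rule lin)
  show "linear (\<lambda>x. c * \<phi> g' x)"
    using lin[OF assms(2)] by (intro linearI) (simp_all add: linear_add linear_scale algebra_simps)
  show "x \<in> span (e ` I)" by fact
  show "\<phi> g b = c * \<phi> g' b" if "b \<in> e ` I" for b
    using that assms phi_e by auto
qed

lemma phi_zero:
  assumes "meas m n g" "x \<in> span (e ` I)" "\<And>i. i \<in> I \<Longrightarrow> 1 \<le> i" "\<And>i. i \<in> I \<Longrightarrow> g i = 0"
  shows "\<phi> g x = 0"
  using phi_cong[OF assms(1,1,2,3), of 0] assms(4) by simp

lemma norm_leI:
  assumes "x \<in> span (e ` {1..})" "\<And>g. meas m n g \<Longrightarrow> \<phi> g x \<le> c"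
  shows "norm x \<le> c"
  using norming[OF assms(1), of c] assms(2) by (meson not_le)

lemma span_mono1: "x \<in> span (e ` {a..b}) \<Longrightarrow> 1 \<le> a \<Longrightarrow> x \<in> span (e ` {1..})"
  by (rule subsetD[OF span_mono]) auto

lemma norm_sum_le:
  assumes "\<And>k. k \<in> I \<Longrightarrow> 0 \<le> a k \<and> norm (x k) \<le> 1"
  shows "norm (\<Sum>k\<in>I. a k *\<^sub>R x k) \<le> (\<Sum>k\<in>I. a k)"
proof (rule sum_norm_le)
  fix k assume "k \<in> I"
  then show "norm (a k *\<^sub>R x k) \<le> a k" using assms[of k] by (simp add: mult_left_le)
qed

text \<open>Take almost norming measures of the blocks, cut to their intervals and signed like the
  coefficients. Their left ends form a spreading of \<open>F\<close>, so one operation of weight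
  \<open>m j\<close> joins them.\<close>

lemma lower_l1:
  assumes j: "1 \<le> j" and F: "F \<in> schreier (n j)" and bl: "blocks F lo hi x"
    and lo: "\<And>k. k \<in> F \<Longrightarrow> k \<le> lo k"
  shows "(\<Sum>k\<in>F. \<bar>a k\<bar> * norm (x k)) / real (m j) \<le> norm (\<Sum>k\<in>F. a k *\<^sub>R x k)"
proof (rule field_le_epsilon)
  fix \<epsilon> :: real assume "0 < \<epsilon>"
  define C where "C = (\<Sum>k\<in>F. \<bar>a k\<bar>) / real (m j)"
  have C0: "0 \<le> C" unfolding C_def by (simp add: sum_nonneg)
  \<comment> \<open>Accuracy of the almost norming measures: the accumulated error is
    \<open>C * \<eta>\<close>, and \<open>C + 1\<close> is positive even if all coefficients
    vanish.\<close>
  define \<eta> where "\<eta> = \<epsilon> / (C + 1)"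
  have \<eta>: "0 < \<eta>" "C * \<eta> \<le> \<epsilon>" using \<open>0 < \<epsilon>\<close> C0 by (auto simp: \<eta>_def field_simps)
  have mono: "lo k < lo l" if "k \<in> F" "l \<in> F" "k < l" for k l
    using blocksD(2)[OF bl that(1)] blocksD(4)[OF bl that(1) that(2,3)] by simp
  have sm: "strict_mono_on F lo" using mono by (rule strict_mono_onI)
  then have inj: "inj_on lo F" by (rule strict_mono_on_imp_inj_on)
  have "\<exists>g. meas m n g \<and> norm (x k) - \<eta> < \<phi> g (x k)" if "k \<in> F" for k
    using span_mono1[OF blocksD(3,1)[OF bl that]] \<eta>(1) by (intro norming) simp_all
  then obtain g where g: "\<And>k. k \<in> F \<Longrightarrow> meas m n (g k)"
    "\<And>k. k \<in> F \<Longrightarrow> norm (x k) - \<eta> < \<phi> (g k) (x k)" by metis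
  define h' where "h' k = (\<lambda>i. (if i \<in> {lo k..hi k} then sgn (a k) else 0) * g k i)" for k
  \<comment> \<open>An operation indexes its measures by the points of its Schreier set, here the
    left ends, so the block is recovered from its left end.\<close>
  define h where "h t = h' (inv_into F lo t)" for t
  have h_lo: "h (lo k) = h' k" if "k \<in> F" for k unfolding h_def using inj that by simp
  have h': "meas m n (h' k)" if "k \<in> F" for k unfolding h'_def
    by (rule meas_mult[OF g(1)[OF that]]) (auto simp: sgn_if)
  have placed: "placed (lo ` F) h" unfolding placed_def
  proof (intro ballI allI impI)
    fix t i assume t: "t \<in> lo ` F" and nz: "h t i \<noteq> 0"
    then obtain k where k: "k \<in> F" "t = lo k" by blast
    then have i: "lo k \<le> i" "i \<le> hi k" using nz h_lo[OF k(1)] by (auto simp: h'_def split: if_splits)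
    have "i < s" if s: "s \<in> lo ` F" "t < s" for s
    proof -
      obtain l where l: "l \<in> F" "s = lo l" using s by blast
      have "\<not> l \<le> k" using mono[OF l(1) k(1)] s(2) l(2) k(2) by (cases "l = k") auto
      then show ?thesis using blocksD(4)[OF bl k(1) l(1)] i l by simp
    qed
    then show "t \<le> i \<and> (\<forall>s\<in>lo ` F. t < s \<longrightarrow> i < s)" using i k by simp
  qed
  define G where "G = (\<lambda>i. (\<Sum>t\<in>lo ` F. h t i) / real (m j))"
  have G: "meas m n G" unfolding G_def
  proof (rule meas.oper[OF j _ placed])
    show "lo ` F \<in> schreier (n j)" using F sm lo by (rule schreier_spread)
    show "meas m n (h t)" if "t \<in> lo ` F" for t using that h' h_lo by auto
  qed
  have finF: "finite F" using F by (rule schreier_finite)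
  have Gx: "\<phi> G (x k) = sgn (a k) / real (m j) * \<phi> (g k) (x k)" if k: "k \<in> F" for k
  proof (rule phi_cong[OF G g(1)[OF k] blocksD(3)[OF bl k]])
    show "1 \<le> i" if "i \<in> {lo k..hi k}" for i using that blocksD(1)[OF bl k] by simp
    show "G i = sgn (a k) / real (m j) * g k i" if i: "i \<in> {lo k..hi k}" for i
    proof -
      have "h' l i = 0" if l: "l \<in> F - {k}" for l
      proof -
        have "i \<notin> {lo l..hi l}"
        proof (cases "l < k")
          case True
          then show ?thesis using blocksD(4)[OF bl _ k, of l] l i by auto
        next
          case False
          then have "k < l" using l by auto
          then show ?thesis using blocksD(4)[OF bl k, of l] l i by auto
        qed
        then show ?thesis unfolding h'_def by (simp only: if_False mult_zero_left)
      qed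
      then have "(\<Sum>l\<in>F - {k}. h' l i) = 0" by (intro sum.neutral) blast
      moreover have "(\<Sum>t\<in>lo ` F. h t i) = (\<Sum>l\<in>F. h' l i)"
        using inj h_lo by (simp add: sum.reindex)
      moreover have "(\<Sum>l\<in>F. h' l i) = h' k i + (\<Sum>l\<in>F - {k}. h' l i)"
        using finF k by (rule sum.remove)
      ultimately have "G i = h' k i / real (m j)" unfolding G_def by simp
      then show ?thesis using i unfolding h'_def by simp
    qed
  qed
  have "(\<Sum>k\<in>F. \<bar>a k\<bar> * norm (x k)) / real (m j) - C * \<eta>
      = (\<Sum>k\<in>F. \<bar>a k\<bar> / real (m j) * (norm (x k) - \<eta>))"
    unfolding C_def right_diff_distrib sum_subtractf sum_divide_distrib sum_distrib_right by simp
  also have "\<dots> \<le> (\<Sum>k\<in>F. a k * \<phi> G (x k))"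
  proof (rule sum_mono)
    fix k assume k: "k \<in> F"
    have "\<bar>a k\<bar> / real (m j) * (norm (x k) - \<eta>) \<le> \<bar>a k\<bar> / real (m j) * \<phi> (g k) (x k)"
      using g(2)[OF k] by (intro mult_left_mono) simp_all
    also have "\<dots> = a k * \<phi> G (x k)" unfolding Gx[OF k]
      by (simp add: abs_sgn)
    finally show "\<bar>a k\<bar> / real (m j) * (norm (x k) - \<eta>) \<le> a k * \<phi> G (x k)" .
  qed
  also have "\<dots> = \<phi> G (\<Sum>k\<in>F. a k *\<^sub>R x k)" by (rule phi_sum[OF G, symmetric])
  also have "\<dots> \<le> norm (\<Sum>k\<in>F. a k *\<^sub>R x k)" using phi_le[OF G] by (simp add: abs_le_iff)
  finally show "(\<Sum>k\<in>F. \<bar>a k\<bar> * norm (x k)) / real (m j) \<le> norm (\<Sum>k\<in>F. a k *\<^sub>R x k) + \<epsilon>"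
    using \<eta>(2) by simp
qed

text \<open>Disjoint intervals contain different points of \<open>T\<close>; moving the last one in
  each cut block to the right end is a spreading. Left ends would go the wrong way, which is why
  special convex combinations are tested along \<open>hi\<close>.\<close>

lemma split_schreier:
  assumes T: "T \<in> schreier \<xi>" and bl: "blocks F lo hi x"
  shows "hi ` {k \<in> F. \<exists>t\<in>T. lo k < t \<and> t \<le> hi k} \<in> schreier \<xi>"
proof -
  define S where "S k = {t \<in> T. lo k < t \<and> t \<le> hi k}" for k
  define G where "G = {k \<in> F. S k \<noteq> {}}"
  have finS: "finite (S k)" for k unfolding S_def using schreier_finite[OF T] by simp
  have mx: "Max (S k) \<in> T" "lo k < Max (S k)" "Max (S k) \<le> hi k" if "k \<in> G" for k
  proof -
    have "Max (S k) \<in> S k" using finS that unfolding G_def by (intro Max_in) simp_all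
    then show "Max (S k) \<in> T" "lo k < Max (S k)" "Max (S k) \<le> hi k" unfolding S_def by simp_all
  qed
  define B where "B t = {hi k |k. k \<in> G \<and> Max (S k) = t}" for t
  have uniq: "k = l" if "k \<in> G" "l \<in> G" "Max (S k) = Max (S l)" for k l
  proof (rule ccontr)
    have *: "False" if "k \<in> G" "l \<in> G" "Max (S k) = Max (S l)" "k < l" for k l
    proof -
      have "hi k < lo l" using blocksD(4)[OF bl, of k l] that unfolding G_def by simp
      then show False using mx(3)[OF that(1)] mx(2)[OF that(2)] that(3) by simp
    qed
    assume "k \<noteq> l"
    then show False using *[of k l] *[of l k] that by (cases "k < l") simp_all
  qed
  have nxt: "y < s" if "s \<in> T" "t < s" "y \<in> B t" for s t y
  proof (rule ccontr)
    from that(3) obtain k where k: "k \<in> G" "Max (S k) = t" "y = hi k" unfolding B_def by blast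
    assume "\<not> y < s"
    then have "s \<in> S k" using that mx(2)[OF k(1)] k(2,3) unfolding S_def by simp
    then have "s \<le> t" using Max_ge[OF finS] k(2) by auto
    then show False using that(2) by simp
  qed
  have ge: "t \<le> y" if "y \<in> B t" for t y using mx(3) that unfolding B_def by blast
  \<comment> \<open>With order 0 for each \<open>B t\<close> the union lemma acts as a spreading;
    points of \<open>T\<close> that are not last in a block contribute the empty set.\<close>
  have "(\<Union>t\<in>T. B t) \<in> schreier (\<xi> + 0)"
  proof (rule schreier_union[OF T _ ge])
    fix t
    show "B t \<in> schreier 0"
    proof (cases "B t = {}")
      case False
      then obtain k where k: "k \<in> G" "Max (S k) = t" unfolding B_def by blast
      then have "B t = {hi k}" using uniq unfolding B_def by blast
      moreover have "1 \<le> hi k" using blocksD(1,2)[OF bl, of k] k unfolding G_def by simp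
      ultimately show ?thesis unfolding schreier_0 by blast
    qed simp
    show "x < y" if "t \<in> T" "s < t" "x \<in> B s" "y \<in> B t" for s x y
      using nxt[OF that(1,2,3)] ge[OF that(4)] by simp
  qed
  moreover have "(\<Union>t\<in>T. B t) = hi ` G" using mx(1) unfolding B_def by blast
  moreover have "G = {k \<in> F. \<exists>t\<in>T. lo k < t \<and> t \<le> hi k}" unfolding G_def S_def by blast
  ultimately show ?thesis by simp
qed

text \<open>By \<open>placed_sum_eq\<close> a block that is not cut sees at most one of the measures
  \<open>h t\<close>. Below a node the blocks therefore fall into the cut ones, the families
  \<open>J t\<close> passed on to \<open>h t\<close>, and those that \<open>g\<close>
  annihilates.\<close>

lemma oper_split:
  assumes i: "1 \<le> i" and T: "T \<in> schreier (n i)" and h: "placed T h" "\<And>t. t \<in> T \<Longrightarrow> meas m n (h t)"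
    and g: "g = (\<lambda>k. (\<Sum>t\<in>T. h t k) / real (m i))" and bl: "blocks I lo hi x"
  obtains I0 J where "I0 \<subseteq> I" "hi ` I0 \<in> schreier (n i)" "\<And>t. J t \<subseteq> I - I0"
    "\<And>s t. s \<noteq> t \<Longrightarrow> J s \<inter> J t = {}"
    "\<And>t k. t \<in> T \<Longrightarrow> k \<in> J t \<Longrightarrow> t \<le> hi k \<and> (\<forall>s\<in>T. t < s \<longrightarrow> hi k < s)"
    "\<And>t k. t \<in> T \<Longrightarrow> k \<in> J t \<Longrightarrow> \<phi> g (x k) = \<phi> (h t) (x k) / real (m i)"
    "\<And>k. k \<in> I - I0 \<Longrightarrow> k \<notin> (\<Union>t\<in>T. J t) \<Longrightarrow> \<phi> g (x k) = 0"
proof -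
  define I0 where "I0 = {k \<in> I. \<exists>t\<in>T. lo k < t \<and> t \<le> hi k}"
  define S where "S k = {s \<in> T. s \<le> lo k}" for k
  define J where "J t = {k \<in> I - I0. S k \<noteq> {} \<and> Max (S k) = t}" for t
  have gm: "meas m n g" unfolding g using i T h by (rule meas.oper)
  have finT: "finite T" using T by (rule schreier_finite)
  have finS: "finite (S k)" for k unfolding S_def using finT by simp
  have gap: "hi k < s" if "k \<in> I - I0" "s \<in> T" "lo k < s" for k s
  proof (rule ccontr)
    assume "\<not> hi k < s"
    then have "k \<in> I0" using that unfolding I0_def by auto
    then show False using that by simp
  qed
  have eq: "(\<Sum>t\<in>T. h t y) = (if S k = {} then 0 else h (Max (S k)) y)"
    if "k \<in> I - I0" "y \<in> {lo k..hi k}" for k y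
    using placed_sum_eq[OF h(1) finT, of "lo k" "hi k" y, OF gap[OF that(1)]] that(2)
    unfolding S_def by simp
  have pos: "1 \<le> y" if "k \<in> I - I0" "y \<in> {lo k..hi k}" for k y
    using blocksD(1)[OF bl, of k] that by simp
  show ?thesis
  proof (rule that[of I0 J])
    show "I0 \<subseteq> I" unfolding I0_def by blast
    show "hi ` I0 \<in> schreier (n i)" unfolding I0_def using T bl by (rule split_schreier)
    show "J t \<subseteq> I - I0" for t unfolding J_def by blast
    show "J s \<inter> J t = {}" if "s \<noteq> t" for s t using that unfolding J_def by blast
    fix t k assume t: "t \<in> T" and k: "k \<in> J t"
    then have k': "k \<in> I - I0" "S k \<noteq> {}" "Max (S k) = t" unfolding J_def by simp_all
    have tS: "t \<in> S k" using Max_in[OF finS k'(2)] k'(3) by simp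
    have "hi k < s" if s: "s \<in> T" "t < s" for s
    proof (rule gap[OF k'(1) s(1)])
      show "lo k < s"
      proof (rule ccontr)
        assume "\<not> lo k < s"
        then have "s \<in> S k" using s unfolding S_def by simp
        then show False using Max_ge[OF finS] k'(3) s(2) by (metis not_le)
      qed
    qed
    moreover have "t \<le> hi k" using tS blocksD(2)[OF bl, of k] k'(1) unfolding S_def by simp
    ultimately show "t \<le> hi k \<and> (\<forall>s\<in>T. t < s \<longrightarrow> hi k < s)" by simp
    have "\<phi> g (x k) = 1 / real (m i) * \<phi> (h t) (x k)"
    proof (rule phi_cong[OF gm h(2)[OF t] blocksD(3)[OF bl] pos[OF k'(1)]])
      show "k \<in> I" using k' by simp
      show "g y = 1 / real (m i) * h t y" if "y \<in> {lo k..hi k}" for y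
        using eq[OF k'(1) that] k'(2,3) unfolding g by simp
    qed
    then show "\<phi> g (x k) = \<phi> (h t) (x k) / real (m i)" by simp
  next
    fix k assume k: "k \<in> I - I0" "k \<notin> (\<Union>t\<in>T. J t)"
    have S: "S k = {}"
    proof (rule ccontr)
      assume ne: "S k \<noteq> {}"
      then have "Max (S k) \<in> S k" using finS by (intro Max_in)
      then have "Max (S k) \<in> T" unfolding S_def by simp
      moreover have "k \<in> J (Max (S k))" using k ne unfolding J_def by simp
      ultimately show False using k(2) by blast
    qed
    show "\<phi> g (x k) = 0"
    proof (rule phi_zero[OF gm blocksD(3)[OF bl] pos[OF k(1)]])
      show "k \<in> I" using k by simp
      show "g y = 0" if "y \<in> {lo k..hi k}" for y using eq[OF k(1) that] S unfolding g by simp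
    qed
  qed
qed

lemma sum_estimate:
  assumes g: "meas m n g" and fin: "finite I" and S: "S \<subseteq> I" and a: "\<And>k. k \<in> I \<Longrightarrow> 0 \<le> a k"
    and b: "\<And>k. k \<in> I \<Longrightarrow> \<bar>\<phi> g (x k)\<bar> \<le> \<beta> + (if k \<in> S then 1 else 0)"
  shows "\<bar>\<phi> g (\<Sum>k\<in>I. a k *\<^sub>R x k)\<bar> \<le> \<beta> * (\<Sum>k\<in>I. a k) + (\<Sum>k\<in>S. a k)"
proof -
  have "\<bar>\<phi> g (\<Sum>k\<in>I. a k *\<^sub>R x k)\<bar> \<le> (\<Sum>k\<in>I. \<bar>a k * \<phi> g (x k)\<bar>)"
    unfolding phi_sum[OF g] by (rule sum_abs)
  also have "\<dots> \<le> (\<Sum>k\<in>I. \<beta> * a k + (if k \<in> S then a k else 0))"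
  proof (rule sum_mono)
    fix k assume k: "k \<in> I"
    have "\<bar>a k * \<phi> g (x k)\<bar> \<le> a k * (\<beta> + (if k \<in> S then 1 else 0))"
      unfolding abs_mult using a[OF k] b[OF k] by (intro mult_mono) simp_all
    also have "\<dots> = \<beta> * a k + (if k \<in> S then a k else 0)" by (simp add: algebra_simps)
    finally show "\<bar>a k * \<phi> g (x k)\<bar> \<le> \<beta> * a k + (if k \<in> S then a k else 0)" .
  qed
  also have "\<dots> = \<beta> * (\<Sum>k\<in>I. a k) + (\<Sum>k\<in>S. a k)"
    using S fin by (simp add: sum.distrib sum_distrib_left sum.If_cases Int_absorb1)
  finally show ?thesis .
qed

text \<open>Only blocks cut by the outermost operation can escape the factor \<open>1 / m i\<close>,
  and they form a set of order \<open>n i\<close>.\<close>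

lemma average_estimate:
  assumes i: "1 \<le> i" and w: "weighted m n i g" and fin: "finite F" and bl: "blocks F lo hi x"
    and a: "\<And>k. k \<in> F \<Longrightarrow> 0 \<le> a k" and x: "\<And>k. k \<in> F \<Longrightarrow> norm (x k) \<le> 1"
  obtains G where "G \<subseteq> F" "hi ` G \<in> schreier (n i)"
    "\<bar>\<phi> g (\<Sum>k\<in>F. a k *\<^sub>R x k)\<bar> \<le> (\<Sum>k\<in>F. a k) / real (m i) + (\<Sum>k\<in>G. a k)"
proof -
  obtain T h where T: "T \<in> schreier (n i)" "placed T h" "\<forall>t\<in>T. meas m n (h t)"
    "g = (\<lambda>k. (\<Sum>t\<in>T. h t k) / real (m i))"
    using w unfolding weighted_def by (elim exE conjE)
  have gm: "meas m n g" using w i by (rule weighted_meas)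
  obtain I0 J where I0: "I0 \<subseteq> F" "hi ` I0 \<in> schreier (n i)" "\<And>t. J t \<subseteq> F - I0"
    "\<And>t k. t \<in> T \<Longrightarrow> k \<in> J t \<Longrightarrow> \<phi> g (x k) = \<phi> (h t) (x k) / real (m i)"
    "\<And>k. k \<in> F - I0 \<Longrightarrow> k \<notin> (\<Union>t\<in>T. J t) \<Longrightarrow> \<phi> g (x k) = 0"
    using oper_split[OF i T(1,2) T(3)[rule_format] T(4) bl] by metis
  have le1: "\<bar>\<phi> g' (x k)\<bar> \<le> 1" if "meas m n g'" "k \<in> F" for g' k
    using phi_le[OF that(1), of "x k"] x[OF that(2)] by simp
  have rest: "\<bar>\<phi> g (x k)\<bar> \<le> 1 / real (m i)" if k: "k \<in> F - I0" for k
  proof (cases "k \<in> (\<Union>t\<in>T. J t)")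
    case True
    then obtain t where "t \<in> T" "k \<in> J t" by blast
    then show ?thesis using I0(4)[of t k] le1[of "h t" k] T(3) k by (simp add: divide_right_mono)
  qed (use I0(5)[OF k] in simp)
  have "\<bar>\<phi> g (x k)\<bar> \<le> 1 / real (m i) + (if k \<in> I0 then 1 else 0)" if "k \<in> F" for k
    using rest[of k] le1[OF gm that] m_pos[OF i] that
    by (cases "k \<in> I0") (auto intro: order.trans)
  then show ?thesis
    using that[OF I0(1,2)] sum_estimate[OF gm fin I0(1), of a x "1 / real (m i)"] a by simp
qed

subsection \<open>The tree estimate\<close>

text \<open>\<open>\<rho> i\<close> counts the operations of weight \<open>m i\<close> on a branch,
  for \<open>i < j\<close>. This product and the \<open>cost\<close> below are the constraint and
  the objective in \<open>good_f\<close>.\<close>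

definition branch_weight :: "nat \<Rightarrow> (nat \<Rightarrow> nat) \<Rightarrow> nat" where
  "branch_weight j \<rho> = (\<Prod>i\<in>{1..<j}. m i ^ \<rho> i)"

definition cost :: "nat \<Rightarrow> (nat \<Rightarrow> nat) \<Rightarrow> nat" where
  "cost j \<rho> = (\<Sum>i\<in>{1..<j}. \<rho> i * n i)"

lemma branch_weight_pos: "1 \<le> branch_weight j \<rho>"
proof -
  have "0 < m i" if "i \<in> {1..<j}" for i using m_one[of i] that by simp
  then have "0 < branch_weight j \<rho>" unfolding branch_weight_def by (simp add: prod_pos)
  then show ?thesis by simp
qed

lemma branch_weight_upd: "1 \<le> i \<Longrightarrow> i < j \<Longrightarrow> branch_weight j (\<rho>(i := Suc (\<rho> i))) = branch_weight j \<rho> * m i"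
  and cost_upd: "1 \<le> i \<Longrightarrow> i < j \<Longrightarrow> cost j (\<rho>(i := Suc (\<rho> i))) = cost j \<rho> + n i"
proof -
  assume i: "1 \<le> i" "i < j"
  then have mem: "i \<in> {1..<j}" by simp
  show "branch_weight j (\<rho>(i := Suc (\<rho> i))) = branch_weight j \<rho> * m i"
    unfolding branch_weight_def prod.remove[OF finite_atLeastLessThan mem] by simp
  show "cost j (\<rho>(i := Suc (\<rho> i))) = cost j \<rho> + n i"
    unfolding cost_def sum.remove[OF finite_atLeastLessThan mem] by simp
qed

text \<open>\<open>C\<close> is the sum of the absolute values of the coefficients in a finite
  expansion; it does not depend on the measure.\<close>

lemma coef_bound:
  assumes "x \<in> span (e ` {1..})"
  shows "\<exists>C\<ge>0. \<forall>g \<delta>. meas m n g \<longrightarrow> (\<forall>k. \<bar>g k\<bar> \<le> \<delta>) \<longrightarrow> \<bar>\<phi> g x\<bar> \<le> C * \<delta>"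
  using assms
proof (induction rule: span_induct_alt)
    case base
    have "\<phi> g 0 = 0" if "meas m n g" for g using lin[OF that] by (rule linear_0)
    then show ?case by (intro exI[of _ 0]) simp
  next
    case (step c b y)
    then obtain C where C: "0 \<le> C" "\<And>g \<delta>. meas m n g \<Longrightarrow> (\<forall>k. \<bar>g k\<bar> \<le> \<delta>) \<Longrightarrow> \<bar>\<phi> g y\<bar> \<le> C * \<delta>"
      by blast
    obtain i where i: "1 \<le> i" "b = e i" using step by auto
    have "\<bar>\<phi> g (c *\<^sub>R b + y)\<bar> \<le> (\<bar>c\<bar> + C) * \<delta>" if g: "meas m n g" "\<forall>k. \<bar>g k\<bar> \<le> \<delta>" for g \<delta>
    proof -
      have "\<phi> g (c *\<^sub>R b + y) = c * g i + \<phi> g y"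
        using lin[OF g(1)] phi_e[OF g(1) i(1)] i(2) by (simp add: linear_add linear_scale)
      moreover have "\<bar>c * g i\<bar> \<le> \<bar>c\<bar> * \<delta>" unfolding abs_mult using g(2) by (intro mult_left_mono) simp_all
      moreover have "\<bar>\<phi> g y\<bar> \<le> C * \<delta>" using C(2) g by simp
      ultimately show ?thesis by (simp add: algebra_simps)
    qed
    then show ?case using C(1) by (intro exI[of _ "\<bar>c\<bar> + C"]) simp
qed

end

locale good_space = tree_space +
  fixes l f :: "nat \<Rightarrow> nat"
  assumes cost_le: "1 \<le> j \<Longrightarrow> branch_weight j \<rho> < m j ^ 3 \<Longrightarrow> cost j \<rho> \<le> f j"
    and good: "1 \<le> j \<Longrightarrow> l j * (f j + 1) < n j"
    and pow_l: "1 \<le> j \<Longrightarrow> m j < 2 ^ l j"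
begin

lemma m_less_cube: "1 \<le> i \<Longrightarrow> i < j \<Longrightarrow> m i < m j ^ 3"
proof -
  assume i: "1 \<le> i" "i < j"
  have "1 \<le> m j" using m_one[of j] i by simp
  then have "m j ^ 1 \<le> m j ^ 3" by (intro power_increasing) simp_all
  then show ?thesis using m_less[OF i] by simp
qed

text \<open>A branch with a single operation, the indicator of \<open>i\<close>, already satisfies
  the constraint for \<open>f j\<close>.\<close>

lemma n_le_f: "1 \<le> i \<Longrightarrow> i < j \<Longrightarrow> n i \<le> f j"
proof -
  assume i: "1 \<le> i" "i < j"
  have "branch_weight j ((\<lambda>_. 0)(i := Suc 0)) = m i" "cost j ((\<lambda>_. 0)(i := Suc 0)) = n i"
    using branch_weight_upd[OF i, of "\<lambda>_. 0"] cost_upd[OF i, of "\<lambda>_. 0"] by (simp_all add: branch_weight_def cost_def)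
  then show ?thesis using cost_le[of j "(\<lambda>_. 0)(i := Suc 0)"] m_less_cube[OF i] i by simp
qed

lemma f_less_n: "1 \<le> j \<Longrightarrow> f j + 1 < n j"
proof -
  assume j: "1 \<le> j"
  have "l j \<noteq> 0" using pow_l[OF j] m_one[OF j] by (intro notI) simp
  then have "1 * (f j + 1) \<le> l j * (f j + 1)" by (intro mult_right_mono) simp_all
  then show ?thesis using good[OF j] by simp
qed

text \<open>A tree of operations is followed downwards. The product of the weights on the current branch is
  \<open>branch_weight j \<rho>\<close>; the branch may be cut once this is at least \<open>m j\<close>. At each of at most \<open>D\<close>
  further levels, the blocks that are split or met exceptionally form a set of low complexity.\<close>

lemma tree_estimate:
  assumes g: "meas m n g" and j: "1 \<le> j" and bl: "blocks F lo hi x" and fin: "finite F"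
    and a: "\<And>k. k \<in> F \<Longrightarrow> 0 \<le> a k" and x: "\<And>k. k \<in> F \<Longrightarrow> norm (x k) \<le> 1"
    and exc: "\<And>i. j \<le> i \<Longrightarrow>
      \<exists>k0. \<forall>k\<in>F. k \<noteq> k0 \<longrightarrow> (\<forall>g. weighted m n i g \<longrightarrow> \<bar>\<phi> g (x k)\<bar> \<le> 3 / real (m j))"
    and I: "I \<subseteq> F" "branch_weight j \<rho> < m j ^ 3" "m j \<le> branch_weight j \<rho> + D"
  shows "\<exists>G. (\<forall>d. G d \<subseteq> I \<and> hi ` G d \<in> schreier (f j - cost j \<rho>)) \<and>
      \<bar>\<phi> g (\<Sum>k\<in>I. a k *\<^sub>R x k)\<bar>
        \<le> 3 * real (branch_weight j \<rho>) / real (m j) * (\<Sum>k\<in>I. a k) + (\<Sum>d<D. \<Sum>k\<in>G d. a k)"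
proof -
  \<comment> \<open>Measure, surviving blocks, branch and remaining depth all change in the
    induction over the tree.\<close>
  define claim where "claim g I \<rho> D \<longleftrightarrow>
    (\<exists>G. (\<forall>d. G d \<subseteq> I \<and> hi ` G d \<in> schreier (f j - cost j \<rho>)) \<and>
      \<bar>\<phi> g (\<Sum>k\<in>I. a k *\<^sub>R x k)\<bar>
        \<le> 3 * real (branch_weight j \<rho>) / real (m j) * (\<Sum>k\<in>I. a k) + (\<Sum>d<D. \<Sum>k\<in>G d. a k))"
    for g I \<rho> and D :: nat
  have le1: "\<bar>\<phi> g' (x k)\<bar> \<le> 1" if "meas m n g'" "k \<in> F" for g' k
    using phi_le[OF that(1), of "x k"] x[OF that(2)] by simp
  have mj: "0 < real (m j)" using m_pos[OF j] .
  have a_sum: "0 \<le> (\<Sum>k\<in>I. a k)" if "I \<subseteq> F" for I using a that by (intro sum_nonneg) blast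
  have finI: "finite I" if "I \<subseteq> F" for I using finite_subset[OF that fin] .
  \<comment> \<open>Once the product has reached \<open>m j\<close>, the factor in front of the mass
    is at least 3 and the triangle inequality suffices, without exceptional blocks.\<close>
  have big: "claim g I \<rho> D" if g: "meas m n g" and I: "I \<subseteq> F" and W: "m j \<le> branch_weight j \<rho>" for g I \<rho> D
  proof -
    have "\<bar>\<phi> g (\<Sum>k\<in>I. a k *\<^sub>R x k)\<bar> \<le> norm (\<Sum>k\<in>I. a k *\<^sub>R x k)" using g by (rule phi_le)
    also have "\<dots> \<le> (\<Sum>k\<in>I. a k)" using a x I by (intro norm_sum_le) blast
    also have "\<dots> = 1 * (\<Sum>k\<in>I. a k)" by simp
    also have "\<dots> \<le> 3 * real (branch_weight j \<rho>) / real (m j) * (\<Sum>k\<in>I. a k)"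
    proof (rule mult_right_mono[OF _ a_sum[OF I]])
      have "real (m j) \<le> 3 * real (branch_weight j \<rho>)" using W by simp
      then show "1 \<le> 3 * real (branch_weight j \<rho>) / real (m j)" using mj by (simp add: le_divide_eq)
    qed
    finally show ?thesis unfolding claim_def by (intro exI[of _ "\<lambda>_. {}"]) simp
  qed
  \<comment> \<open>Covers leaves and operations of weight at least \<open>m j\<close>. The one bad
    block is put on every level, since a singleton has every order; \<open>1 \<le> D\<close> ensures
    that there is a level.\<close>
  have single: "claim g I \<rho> D"
    if g: "meas m n g" and I: "I \<subseteq> F" and S: "S \<subseteq> I" "\<And>k l. k \<in> S \<Longrightarrow> l \<in> S \<Longrightarrow> k = l" and D: "1 \<le> D"
      and b: "\<And>k. k \<in> I \<Longrightarrow> \<bar>\<phi> g (x k)\<bar> \<le> 3 / real (m j) + (if k \<in> S then 1 else 0)"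
    for g I S \<rho> D
  proof -
    have sch: "hi ` S \<in> schreier q" for q
    proof (cases "S = {}")
      case False
      then obtain k where k: "k \<in> S" by blast
      then have "S = {k}" using S(2) by blast
      moreover have "k \<in> F" using k S(1) I by blast
      then have "1 \<le> hi k" using blocksD(1,2)[OF bl] by (meson order.trans)
      ultimately show ?thesis using schreier_singleton by simp
    qed simp
    have S0: "0 \<le> (\<Sum>k\<in>S. a k)" using S(1) I by (intro a_sum) blast
    have "\<bar>\<phi> g (\<Sum>k\<in>I. a k *\<^sub>R x k)\<bar> \<le> 3 / real (m j) * (\<Sum>k\<in>I. a k) + (\<Sum>k\<in>S. a k)"
      using a I by (intro sum_estimate[OF g finI[OF I] S(1) _ b]) blast+
    also have "\<dots> \<le> 3 * real (branch_weight j \<rho>) / real (m j) * (\<Sum>k\<in>I. a k) + (\<Sum>d<D. \<Sum>k\<in>S. a k)"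
    proof (rule add_mono)
      show "3 / real (m j) * (\<Sum>k\<in>I. a k) \<le> 3 * real (branch_weight j \<rho>) / real (m j) * (\<Sum>k\<in>I. a k)"
        using branch_weight_pos[of j \<rho>] mj by (intro mult_right_mono[OF _ a_sum[OF I]] divide_right_mono) simp_all
      have "1 * (\<Sum>k\<in>S. a k) \<le> real D * (\<Sum>k\<in>S. a k)"
        using D S0 by (intro mult_right_mono) simp_all
      then show "(\<Sum>k\<in>S. a k) \<le> (\<Sum>d<D. \<Sum>k\<in>S. a k)" by simp
    qed
    finally show ?thesis unfolding claim_def using S(1) sch by (intro exI[of _ "\<lambda>_. S"]) simp
  qed
  have "claim g I \<rho> D"
    using g I
  proof (induction arbitrary: I \<rho> D rule: meas.induct)
    case (point i c)
    let ?g = "\<lambda>k. if k = i then c else 0"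
    have gm: "meas m n ?g" using point(1,2) by (rule meas.point)
    show ?case
    proof (cases "m j \<le> branch_weight j \<rho>")
      case True
      then show ?thesis using big gm point by simp
    next
      case False
      then have D: "1 \<le> D" using point.prems(3) by simp
      \<comment> \<open>The intervals are disjoint, so a point mass meets at most one block.\<close>
      let ?S = "{k \<in> I. lo k \<le> i \<and> i \<le> hi k}"
      show ?thesis
      proof (rule single[OF gm point.prems(1) _ _ D, of ?S])
        show "k = l" if k: "k \<in> ?S" and l: "l \<in> ?S" for k l
        proof (rule ccontr)
          have kl: "k \<in> F" "l \<in> F" using k l point.prems(1) by auto
          assume "k \<noteq> l"
          then consider "k < l" | "l < k" by linarith
          then show False
          proof cases
            case 1
            then show ?thesis using blocksD(4)[OF bl kl] k l by simp
          next
            case 2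
            then show ?thesis using blocksD(4)[OF bl kl(2,1)] k l by simp
          qed
        qed
        show "\<bar>\<phi> ?g (x k)\<bar> \<le> 3 / real (m j) + (if k \<in> ?S then 1 else 0)" if k: "k \<in> I" for k
        proof (cases "k \<in> ?S")
          case True
          have "\<bar>\<phi> ?g (x k)\<bar> \<le> 1" using le1[OF gm] k point.prems(1) by blast
          moreover have "0 \<le> 3 / real (m j)" using mj by simp
          ultimately show ?thesis unfolding if_P[OF True] by linarith
        next
          case False
          have kF: "k \<in> F" using k point.prems(1) by blast
          have "\<phi> ?g (x k) = 0"
            using False k blocksD(1)[OF bl kF] by (intro phi_zero[OF gm blocksD(3)[OF bl kF]]) auto
          then show ?thesis using mj by simp
        qed
      qed blast
    qed
  next
    case (oper i T h)
    let ?g = "\<lambda>k. (\<Sum>t\<in>T. h t k) / real (m i)"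
    have gm: "meas m n ?g" using oper.hyps by (rule meas.oper)
    have IF: "I \<subseteq> F" by fact
    show ?case
    proof (cases "m j \<le> branch_weight j \<rho>")
      case True
      then show ?thesis using big gm IF by simp
    next
      case small: False
      show ?thesis
      proof (cases "j \<le> i")
        case True
        obtain k0 where k0: "\<forall>k\<in>F. k \<noteq> k0 \<longrightarrow>
            (\<forall>g. weighted m n i g \<longrightarrow> \<bar>\<phi> g (x k)\<bar> \<le> 3 / real (m j))"
          using exc[OF True] by blast
        have w: "weighted m n i ?g" unfolding weighted_def using oper.hyps by blast
        have D: "1 \<le> D" using small oper.prems(3) by simp
        show ?thesis
        proof (rule single[OF gm IF _ _ D, of "{k \<in> I. k = k0}"])
          show "\<bar>\<phi> ?g (x k)\<bar> \<le> 3 / real (m j) + (if k \<in> {k \<in> I. k = k0} then 1 else 0)"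
            if k: "k \<in> I" for k
          proof (cases "k = k0")
            case True
            then have in0: "k \<in> {k \<in> I. k = k0}" using k by simp
            have "\<bar>\<phi> ?g (x k)\<bar> \<le> 1" using le1[OF gm] k IF by blast
            moreover have "0 \<le> 3 / real (m j)" using mj by simp
            ultimately show ?thesis unfolding if_P[OF in0] by linarith
          next
            case False
            have "\<bar>\<phi> ?g (x k)\<bar> \<le> 3 / real (m j)" using k0 w k IF False by blast
            then show ?thesis using False by simp
          qed
        qed auto
      next
        case False
        then have i: "1 \<le> i" "i < j" using oper.hyps by simp_all
        have mi: "1 \<le> real (m i)" using m_one[OF i(1)] by simp
        define \<rho>' where "\<rho>' = \<rho>(i := Suc (\<rho> i))"
        have W': "branch_weight j \<rho>' = branch_weight j \<rho> * m i" and cost': "cost j \<rho>' = cost j \<rho> + n i"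
          unfolding \<rho>'_def using branch_weight_upd[OF i] cost_upd[OF i] by blast+
        obtain D' where D': "D = Suc D'" using small oper.prems(3) by (cases D) simp_all
        \<comment> \<open>Both factors are below \<open>m j\<close>, so the extended branch still
          obeys the constraint and its cost is at most \<open>f j\<close>.\<close>
        have "branch_weight j \<rho> * m i < m j * m j"
          using small m_less[OF i] by (intro mult_strict_mono') simp_all
        also have "\<dots> \<le> m j ^ 3"
          using m_one[OF j] by (simp add: power3_eq_cube)
        finally have W'_less: "branch_weight j \<rho>' < m j ^ 3" unfolding W' .
        \<comment> \<open>From a product of at least 1 a factor \<open>m i \<ge> 2\<close> gains at
          least 1, which pays for the lost level in
          \<open>m j \<le> branch_weight j \<rho> + D\<close>.\<close>
        have "branch_weight j \<rho> + 1 \<le> branch_weight j \<rho> * 2" using branch_weight_pos[of j \<rho>] by simp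
        also have "\<dots> \<le> branch_weight j \<rho>'" unfolding W' using m_ge[OF i(1)] by (intro mult_left_mono) simp_all
        finally have W'_D: "m j \<le> branch_weight j \<rho>' + D'" using oper.prems(3) D' by simp
        \<comment> \<open>The truncated subtraction is exact because
          \<open>cost j \<rho>' \<le> f j\<close>: this node uses \<open>n i\<close> of the
          available order and leaves the rest to its children.\<close>
        have cf: "f j - cost j \<rho> = n i + (f j - cost j \<rho>')"
          using cost_le[OF j W'_less] cost' by simp
        have blI: "blocks I lo hi x" using bl IF by (rule blocks_subset)
        obtain I0 J where I0: "I0 \<subseteq> I" "hi ` I0 \<in> schreier (n i)" and JI: "\<And>t. J t \<subseteq> I - I0"
          and Jdisj: "\<And>s t. s \<noteq> t \<Longrightarrow> J s \<inter> J t = {}"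
          and Jord: "\<And>t k. t \<in> T \<Longrightarrow> k \<in> J t \<Longrightarrow> t \<le> hi k \<and> (\<forall>s\<in>T. t < s \<longrightarrow> hi k < s)"
          and Jphi: "\<And>t k. t \<in> T \<Longrightarrow> k \<in> J t \<Longrightarrow> \<phi> ?g (x k) = \<phi> (h t) (x k) / real (m i)"
          and Jzero: "\<And>k. k \<in> I - I0 \<Longrightarrow> k \<notin> (\<Union>t\<in>T. J t) \<Longrightarrow> \<phi> ?g (x k) = 0"
          by (rule oper_split[OF oper.hyps(1,2,3,4) refl blI]) (assumption | rule that)+
        have JF: "J t \<subseteq> F" for t using JI IF by blast
        have finT: "finite T" using oper.hyps(2) by (rule schreier_finite)
        have "\<forall>t\<in>T. \<exists>G. (\<forall>d. G d \<subseteq> J t \<and> hi ` G d \<in> schreier (f j - cost j \<rho>')) \<and>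
            \<bar>\<phi> (h t) (\<Sum>k\<in>J t. a k *\<^sub>R x k)\<bar>
              \<le> 3 * real (branch_weight j \<rho>') / real (m j) * (\<Sum>k\<in>J t. a k) + (\<Sum>d<D'. \<Sum>k\<in>G d. a k)"
        proof
          fix t assume "t \<in> T"
          from oper.IH[OF this JF W'_less W'_D]
          show "\<exists>G. (\<forall>d. G d \<subseteq> J t \<and> hi ` G d \<in> schreier (f j - cost j \<rho>')) \<and>
            \<bar>\<phi> (h t) (\<Sum>k\<in>J t. a k *\<^sub>R x k)\<bar>
              \<le> 3 * real (branch_weight j \<rho>') / real (m j) * (\<Sum>k\<in>J t. a k) + (\<Sum>d<D'. \<Sum>k\<in>G d. a k)"
            unfolding claim_def .
        qed
        from bchoice[OF this] obtain Gt where "\<forall>t\<in>T. (\<forall>d. Gt t d \<subseteq> J t \<and> hi ` Gt t d \<in> schreier (f j - cost j \<rho>')) \<and>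
            \<bar>\<phi> (h t) (\<Sum>k\<in>J t. a k *\<^sub>R x k)\<bar>
              \<le> 3 * real (branch_weight j \<rho>') / real (m j) * (\<Sum>k\<in>J t. a k) + (\<Sum>d<D'. \<Sum>k\<in>Gt t d. a k)"
          by (elim exE)
        then have GtJ: "\<And>t d. t \<in> T \<Longrightarrow> Gt t d \<subseteq> J t"
          and Gts: "\<And>t d. t \<in> T \<Longrightarrow> hi ` Gt t d \<in> schreier (f j - cost j \<rho>')"
          and Gte: "\<And>t. t \<in> T \<Longrightarrow> \<bar>\<phi> (h t) (\<Sum>k\<in>J t. a k *\<^sub>R x k)\<bar>
              \<le> 3 * real (branch_weight j \<rho>') / real (m j) * (\<Sum>k\<in>J t. a k) + (\<Sum>d<D'. \<Sum>k\<in>Gt t d. a k)"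
          by simp_all
        \<comment> \<open>Level 0 holds the blocks cut here; level \<open>Suc d\<close> joins level
          \<open>d\<close> of all children. The points of \<open>T\<close> separate the children, so
          joining adds \<open>n i\<close> to the order.\<close>
        define G where "G d = (case d of 0 \<Rightarrow> I0 | Suc d \<Rightarrow> \<Union>t\<in>T. Gt t d)" for d
        have G: "G d \<subseteq> I \<and> hi ` G d \<in> schreier (f j - cost j \<rho>)" for d
        proof (cases d)
          case 0
          have "hi ` I0 \<in> schreier (f j - cost j \<rho>)" using I0(2) cf by (auto intro: schreier_mono)
          then show ?thesis using 0 I0(1) unfolding G_def by simp
        next
          case (Suc d')
          have "(\<Union>t\<in>T. hi ` Gt t d') \<in> schreier (n i + (f j - cost j \<rho>'))"
          proof (rule schreier_union[OF oper.hyps(2) Gts])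
            show "t \<le> y" if "t \<in> T" "y \<in> hi ` Gt t d'" for t y
              using Jord[OF that(1)] GtJ[OF that(1), of d'] that(2) by blast
            show "y < z" if st: "s \<in> T" "t \<in> T" "s < t" and yz: "y \<in> hi ` Gt s d'" "z \<in> hi ` Gt t d'" for s t y z
            proof -
              have "y < t" using Jord[OF st(1)] GtJ[OF st(1), of d'] yz(1) st by blast
              moreover have "t \<le> z" using Jord[OF st(2)] GtJ[OF st(2), of d'] yz(2) by blast
              ultimately show ?thesis by simp
            qed
          qed
          moreover have "hi ` (\<Union>t\<in>T. Gt t d') = (\<Union>t\<in>T. hi ` Gt t d')" by (rule image_UN)
          moreover have "(\<Union>t\<in>T. Gt t d') \<subseteq> I" using GtJ JI by blast
          ultimately show ?thesis using Suc cf unfolding G_def by simp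
        qed
        define R where "R t = (\<Sum>d<D'. \<Sum>k\<in>Gt t d. a k)" for t
        have R0: "0 \<le> R t" if "t \<in> T" for t
          unfolding R_def using GtJ[OF that] JF by (intro sum_nonneg a) blast
        have UJ: "(\<Union>t\<in>T. J t) \<subseteq> I - I0" using JI by blast
        have finJ: "\<forall>t\<in>T. finite (J t)" using finI[OF JF] by simp
        have disJ: "\<forall>s\<in>T. \<forall>t\<in>T. s \<noteq> t \<longrightarrow> J s \<inter> J t = {}" using Jdisj by simp
        have "\<bar>\<Sum>k\<in>I0. a k * \<phi> ?g (x k)\<bar> \<le> (\<Sum>k\<in>I0. a k)"
        proof (rule order.trans[OF sum_abs sum_mono])
          fix k assume "k \<in> I0"
          then have k: "k \<in> F" using I0(1) IF by blast
          show "\<bar>a k * \<phi> ?g (x k)\<bar> \<le> a k"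
            unfolding abs_mult using le1[OF gm k] a[OF k] by (simp add: mult_left_le)
        qed
        moreover have "(\<Sum>k\<in>I - I0. a k * \<phi> ?g (x k))
            = (\<Sum>t\<in>T. \<phi> (h t) (\<Sum>k\<in>J t. a k *\<^sub>R x k) / real (m i))"
        proof -
          have "(\<Sum>k\<in>I - I0. a k * \<phi> ?g (x k)) = (\<Sum>k\<in>(\<Union>t\<in>T. J t). a k * \<phi> ?g (x k))"
            using finI[OF IF] UJ Jzero by (intro sum.mono_neutral_right) simp_all
          also have "\<dots> = (\<Sum>t\<in>T. \<Sum>k\<in>J t. a k * \<phi> ?g (x k))"
            using finT finJ disJ by (rule sum.UNION_disjoint)
          also have "\<dots> = (\<Sum>t\<in>T. \<phi> (h t) (\<Sum>k\<in>J t. a k *\<^sub>R x k) / real (m i))"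
          proof (rule sum.cong[OF refl])
            fix t assume t: "t \<in> T"
            have "(\<Sum>k\<in>J t. a k * \<phi> ?g (x k)) = (\<Sum>k\<in>J t. a k * \<phi> (h t) (x k) / real (m i))"
              using Jphi[OF t] by (intro sum.cong) simp_all
            also have "\<dots> = \<phi> (h t) (\<Sum>k\<in>J t. a k *\<^sub>R x k) / real (m i)"
              unfolding phi_sum[OF oper.hyps(4)[OF t]] by (rule sum_divide_distrib[symmetric])
            finally show "(\<Sum>k\<in>J t. a k * \<phi> ?g (x k))
              = \<phi> (h t) (\<Sum>k\<in>J t. a k *\<^sub>R x k) / real (m i)" .
          qed
          finally show ?thesis .
        qed
        moreover have "\<bar>\<Sum>t\<in>T. \<phi> (h t) (\<Sum>k\<in>J t. a k *\<^sub>R x k) / real (m i)\<bar>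
            \<le> (\<Sum>t\<in>T. 3 * real (branch_weight j \<rho>) / real (m j) * (\<Sum>k\<in>J t. a k) + R t)"
        proof (rule order.trans[OF sum_abs sum_mono])
          fix t assume t: "t \<in> T"
          have "\<bar>\<phi> (h t) (\<Sum>k\<in>J t. a k *\<^sub>R x k) / real (m i)\<bar>
              \<le> (3 * real (branch_weight j \<rho>') / real (m j) * (\<Sum>k\<in>J t. a k) + R t) / real (m i)"
            using divide_right_mono[OF Gte[OF t], of "real (m i)"] mi unfolding R_def by simp
          also have "\<dots> = 3 * real (branch_weight j \<rho>) / real (m j) * (\<Sum>k\<in>J t. a k) + R t / real (m i)"
            unfolding W' add_divide_distrib using mi by simp
          \<comment> \<open>In the main term \<open>m i\<close> cancels against the enlarged branch
            product; in the exceptional part the gain is given away, as these sums will be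
            tiny.\<close>
          also have "R t / real (m i) \<le> R t / 1" using R0[OF t] mi by (intro divide_left_mono) simp_all
          finally show "\<bar>\<phi> (h t) (\<Sum>k\<in>J t. a k *\<^sub>R x k) / real (m i)\<bar>
              \<le> 3 * real (branch_weight j \<rho>) / real (m j) * (\<Sum>k\<in>J t. a k) + R t" by simp
        qed
        moreover have "(\<Sum>t\<in>T. 3 * real (branch_weight j \<rho>) / real (m j) * (\<Sum>k\<in>J t. a k) + R t)
            \<le> 3 * real (branch_weight j \<rho>) / real (m j) * (\<Sum>k\<in>I. a k) + (\<Sum>t\<in>T. R t)"
        proof -
          have "(\<Sum>t\<in>T. \<Sum>k\<in>J t. a k) = (\<Sum>k\<in>(\<Union>t\<in>T. J t). a k)"
            using finT finJ disJ by (rule sum.UNION_disjoint[symmetric])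
          also have "\<dots> \<le> (\<Sum>k\<in>I. a k)"
            using UJ IF a by (intro sum_mono2 finI[OF IF]) blast+
          finally have "3 * real (branch_weight j \<rho>) / real (m j) * (\<Sum>t\<in>T. \<Sum>k\<in>J t. a k)
              \<le> 3 * real (branch_weight j \<rho>) / real (m j) * (\<Sum>k\<in>I. a k)" by (intro mult_left_mono) simp_all
          then show ?thesis unfolding sum.distrib sum_distrib_left[symmetric] by simp
        qed
        moreover have "(\<Sum>t\<in>T. R t) = (\<Sum>d<D'. \<Sum>k\<in>G (Suc d). a k)"
        proof -
          have "(\<Sum>t\<in>T. \<Sum>k\<in>Gt t d. a k) = (\<Sum>k\<in>(\<Union>t\<in>T. Gt t d). a k)" for d
          proof (rule sum.UNION_disjoint[symmetric, OF finT])
            show "\<forall>t\<in>T. finite (Gt t d)" using GtJ finJ finite_subset by blast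
            show "\<forall>s\<in>T. \<forall>t\<in>T. s \<noteq> t \<longrightarrow> Gt s d \<inter> Gt t d = {}" using GtJ disJ by blast
          qed
          then show ?thesis unfolding R_def G_def by (subst sum.swap) simp
        qed
        moreover have "\<phi> ?g (\<Sum>k\<in>I. a k *\<^sub>R x k)
            = (\<Sum>k\<in>I - I0. a k * \<phi> ?g (x k)) + (\<Sum>k\<in>I0. a k * \<phi> ?g (x k))"
          unfolding phi_sum[OF gm] using I0(1) finI[OF IF] by (rule sum.subset_diff)
        moreover have "(\<Sum>d<D. \<Sum>k\<in>G d. a k) = (\<Sum>k\<in>I0. a k) + (\<Sum>d<D'. \<Sum>k\<in>G (Suc d). a k)"
          unfolding D' sum.lessThan_Suc_shift by (simp add: G_def)
        ultimately have "\<bar>\<phi> ?g (\<Sum>k\<in>I. a k *\<^sub>R x k)\<bar>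
            \<le> 3 * real (branch_weight j \<rho>) / real (m j) * (\<Sum>k\<in>I. a k) + (\<Sum>d<D. \<Sum>k\<in>G d. a k)"
          by linarith
        then show ?thesis unfolding claim_def using G by blast
      qed
    qed
  qed
  then show ?thesis unfolding claim_def .
qed

text \<open>Start \<open>tree_estimate\<close> at the root, with product 1 and depth
  \<open>m j\<close>. Mass \<open>1 / m j ^ 2\<close> on each of the \<open>m j\<close> exceptional
  sets totals \<open>1 / m j\<close>, added to the main term \<open>3 / m j\<close>.\<close>

lemma blocks_upper:
  assumes j: "1 \<le> j" and bl: "blocks {1..} lo hi x" and x: "\<And>k. 1 \<le> k \<Longrightarrow> norm (x k) \<le> 1"
    and exc: "\<And>i. j \<le> i \<Longrightarrow>
      \<exists>k0. \<forall>k\<ge>1. k \<noteq> k0 \<longrightarrow> (\<forall>g. weighted m n i g \<longrightarrow> \<bar>\<phi> g (x k)\<bar> \<le> 3 / real (m j))"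
  obtains F a where "F \<in> schreier (f j + 1)" "F \<noteq> {}" "\<And>k. 0 \<le> a k" "(\<Sum>k\<in>F. a k) = 1"
    "norm (\<Sum>k\<in>F. a k *\<^sub>R x k) \<le> 4 / real (m j)"
proof -
  have mj: "0 < real (m j)" using m_pos[OF j] .
  have hi: "strict_mono_on {1..} hi" using bl by (rule blocks_hi_mono)
  have "0 < 1 / real (m j) ^ 2" using mj by simp
  from special_convex[OF hi this, of "f j" 0] obtain F a where F: "F \<in> schreier (Suc (f j))" "F \<noteq> {}"
    "\<forall>k\<in>F. 0 < k" "\<forall>k. 0 \<le> a k" "\<forall>k. k \<notin> F \<longrightarrow> a k = 0" "(\<Sum>k\<in>F. a k) = 1"
    "\<forall>G\<subseteq>F. hi ` G \<in> schreier (f j) \<longrightarrow> (\<Sum>k\<in>G. a k) \<le> 1 / real (m j) ^ 2"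
    by (elim exE conjE)
  have F1: "F \<subseteq> {1..}" using F(3) by auto
  have blF: "blocks F lo hi x" using bl F1 by (rule blocks_subset)
  have W0: "branch_weight j (\<lambda>_. 0) = 1" and c0: "cost j (\<lambda>_. 0) = 0" by (simp_all add: branch_weight_def cost_def)
  have excF: "\<exists>k0. \<forall>k\<in>F. k \<noteq> k0 \<longrightarrow> (\<forall>g. weighted m n i g \<longrightarrow> \<bar>\<phi> g (x k)\<bar> \<le> 3 / real (m j))"
    if "j \<le> i" for i
    using exc[OF that] F1 by (meson atLeast_iff subsetD)
  have "norm (\<Sum>k\<in>F. a k *\<^sub>R x k) \<le> 4 / real (m j)"
  proof (rule norm_leI)
    show "(\<Sum>k\<in>F. a k *\<^sub>R x k) \<in> span (e ` {1..})"
    proof (intro span_sum span_scale)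
      fix k assume "k \<in> F"
      then show "x k \<in> span (e ` {1..})" using span_mono1[OF blocksD(3,1)[OF blF]] by blast
    qed
    fix g assume g: "meas m n g"
    have "\<exists>G. (\<forall>d. G d \<subseteq> F \<and> hi ` G d \<in> schreier (f j - cost j (\<lambda>_. 0))) \<and>
      \<bar>\<phi> g (\<Sum>k\<in>F. a k *\<^sub>R x k)\<bar>
        \<le> 3 * real (branch_weight j (\<lambda>_. 0)) / real (m j) * (\<Sum>k\<in>F. a k) + (\<Sum>d<m j. \<Sum>k\<in>G d. a k)"
    proof (rule tree_estimate[OF g j blF schreier_finite[OF F(1)] _ _ excF])
      show "norm (x k) \<le> 1" if "k \<in> F" for k using x[of k] F1 that by auto
      show "branch_weight j (\<lambda>_. 0) < m j ^ 3" using m_ge[OF j] unfolding W0 by (intro one_less_power) simp_all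
    qed (use F(4) in simp_all)
    then obtain G where G: "\<And>d. G d \<subseteq> F \<and> hi ` G d \<in> schreier (f j)"
      "\<bar>\<phi> g (\<Sum>k\<in>F. a k *\<^sub>R x k)\<bar> \<le> 3 / real (m j) + (\<Sum>d<m j. \<Sum>k\<in>G d. a k)"
      unfolding W0 c0 F(6) by auto
    have "(\<Sum>d<m j. \<Sum>k\<in>G d. a k) \<le> (\<Sum>d<m j. 1 / real (m j) ^ 2)"
      using F(7) G(1) by (intro sum_mono) blast
    also have "\<dots> = 1 / real (m j)" using mj by (simp add: power2_eq_square)
    finally show "\<phi> g (\<Sum>k\<in>F. a k *\<^sub>R x k) \<le> 4 / real (m j)" using G(2) by simp
  qed
  then show ?thesis using that[of F a] F by simp
qed

end

section \<open>Rapidly increasing sequences\<close>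

context tree_space
begin

lemma m_unbounded: "1 \<le> i \<Longrightarrow> i \<le> m i"
proof (induction i)
  case (Suc i)
  show ?case
  proof (cases "i = 0")
    case True
    then show ?thesis using m_ge[of 1] by simp
  next
    case False
    then have "i \<le> m i" "m i < m (Suc i)" using Suc.IH m_less[of i "Suc i"] by simp_all
    then show ?thesis by simp
  qed
qed simp

lemma blocks_ge: "blocks {1..} lo hi x \<Longrightarrow> 1 \<le> k \<Longrightarrow> k \<le> lo k"
proof (induction k)
  case (Suc k)
  show ?case
  proof (cases "k = 0")
    case True
    then show ?thesis using blocksD(1)[OF Suc.prems(1), of 1] by simp
  next
    case False
    have "k \<le> lo k" using Suc.IH[OF Suc.prems(1)] False by simp
    also have "lo k \<le> hi k" using blocksD(2)[OF Suc.prems(1), of k] False by simp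
    also have "hi k < lo (Suc k)" using blocksD(4)[OF Suc.prems(1), of k "Suc k"] False by simp
    finally show ?thesis by simp
  qed
qed simp

lemma blocks_mono:
  assumes "blocks K lo hi x" "k \<in> K" "l \<in> K" "k \<le> l"
  shows "lo k \<le> lo l \<and> hi k \<le> hi l"
proof (cases "k = l")
  case False
  then show ?thesis using blocksD(4)[OF assms(1,2,3)] blocksD(2)[OF assms(1,2)]
      blocksD(2)[OF assms(1,3)] assms(4) by simp
qed simp

lemma blocks_comb:
  assumes bl: "blocks {1..} lo hi u"
    and E: "\<And>i. i \<in> K \<Longrightarrow> finite (E i)" "\<And>i. i \<in> K \<Longrightarrow> E i \<noteq> {}" "\<And>i. i \<in> K \<Longrightarrow> E i \<subseteq> {1..}"
    and ord: "\<And>i j k l. i \<in> K \<Longrightarrow> j \<in> K \<Longrightarrow> i < j \<Longrightarrow> k \<in> E i \<Longrightarrow> l \<in> E j \<Longrightarrow> k < l"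
  shows "blocks K (\<lambda>i. lo (Min (E i))) (\<lambda>i. hi (Max (E i))) (\<lambda>i. \<Sum>k\<in>E i. c i k *\<^sub>R u k)"
proof -
  have mn: "Min (E i) \<in> E i" "Max (E i) \<in> E i" if "i \<in> K" for i using E(1,2)[OF that] by simp_all
  then have mn1: "Min (E i) \<in> {1..}" "Max (E i) \<in> {1..}" if "i \<in> K" for i
    using E(3)[OF that] that by blast+
  show ?thesis unfolding blocks_def
  proof (intro conjI ballI impI)
    fix i assume i: "i \<in> K"
    show "1 \<le> lo (Min (E i))" using blocksD(1)[OF bl mn1(1)[OF i]] .
    have "lo (Min (E i)) \<le> hi (Min (E i))" using blocksD(2)[OF bl mn1(1)[OF i]] .
    also have "\<dots> \<le> hi (Max (E i))"
      using blocks_mono[OF bl mn1(1)[OF i] mn1(2)[OF i]] mn(1)[OF i] E(1)[OF i] by simp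
    finally show "lo (Min (E i)) \<le> hi (Max (E i))" .
    show "(\<Sum>k\<in>E i. c i k *\<^sub>R u k) \<in> span (e ` {lo (Min (E i))..hi (Max (E i))})"
    proof (intro span_sum span_scale)
      fix k assume k: "k \<in> E i"
      then have k1: "k \<in> {1..}" using E(3)[OF i] by blast
      have "Min (E i) \<le> k" "k \<le> Max (E i)" using k E(1)[OF i] by simp_all
      then have "lo (Min (E i)) \<le> lo k" "hi k \<le> hi (Max (E i))"
        using blocks_mono[OF bl mn1(1)[OF i] k1] blocks_mono[OF bl k1 mn1(2)[OF i]] by simp_all
      then have "span (e ` {lo k..hi k}) \<subseteq> span (e ` {lo (Min (E i))..hi (Max (E i))})"
        by (intro span_mono image_mono) simp
      then show "u k \<in> span (e ` {lo (Min (E i))..hi (Max (E i))})" using blocksD(3)[OF bl k1] by blast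
    qed
  next
    fix i j assume ij: "i \<in> K" "j \<in> K" "i < j"
    have "Max (E i) < Min (E j)" using ord[OF ij mn(2)[OF ij(1)] mn(1)[OF ij(2)]] .
    then show "hi (Max (E i)) < lo (Min (E j))"
      using blocksD(4)[OF bl mn1(2)[OF ij(1)] mn1(1)[OF ij(2)]] by simp
  qed
qed

end

context good_space
begin

text \<open>Says nothing about weights from \<open>m J\<close> on; there the next index of the
  sequence is chosen large enough for this particular vector.\<close>

definition tame :: "nat \<Rightarrow> 'a \<Rightarrow> bool" where
  "tame J z \<longleftrightarrow> (\<forall>i g. 1 \<le> i \<longrightarrow> i < J \<longrightarrow> weighted m n i g \<longrightarrow> \<bar>\<phi> g z\<bar> \<le> 3 / real (m i))"

text \<open>Sets of order \<open>n i\<close> are covered by order \<open>f J\<close>, so the cut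
  blocks weigh at most \<open>1 / (2 * m J)\<close>, hence at most half of \<open>1 / m i\<close>.
  Normalizing at most doubles \<open>3 / 2 / m i\<close>.\<close>

lemma tame_average:
  assumes J: "1 \<le> J" and fin: "finite F" and bl: "blocks F lo hi v"
    and a: "\<And>k. k \<in> F \<Longrightarrow> 0 \<le> a k" "(\<Sum>k\<in>F. a k) = 1" and v: "\<And>k. k \<in> F \<Longrightarrow> norm (v k) \<le> 1"
    and sm: "\<And>G. G \<subseteq> F \<Longrightarrow> hi ` G \<in> schreier (f J) \<Longrightarrow> (\<Sum>k\<in>G. a k) \<le> 1 / (2 * real (m J))"
    and y: "y = (\<Sum>k\<in>F. a k *\<^sub>R v k)" and half: "1 / 2 \<le> norm y"
  shows "tame J ((1 / norm y) *\<^sub>R y)"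
  unfolding tame_def
proof (intro allI impI)
  fix i g assume i: "1 \<le> i" "i < J" and w: "weighted m n i g"
  have gm: "meas m n g" using w i(1) by (rule weighted_meas)
  obtain G where G: "G \<subseteq> F" "hi ` G \<in> schreier (n i)"
    "\<bar>\<phi> g (\<Sum>k\<in>F. a k *\<^sub>R v k)\<bar> \<le> (\<Sum>k\<in>F. a k) / real (m i) + (\<Sum>k\<in>G. a k)"
    by (rule average_estimate[OF i(1) w fin bl a(1) v]) (assumption | rule that)+
  have "hi ` G \<in> schreier (f J)" using G(2) n_le_f[OF i] by (rule schreier_mono)
  then have "(\<Sum>k\<in>G. a k) \<le> 1 / (2 * real (m J))" using sm G(1) by blast
  also have "\<dots> \<le> 1 / (2 * real (m i))"
    using m_less[OF i] m_pos[OF i(1)] by (intro divide_left_mono) simp_all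
  finally have "\<bar>\<phi> g y\<bar> \<le> 3 / 2 / real (m i)" using G(3) a(2) unfolding y by (simp add: field_simps)
  also have "\<dots> \<le> 3 / real (m i) * norm y"
    using mult_left_mono[OF half, of "3 / real (m i)"] by simp
  finally show "\<bar>\<phi> g ((1 / norm y) *\<^sub>R y)\<bar> \<le> 3 / real (m i)"
    using half by (simp add: phi_scale[OF gm] abs_mult divide_le_eq)
qed

text \<open>If every special average of normalized blocks had norm below \<open>1/2\<close>, then \<open>l J\<close> rounds of
  averaging and normalizing would produce a vector of norm 1 whose coefficients sum to at least
  \<open>2 ^ l J > m J\<close> and whose support is in \<open>schreier (n J)\<close>, contradicting the lower estimate.\<close>

lemma good_vector:
  assumes J: "1 \<le> J" and bl: "blocks {1..} lo hi u" and u: "\<And>k. 1 \<le> k \<Longrightarrow> norm (u k) = 1"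
  shows "\<exists>E c. finite E \<and> E \<noteq> {} \<and> (\<forall>k\<in>E. n0 < k) \<and> (\<forall>k. 0 \<le> c k) \<and>
    norm (\<Sum>k\<in>E. c k *\<^sub>R u k) = 1 \<and> tame J (\<Sum>k\<in>E. c k *\<^sub>R u k)"
proof (rule ccontr)
  assume no: "\<not> ?thesis"
  have mJ: "0 < real (m J)" using m_pos[OF J] .
  \<comment> \<open>The state after \<open>s\<close> rounds. Each round multiplies the coefficient
    sum by at least 2 and adds \<open>f J + 1\<close> to the order; \<open>N\<close> lets the
    support start arbitrarily far out.\<close>
  define Good where "Good s N E c \<longleftrightarrow> E \<in> schreier (s * (f J + 1)) \<and> E \<noteq> {} \<and> (\<forall>k\<in>E. n0 + N < k) \<and>
    (\<forall>k. 0 \<le> c k) \<and> norm (\<Sum>k\<in>E. c k *\<^sub>R u k) = 1 \<and> 2 ^ s \<le> (\<Sum>k\<in>E. c k)"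
    for s N E and c :: "nat \<Rightarrow> real"
  have grow: "\<exists>E c. Good s N E c" for s N
  proof (induction s arbitrary: N)
    case 0
    have "Good 0 N {n0 + N + 1} (\<lambda>_. 1)" unfolding Good_def using u[of "n0 + N + 1"] schreier_singleton by simp
    then show ?case by blast
  next
    case (Suc s)
    \<comment> \<open>The \<open>i\<close> added to \<open>N\<close> makes the support of the
      \<open>i\<close>-th vector lie beyond \<open>i\<close>, so that the indices can serve as
      points of \<open>T\<close> in \<open>schreier_union\<close>.\<close>
    define P where "P i Z \<longleftrightarrow> Good s (N + i) (fst Z) (snd Z)" for i :: nat and Z :: "nat set \<times> (nat \<Rightarrow> real)"
    define Q where "Q i Z Z' \<longleftrightarrow> (\<forall>k\<in>fst Z. \<forall>k'\<in>fst Z'. k < k')"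
      for i :: nat and Z Z' :: "nat set \<times> (nat \<Rightarrow> real)"
    have "\<exists>Z. \<forall>i. P i (Z i) \<and> Q i (Z i) (Z (Suc i))"
    proof (rule dependent_nat_choice)
      obtain E c where "Good s N E c" using Suc.IH[of N] by blast
      then show "\<exists>Z. P 0 Z" unfolding P_def by (intro exI[of _ "(E, c)"]) simp
    next
      fix Z :: "nat set \<times> (nat \<Rightarrow> real)" and i assume Z: "P i Z"
      have fin: "finite (fst Z)" using Z schreier_finite unfolding P_def Good_def by blast
      obtain E c where E: "Good s (N + Suc i + Max (fst Z)) E c" using Suc.IH[of "N + Suc i + Max (fst Z)"] by blast
      have "P (Suc i) (E, c)" using E unfolding P_def Good_def by auto
      moreover have "k < k'" if "k \<in> fst Z" "k' \<in> E" for k k'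
      proof -
        have "k \<le> Max (fst Z)" using fin that(1) by simp
        moreover have "n0 + (N + Suc i + Max (fst Z)) < k'" using E that(2) unfolding Good_def by simp
        ultimately show ?thesis by simp
      qed
      then have "Q i Z (E, c)" unfolding Q_def by simp
      ultimately show "\<exists>Z'. P (Suc i) Z' \<and> Q i Z Z'" by blast
    qed
    then obtain Z where Z: "\<And>i. P i (Z i)" "\<And>i. Q i (Z i) (Z (Suc i))" by blast
    define E where "E i = fst (Z i)" for i
    define c where "c i = snd (Z i)" for i
    have G: "Good s (N + i) (E i) (c i)" for i using Z(1)[of i] unfolding P_def E_def c_def .
    have E: "E i \<in> schreier (s * (f J + 1))" "E i \<noteq> {}" "0 \<le> c i k"
      "norm (\<Sum>k\<in>E i. c i k *\<^sub>R u k) = 1" "2 ^ s \<le> (\<Sum>k\<in>E i. c i k)" for i k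
      using G[of i] unfolding Good_def by simp_all
    have E_gt: "n0 + (N + i) < k" if "k \<in> E i" for i k
      using G[of i] that unfolding Good_def by simp
    have finE: "finite (E i)" for i using E(1) by (rule schreier_finite)
    have ord: "k < k'" if "i < i'" "k \<in> E i" "k' \<in> E i'" for i i' k k'
    proof (rule successive_less[of E, OF E(2) _ that])
      show "x < y" if "x \<in> E i" "y \<in> E (Suc i)" for i x y
        using Z(2)[of i] that unfolding Q_def E_def by blast
    qed
    have E1: "E i \<subseteq> {1..}" for i
    proof
      fix k assume "k \<in> E i"
      then show "k \<in> {1..}" using E_gt[of k i] by simp
    qed
    define v where "v i = (\<Sum>k\<in>E i. c i k *\<^sub>R u k)" for i
    define lo' where "lo' i = lo (Min (E i))" for i
    define hi' where "hi' i = hi (Max (E i))" for i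
    have blv: "blocks {1..} lo' hi' v" unfolding lo'_def hi'_def v_def
      using bl finE E(2) E1 ord by (rule blocks_comb)
    have nv: "norm (v i) = 1" for i unfolding v_def using E(4) .
    have "0 < 1 / (2 * real (m J))" using mJ by simp
    from special_convex[OF blocks_hi_mono[OF blv] this, of "f J" 0] obtain F a where
      F: "F \<in> schreier (Suc (f J))" "F \<noteq> {}" "\<forall>k\<in>F. 0 < k" "\<forall>k. 0 \<le> a k"
      "\<forall>k. k \<notin> F \<longrightarrow> a k = 0" "(\<Sum>k\<in>F. a k) = 1"
      "\<forall>G\<subseteq>F. hi' ` G \<in> schreier (f J) \<longrightarrow> (\<Sum>k\<in>G. a k) \<le> 1 / (2 * real (m J))"
      by (elim exE conjE)
    have finF: "finite F" using F(1) by (rule schreier_finite)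
    have F1: "F \<subseteq> {1..}" using F(3) by auto
    have blF: "blocks F lo' hi' v" using blv F1 by (rule blocks_subset)
    define y where "y = (\<Sum>i\<in>F. a i *\<^sub>R v i)"
    define E' where "E' = (\<Union>i\<in>F. E i)"
    define C where "C k = (\<Sum>i\<in>F. if k \<in> E i then a i * c i k else 0)" for k
    have finE': "finite E'" unfolding E'_def using finF finE by blast
    have C0: "0 \<le> C k" for k unfolding C_def using F(4) E(3) by (intro sum_nonneg) simp
    have y_C: "y = (\<Sum>k\<in>E'. C k *\<^sub>R u k)"
    proof -
      have "(\<Sum>k\<in>E'. C k *\<^sub>R u k)
          = (\<Sum>k\<in>E'. \<Sum>i\<in>F. if k \<in> E i then (a i * c i k) *\<^sub>R u k else 0)"
        unfolding C_def scaleR_sum_left by (intro sum.cong refl) simp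
      also have "\<dots> = (\<Sum>i\<in>F. \<Sum>k\<in>E i. (a i * c i k) *\<^sub>R u k)"
        unfolding E'_def using finF finE by (rule sum_UN_swap)
      also have "\<dots> = y" unfolding y_def v_def scaleR_sum_right by simp
      finally show ?thesis by simp
    qed
    have sum_C: "2 ^ s \<le> (\<Sum>k\<in>E'. C k)"
    proof -
      have "2 ^ s = (\<Sum>i\<in>F. a i * 2 ^ s)" using F(6) by (simp add: sum_distrib_right[symmetric])
      also have "\<dots> \<le> (\<Sum>i\<in>F. a i * (\<Sum>k\<in>E i. c i k))"
        using F(4) E(5) by (intro sum_mono mult_left_mono) simp_all
      also have "\<dots> = (\<Sum>i\<in>F. \<Sum>k\<in>E i. a i * c i k)" by (simp add: sum_distrib_left)
      also have "\<dots> = (\<Sum>k\<in>E'. C k)" unfolding E'_def C_def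
        using finF finE by (rule sum_UN_swap[symmetric])
      finally show ?thesis .
    qed
    have E'_S: "E' \<in> schreier (Suc s * (f J + 1))"
    proof -
      have "E' \<in> schreier (Suc (f J) + s * (f J + 1))" unfolding E'_def
      proof (rule schreier_union[OF F(1) E(1)])
        show "i \<le> k" if "k \<in> E i" for i k using E_gt[OF that] by simp
      qed (rule ord)
      moreover have "Suc (f J) + s * (f J + 1) = Suc s * (f J + 1)" by simp
      ultimately show ?thesis by (simp only:)
    qed
    have E'_gt: "n0 + N < k" if "k \<in> E'" for k
    proof -
      from that obtain i where "k \<in> E i" unfolding E'_def by blast
      then show ?thesis using E_gt[of k i] by simp
    qed
    have E'_ne: "E' \<noteq> {}" unfolding E'_def using F(2) E(2) by blast
    \<comment> \<open>The lower estimate applies since \<open>f J + 1\<close> is below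
      \<open>n J\<close>; without it the average could vanish and could not be normalized.\<close>
    have y_pos: "0 < norm y"
    proof -
      have "F \<in> schreier (n J)" using F(1) f_less_n[OF J] by (auto intro: schreier_mono)
      then have "(\<Sum>k\<in>F. \<bar>a k\<bar> * norm (v k)) / real (m J) \<le> norm y" unfolding y_def
        using blocks_ge[OF blv] F1 by (intro lower_l1[OF J _ blF]) auto
      then have "1 / real (m J) \<le> norm y" using F(4,6) by (simp add: nv)
      then show ?thesis using mJ by (smt (verit) zero_less_divide_1_iff)
    qed
    define D where "D k = C k / norm y" for k
    have D_y: "(\<Sum>k\<in>E'. D k *\<^sub>R u k) = (1 / norm y) *\<^sub>R y"
      unfolding D_def by (subst y_C) (simp add: scaleR_sum_right)
    have D0: "0 \<le> D k" for k unfolding D_def using C0 by simp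
    have D1: "norm (\<Sum>k\<in>E'. D k *\<^sub>R u k) = 1" unfolding D_y using y_pos by simp
    have "norm y < 1 / 2"
    \<comment> \<open>An average of norm at least \<open>1 / 2\<close> would normalize to a tame
      vector, which was excluded.\<close>
    proof (rule ccontr)
      assume "\<not> norm y < 1 / 2"
      then have "tame J ((1 / norm y) *\<^sub>R y)"
        using F(4,6,7) nv by (intro tame_average[OF J finF blF _ _ _ _ y_def]) simp_all
      moreover have "\<forall>k\<in>E'. n0 < k" using E'_gt by fastforce
      ultimately show False using no finE' E'_ne D0 D1 D_y by metis
    qed
    then have "2 ^ Suc s \<le> (\<Sum>k\<in>E'. D k)"
    proof -
      assume h: "norm y < 1 / 2"
      \<comment> \<open>Dividing by a norm below \<open>1 / 2\<close> more than doubles the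
        coefficients, while averaging has preserved the lower bound on their sum.\<close>
      have "2 ^ Suc s * norm y \<le> 2 ^ Suc s * (1 / 2)" using h by (intro mult_left_mono) simp_all
      also have "\<dots> = (2::real) ^ s" by simp
      also note sum_C
      finally have "2 ^ Suc s \<le> (\<Sum>k\<in>E'. C k) / norm y" using y_pos by (simp add: le_divide_eq)
      then show ?thesis unfolding D_def by (simp add: sum_divide_distrib)
    qed
    then have "Good (Suc s) N E' D" unfolding Good_def using E'_S E'_ne E'_gt D0 D1 by simp
    then show ?case by blast
  qed
  obtain E c where "Good (l J) 0 E c" using grow by blast
  then have E: "E \<in> schreier (l J * (f J + 1))" "\<And>k. k \<in> E \<Longrightarrow> n0 < k" "\<And>k. 0 \<le> c k"
    "norm (\<Sum>k\<in>E. c k *\<^sub>R u k) = 1" "2 ^ l J \<le> (\<Sum>k\<in>E. c k)"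
    unfolding Good_def by simp_all
  have E1: "E \<subseteq> {1..}"
  proof
    fix k assume "k \<in> E"
    then show "k \<in> {1..}" using E(2)[of k] by simp
  qed
  \<comment> \<open>Goodness of \<open>N\<close> enters here: \<open>l J\<close> rounds of cost
    \<open>f J + 1\<close> fit into order \<open>n J\<close>.\<close>
  have "E \<in> schreier (n J)" using E(1) good[OF J] by (auto intro: schreier_mono)
  then have "(\<Sum>k\<in>E. \<bar>c k\<bar> * norm (u k)) / real (m J) \<le> norm (\<Sum>k\<in>E. c k *\<^sub>R u k)"
    using blocks_ge[OF bl] E1 by (intro lower_l1[OF J _ blocks_subset[OF bl E1]]) auto
  moreover have "(\<Sum>k\<in>E. \<bar>c k\<bar> * norm (u k)) = (\<Sum>k\<in>E. c k)"
  proof (rule sum.cong[OF refl])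
    fix k assume "k \<in> E"
    then have "1 \<le> k" using E1 by auto
    then show "\<bar>c k\<bar> * norm (u k) = c k" using u E(3) by simp
  qed
  ultimately have "(\<Sum>k\<in>E. c k) \<le> real (m J)" using E(4) mJ by (simp add: divide_le_eq)
  moreover have "real (m J) < 2 ^ l J" using pow_l[OF J] by (metis of_nat_less_iff of_nat_numeral of_nat_power)
  ultimately show False using E(5) by simp
qed

text \<open>For a fixed weight \<open>m i\<close>, vectors with \<open>J k > i\<close> are
  controlled by tameness, and those with \<open>J (Suc k) \<le> i\<close> by smallness of the point
  masses of heavy measures. Only the \<open>k\<close> with \<open>J k \<le> i < J (Suc k)\<close>
  escapes.\<close>

lemma rapidly_increasing:
  assumes j: "1 \<le> j" and bl: "blocks {1..} lo hi u" and u: "\<And>k. 1 \<le> k \<Longrightarrow> norm (u k) = 1"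
  obtains E :: "nat \<Rightarrow> nat set" and c where "\<And>k. finite (E k)" "\<And>k. E k \<noteq> {}" "\<And>k. E k \<subseteq> {1..}"
    "\<And>k l p q. k < l \<Longrightarrow> p \<in> E k \<Longrightarrow> q \<in> E l \<Longrightarrow> p < q" "\<And>k p. 0 \<le> c k p"
    "\<And>k. norm (\<Sum>p\<in>E k. c k p *\<^sub>R u p) = 1"
    "\<And>i. j \<le> i \<Longrightarrow> \<exists>k0. \<forall>k. k \<noteq> k0 \<longrightarrow>
      (\<forall>g. weighted m n i g \<longrightarrow> \<bar>\<phi> g (\<Sum>p\<in>E k. c k p *\<^sub>R u p)\<bar> \<le> 3 / real (m j))"
proof -
  have mj: "0 < real (m j)" using m_pos[OF j] .
  define vec where "vec E c = (\<Sum>k\<in>E. c k *\<^sub>R u k)" for E and c :: "nat \<Rightarrow> real"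
  define R where "R N E c J \<longleftrightarrow> j \<le> J \<and> finite E \<and> E \<noteq> {} \<and> (\<forall>k\<in>E. N < k) \<and> (\<forall>k. 0 \<le> c k) \<and>
    norm (vec E c) = 1 \<and> tame J (vec E c)" for N J :: nat and E and c :: "nat \<Rightarrow> real"
  have ex: "\<exists>E c. R N E c J" if "j \<le> J" for N J
    using good_vector[OF _ bl u, of J N] that j unfolding R_def vec_def by auto
  have span1: "vec E c \<in> span (e ` {1..})" if "\<forall>k\<in>E. 0 < k" for E c
    unfolding vec_def
  proof (intro span_sum span_scale)
    fix k assume "k \<in> E"
    then have "k \<in> {1..}" using that by auto
    then show "u k \<in> span (e ` {1..})" using span_mono1 blocksD(3,1)[OF bl] by blast
  qed
  define P where "P i Z \<longleftrightarrow> R 0 (fst Z) (fst (snd Z)) (snd (snd Z))"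
    for i :: nat and Z :: "nat set \<times> (nat \<Rightarrow> real) \<times> nat"
  define Q where "Q i Z Z' \<longleftrightarrow> (\<forall>k\<in>fst Z. \<forall>k'\<in>fst Z'. k < k') \<and> snd (snd Z) < snd (snd Z') \<and>
      (\<forall>i\<ge>snd (snd Z'). \<forall>g. weighted m n i g \<longrightarrow> \<bar>\<phi> g (vec (fst Z) (fst (snd Z)))\<bar> \<le> 3 / real (m j))"
    for i :: nat and Z Z' :: "nat set \<times> (nat \<Rightarrow> real) \<times> nat"
  have "\<exists>Z. \<forall>i. P i (Z i) \<and> Q i (Z i) (Z (Suc i))"
  proof (rule dependent_nat_choice)
    obtain E c where "R 0 E c j" using ex[of j 0] by blast
    then show "\<exists>Z. P 0 Z" unfolding P_def by (intro exI[of _ "(E, c, j)"]) simp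
  next
    fix Z :: "nat set \<times> (nat \<Rightarrow> real) \<times> nat" and i assume PZ: "P i Z"
    obtain E c J where Z: "Z = (E, c, J)" by (cases Z)
    have E: "R 0 E c J" using PZ unfolding P_def Z by simp
    then have "vec E c \<in> span (e ` {1..})" by (intro span1) (simp add: R_def)
    from coef_bound[OF this] obtain C where C: "0 \<le> C"
      "\<forall>g \<delta>. meas m n g \<longrightarrow> (\<forall>k. \<bar>g k\<bar> \<le> \<delta>) \<longrightarrow> \<bar>\<phi> g (vec E c)\<bar> \<le> C * \<delta>"
      by (elim exE conjE)
    \<comment> \<open>From \<open>i \<ge> J'\<close> on, \<open>m i \<ge> i \<ge> C * m j\<close>,
      so weight \<open>m i\<close> acts on the present vector by at most
      \<open>1 / m j\<close>.\<close>
    define J' where "J' = J + 1 + nat \<lceil>C * real (m j)\<rceil>"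
    have J': "j \<le> J'" "J < J'" using E unfolding R_def J'_def by simp_all
    have small: "\<bar>\<phi> g (vec E c)\<bar> \<le> 3 / real (m j)" if i: "J' \<le> i" and w: "weighted m n i g" for i g
    proof -
      have i1: "1 \<le> i" using i j J'(1) by simp
      have "C * real (m j) \<le> real i" using i unfolding J'_def by linarith
      also have "\<dots> \<le> real (m i)" using m_unbounded[OF i1] by simp
      finally have Cm: "C * real (m j) \<le> real (m i)" .
      have "\<bar>\<phi> g (vec E c)\<bar> \<le> C * (1 / real (m i))"
        using C(2)[rule_format, OF weighted_meas[OF w i1] weighted_bound[OF w m_one]] by simp
      also have "\<dots> \<le> 1 / real (m j)" using Cm mj m_pos[OF i1] by (simp add: field_simps)
      also have "\<dots> \<le> 3 / real (m j)" using mj by (intro divide_right_mono) simp_all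
      finally show ?thesis .
    qed
    obtain E' c' where E': "R (Max E) E' c' J'" using ex[OF J'(1)] by blast
    have "k < k'" if "k \<in> E" "k' \<in> E'" for k k'
    proof -
      have "k \<le> Max E" using E that(1) unfolding R_def by simp
      moreover have "Max E < k'" using E' that(2) unfolding R_def by simp
      ultimately show ?thesis by simp
    qed
    then have "Q i Z (E', c', J')" unfolding Q_def Z fst_conv snd_conv using J'(2) small by blast
    moreover have "P (Suc i) (E', c', J')" using E' unfolding P_def R_def by auto
    ultimately show "\<exists>Z'. P (Suc i) Z' \<and> Q i Z Z'" by blast
  qed
  then obtain Z where Z: "\<And>i. P i (Z i)" "\<And>i. Q i (Z i) (Z (Suc i))" by blast
  define E where "E i = fst (Z i)" for i
  define c where "c i = fst (snd (Z i))" for i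
  define J where "J i = snd (snd (Z i))" for i
  have R: "R 0 (E i) (c i) (J i)" for i
    using Z(1)[of i] unfolding P_def E_def c_def J_def .
  have QZ: "(\<forall>p\<in>E k. \<forall>q\<in>E (Suc k). p < q) \<and> J k < J (Suc k) \<and>
      (\<forall>i\<ge>J (Suc k). \<forall>g. weighted m n i g \<longrightarrow> \<bar>\<phi> g (vec (E k) (c k))\<bar> \<le> 3 / real (m j))" for k
    using Z(2)[of k] unfolding Q_def E_def c_def J_def .
  have Q: "k < k'" if "k \<in> E i" "k' \<in> E (Suc i)" for i k k'
    using QZ[of i, THEN conjunct1, rule_format, OF that] .
  have QJ: "J k < J (Suc k)" for k using QZ[of k] by (elim conjE)
  have Qs: "\<bar>\<phi> g (vec (E k) (c k))\<bar> \<le> 3 / real (m j)" if "J (Suc k) \<le> i" "weighted m n i g" for i k g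
    using QZ[of k, THEN conjunct2, THEN conjunct2, rule_format, OF that] .
  have J_mono: "J k \<le> J k'" if "k \<le> k'" for k k'
    by (rule lift_Suc_mono_le[of J, OF less_imp_le[OF QJ] that])
  have Ene: "E k \<noteq> {}" for k using R[of k] unfolding R_def by blast
  show ?thesis
  proof (rule that[of E c])
    show "finite (E k)" "E k \<noteq> {}" "0 \<le> c k p" for k p
      using R[of k] unfolding R_def by simp_all
    show "E k \<subseteq> {1..}" for k
    proof
      fix p assume "p \<in> E k"
      then have "0 < p" using R[of k] unfolding R_def by blast
      then show "p \<in> {1..}" by simp
    qed
    show "norm (\<Sum>p\<in>E k. c k p *\<^sub>R u p) = 1" for k using R[of k] unfolding R_def vec_def by simp
    show "p < q" if "k < l" "p \<in> E k" "q \<in> E l" for k l p q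
      using Ene Q that by (rule successive_less)
    fix i assume ji: "j \<le> i"
    then have i1: "1 \<le> i" using j by simp
    have early: "\<bar>\<phi> g (vec (E k) (c k))\<bar> \<le> 3 / real (m j)" if "i < J k" "weighted m n i g" for k g
    proof -
      have "\<bar>\<phi> g (vec (E k) (c k))\<bar> \<le> 3 / real (m i)"
      proof -
        have "tame (J k) (vec (E k) (c k))" using R[of k] unfolding R_def by simp
        then show ?thesis unfolding tame_def using i1 that by simp
      qed
      also have "\<dots> \<le> 3 / real (m j)" using m_le[OF j ji] mj by (intro divide_left_mono) simp_all
      finally show ?thesis .
    qed
    \<comment> \<open>The intervals from \<open>J k\<close> up to, but excluding,
      \<open>J (Suc k)\<close> are disjoint; if \<open>i\<close> lies before all of them, any
      \<open>k0\<close> will do.\<close>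
    have "\<exists>k0. \<forall>k. k \<noteq> k0 \<longrightarrow> i < J k \<or> J (Suc k) \<le> i"
    proof (cases "\<exists>k. J k \<le> i \<and> i < J (Suc k)")
      case True
      then obtain k0 where k0: "J k0 \<le> i" "i < J (Suc k0)" by blast
      have "i < J k \<or> J (Suc k) \<le> i" if "k \<noteq> k0" for k
      proof (cases "k < k0")
        case True
        then have "J (Suc k) \<le> J k0" by (intro J_mono) simp
        then show ?thesis using k0 by simp
      next
        case False
        then have "J (Suc k0) \<le> J k" using that by (intro J_mono) simp
        then show ?thesis using k0 by simp
      qed
      then show ?thesis by blast
    next
      case False
      have "i < J k \<or> J (Suc k) \<le> i" for k
      proof (rule ccontr)
        assume "\<not> (i < J k \<or> J (Suc k) \<le> i)"
        then have "J k \<le> i \<and> i < J (Suc k)" by simp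
        then show False using False by blast
      qed
      then show ?thesis by simp
    qed
    then obtain k0 where k0: "\<forall>k. k \<noteq> k0 \<longrightarrow> i < J k \<or> J (Suc k) \<le> i" by (elim exE)
    have "\<forall>k. k \<noteq> k0 \<longrightarrow> (\<forall>g. weighted m n i g \<longrightarrow> \<bar>\<phi> g (vec (E k) (c k))\<bar> \<le> 3 / real (m j))"
    proof (intro allI impI)
      fix k g assume k: "k \<noteq> k0" and w: "weighted m n i g"
      consider "i < J k" | "J (Suc k) \<le> i" using k0 k by blast
      then show "\<bar>\<phi> g (vec (E k) (c k))\<bar> \<le> 3 / real (m j)"
        using early[OF _ w] Qs[OF _ w] by cases
    qed
    then show "\<exists>k0. \<forall>k. k \<noteq> k0 \<longrightarrow>
      (\<forall>g. weighted m n i g \<longrightarrow> \<bar>\<phi> g (\<Sum>p\<in>E k. c k p *\<^sub>R u p)\<bar> \<le> 3 / real (m j))"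
      unfolding vec_def by blast
  qed
qed

end

section \<open>The basis and its blocks\<close>

context tree_space
begin

lemma blocks_SucI:
  assumes "\<And>k. 1 \<le> k \<Longrightarrow> 1 \<le> lo k \<and> lo k \<le> hi k \<and> x k \<in> span (e ` {lo k..hi k}) \<and> hi k < lo (Suc k)"
  shows "blocks {1..} lo hi x"
proof -
  have ord: "hi k < lo l" if "1 \<le> k" "k < l" for k l
    using that(2)
  proof (induction l)
    case (Suc l)
    show ?case
    proof (cases "k = l")
      case False
      then have "hi k < lo l" using Suc by simp
      moreover have "lo l \<le> hi l" "hi l < lo (Suc l)" using assms[of l] Suc.prems that(1) by simp_all
      ultimately show ?thesis by simp
    qed (use assms[OF that(1)] in simp)
  qed simp
  show ?thesis unfolding blocks_def using assms ord by simp
qed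

lemma blocks_scale:
  assumes "blocks K lo hi x"
  shows "blocks K lo hi (\<lambda>k. r k *\<^sub>R x k)"
  using assms unfolding blocks_def by (simp add: span_scale)

lemma block_basis_blocks:
  assumes "block_basis e u"
  obtains lo hi where "blocks {1..} lo hi u" "\<And>k. 1 \<le> k \<Longrightarrow> u k \<noteq> 0"
proof -
  obtain F a where F: "\<And>n. 1 \<le> n \<Longrightarrow> finite (F n) \<and> F n \<noteq> {} \<and> 0 \<notin> F n \<and> Max (F n) < Min (F (Suc n)) \<and>
        u n = (\<Sum>i\<in>F n. a i *\<^sub>R e i) \<and> u n \<noteq> 0"
    using assms unfolding block_basis_def by blast
  have "blocks {1..} (\<lambda>k. Min (F k)) (\<lambda>k. Max (F k)) u"
  proof (rule blocks_SucI)
    fix k :: nat assume k: "1 \<le> k"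
    have fin: "finite (F k)" "F k \<noteq> {}" "0 \<notin> F k" using F[OF k] by simp_all
    have "Min (F k) \<in> F k" using fin by simp
    then have "Min (F k) \<noteq> 0" using fin(3) by metis
    then have m1: "1 \<le> Min (F k)" by linarith
    have m2: "Min (F k) \<le> Max (F k)" using fin by simp
    have m3: "u k \<in> span (e ` {Min (F k)..Max (F k)})"
    proof -
      have "(\<Sum>i\<in>F k. a i *\<^sub>R e i) \<in> span (e ` {Min (F k)..Max (F k)})"
        using fin by (intro span_sum span_scale span_base imageI) simp
      then show ?thesis using F[OF k] by simp
    qed
    have m4: "Max (F k) < Min (F (Suc k))" using F[OF k] by (elim conjE)
    from m1 m2 m3 m4 show "1 \<le> Min (F k) \<and> Min (F k) \<le> Max (F k) \<and>
        u k \<in> span (e ` {Min (F k)..Max (F k)}) \<and> Max (F k) < Min (F (Suc k))" by (intro conjI)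
  qed
  moreover have "u k \<noteq> 0" if "1 \<le> k" for k using F[OF that] by (elim conjE)
  ultimately show ?thesis by (rule that)
qed

section \<open>Coordinates, unconditionality and bimonotonicity\<close>

abbreviation X :: "'a set" where
  "X \<equiv> closure (span (e ` {1..}))"

definition coord :: "nat \<Rightarrow> 'a \<Rightarrow> real" where
  "coord i = \<phi> (\<lambda>k. if k = i then 1 else 0)"

lemma coord_meas: "1 \<le> i \<Longrightarrow> meas m n (\<lambda>k. if k = i then 1 else 0)"
  by (rule meas.point) simp_all

lemma coord_e: "1 \<le> i \<Longrightarrow> 1 \<le> k \<Longrightarrow> coord i (e k) = (if k = i then 1 else 0)"
  unfolding coord_def using phi_e[OF coord_meas] by simp

lemma coord_linear: "1 \<le> i \<Longrightarrow> linear (coord i)"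
  unfolding coord_def using lin[OF coord_meas] .

lemma coord_bounded_linear: "1 \<le> i \<Longrightarrow> bounded_linear (coord i)"
proof (rule bounded_linear_intro[where K = 1])
  assume i: "1 \<le> i"
  show "coord i (x + y) = coord i x + coord i y" for x y using coord_linear[OF i] by (rule linear_add)
  show "coord i (r *\<^sub>R x) = r *\<^sub>R coord i x" for r x using coord_linear[OF i] by (rule linear_scale)
  show "norm (coord i x) \<le> norm x * 1" for x unfolding coord_def using phi_le[OF coord_meas[OF i]] by simp
qed

lemma e_span: "A \<subseteq> {1..} \<Longrightarrow> (\<Sum>i\<in>A. a i *\<^sub>R e i) \<in> span (e ` {1..})"
  by (intro span_sum span_scale span_base) auto

text \<open>The multiplier is moved from the vector to the measure, where \<open>meas_mult\<close>
  absorbs it.\<close>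

lemma norm_mult_le:
  assumes A: "A \<subseteq> {1..}" and s: "\<And>k. \<sigma> k \<in> {-1, 0, 1}"
  shows "norm (\<Sum>k\<in>A. (\<sigma> k * a k) *\<^sub>R e k) \<le> norm (\<Sum>k\<in>A. a k *\<^sub>R e k)"
proof (rule norm_leI[OF e_span[OF A]])
  fix g assume g: "meas m n g"
  have g': "meas m n (\<lambda>k. \<sigma> k * g k)" using g s by (rule meas_mult)
  have "\<phi> g (\<Sum>k\<in>A. (\<sigma> k * a k) *\<^sub>R e k) = (\<Sum>k\<in>A. a k * \<phi> (\<lambda>k. \<sigma> k * g k) (e k))"
    unfolding phi_sum[OF g]
  proof (rule sum.cong[OF refl])
    fix k assume "k \<in> A"
    then have "1 \<le> k" using A by auto
    then show "\<sigma> k * a k * \<phi> g (e k) = a k * \<phi> (\<lambda>k. \<sigma> k * g k) (e k)"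
      using phi_e[OF g] phi_e[OF g'] by simp
  qed
  also have "\<dots> = \<phi> (\<lambda>k. \<sigma> k * g k) (\<Sum>k\<in>A. a k *\<^sub>R e k)" by (rule phi_sum[OF g', symmetric])
  also have "\<dots> \<le> norm (\<Sum>k\<in>A. a k *\<^sub>R e k)" using phi_le[OF g'] by (simp add: abs_le_iff)
  finally show "\<phi> g (\<Sum>k\<in>A. (\<sigma> k * a k) *\<^sub>R e k) \<le> norm (\<Sum>k\<in>A. a k *\<^sub>R e k)" .
qed

lemma norm_restrict_le:
  assumes A: "A \<subseteq> {1..}" "finite A" and B: "B \<subseteq> A"
  shows "norm (\<Sum>k\<in>B. a k *\<^sub>R e k) \<le> norm (\<Sum>k\<in>A. a k *\<^sub>R e k)"
proof -
  have "(\<Sum>k\<in>A. ((if k \<in> B then 1 else 0) * a k) *\<^sub>R e k) = (\<Sum>k\<in>B. ((if k \<in> B then 1 else 0) * a k) *\<^sub>R e k)"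
    using A B by (intro sum.mono_neutral_right) auto
  also have "\<dots> = (\<Sum>k\<in>B. a k *\<^sub>R e k)" by (intro sum.cong) auto
  finally show ?thesis using norm_mult_le[OF A(1), of "\<lambda>k. if k \<in> B then 1 else 0" a] by simp
qed

lemma expansion_coef:
  assumes "expansion e a x" "1 \<le> i"
  shows "coord i x = a i"
proof -
  have "(\<lambda>n. coord i (\<Sum>k\<in>{1..n}. a k *\<^sub>R e k)) \<longlonglongrightarrow> coord i x"
    using assms bounded_linear.tendsto[OF coord_bounded_linear] unfolding expansion_def by blast
  moreover have "coord i (\<Sum>k\<in>{1..N}. a k *\<^sub>R e k) = a i" if "i \<le> N" for N
  proof -
    have "coord i (\<Sum>k\<in>{1..N}. a k *\<^sub>R e k) = (\<Sum>k\<in>{1..N}. a k * coord i (e k))"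
      unfolding coord_def by (rule phi_sum[OF coord_meas[OF assms(2)]])
    also have "\<dots> = (\<Sum>k\<in>{1..N}. if k = i then a k else 0)"
      using assms(2) by (intro sum.cong) (simp_all add: coord_e)
    also have "\<dots> = a i" using that assms(2) by simp
    finally show ?thesis .
  qed
  then have "(\<lambda>n. coord i (\<Sum>k\<in>{1..n}. a k *\<^sub>R e k)) \<longlonglongrightarrow> a i"
    by (intro tendsto_eventually) (auto simp: eventually_sequentially)
  ultimately show ?thesis by (rule LIMSEQ_unique)
qed

lemma expansion_sum_le:
  assumes "expansion e a x" "1 \<le> p"
  shows "norm (\<Sum>i\<in>{p..q}. a i *\<^sub>R e i) \<le> norm x"
proof (rule LIMSEQ_le_const)
  show "(\<lambda>n. norm (\<Sum>i\<in>{1..n}. a i *\<^sub>R e i)) \<longlonglongrightarrow> norm x"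
    using assms(1) unfolding expansion_def by (rule tendsto_norm)
  have "norm (\<Sum>i\<in>{p..q}. a i *\<^sub>R e i) \<le> norm (\<Sum>i\<in>{1..n}. a i *\<^sub>R e i)" if "q \<le> n" for n
    using that assms(2) by (intro norm_restrict_le) auto
  then show "\<exists>N. \<forall>n\<ge>N. norm (\<Sum>i\<in>{p..q}. a i *\<^sub>R e i) \<le> norm (\<Sum>i\<in>{1..n}. a i *\<^sub>R e i)" by blast
qed

lemma sum_split: "q \<le> p \<Longrightarrow> (\<Sum>i\<in>{1..p}. b i) - (\<Sum>i\<in>{1..q}. b i) = (\<Sum>i\<in>{q+1..p}. b i)"
  for b :: "nat \<Rightarrow> 'a"
proof -
  assume "q \<le> p"
  then have "{1..p} - {1..q} = {q+1..p}" "{1..q} \<subseteq> {1..p}" by auto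
  then show ?thesis using sum_diff[of "{1..p}" "{1..q}" b] by simp
qed

lemma bimonotone_e: "bimonotone e"
  unfolding bimonotone_def
proof (intro allI impI conjI)
  fix a x assume ex: "expansion e a x"
  show "norm (\<Sum>i\<in>{p..q}. a i *\<^sub>R e i) \<le> norm x" if "1 \<le> p" for p q
    using ex that by (rule expansion_sum_le)
  show "norm (x - (\<Sum>i\<in>{1..q}. a i *\<^sub>R e i)) \<le> norm x" for q
  proof (rule LIMSEQ_le_const2)
    show "(\<lambda>n. norm ((\<Sum>i\<in>{1..n}. a i *\<^sub>R e i) - (\<Sum>i\<in>{1..q}. a i *\<^sub>R e i)))
        \<longlonglongrightarrow> norm (x - (\<Sum>i\<in>{1..q}. a i *\<^sub>R e i))"
      using ex unfolding expansion_def by (intro tendsto_intros)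
    have "norm ((\<Sum>i\<in>{1..n}. a i *\<^sub>R e i) - (\<Sum>i\<in>{1..q}. a i *\<^sub>R e i)) \<le> norm x" if "q \<le> n" for n
      unfolding sum_split[OF that] using ex by (rule expansion_sum_le) simp
    then show "\<exists>N. \<forall>n\<ge>N. norm ((\<Sum>i\<in>{1..n}. a i *\<^sub>R e i) - (\<Sum>i\<in>{1..q}. a i *\<^sub>R e i)) \<le> norm x"
      by blast
  qed
qed

lemma unconditional_e: "unconditional 1 e"
  unfolding unconditional_def
proof (intro allI impI)
  fix a x and \<epsilon> :: "nat \<Rightarrow> real" assume ex: "expansion e a x" and eps: "\<forall>i. \<epsilon> i \<in> {-1, 1}"
  then have eps': "\<epsilon> k \<in> {-1, 0, 1}" for k by blast
  define S where "S n = (\<Sum>i\<in>{1..n}. a i *\<^sub>R e i)" for n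
  define T where "T n = (\<Sum>i\<in>{1..n}. (\<epsilon> i * a i) *\<^sub>R e i)" for n
  have S: "S \<longlonglongrightarrow> x" using ex unfolding expansion_def S_def .
  \<comment> \<open>Differences of the new partial sums are dominated by those of the old ones, so
    completeness supplies the limit.\<close>
  have le: "norm (T p - T q) \<le> norm (S p - S q)" if "q \<le> p" for p q
    unfolding T_def S_def sum_split[OF that] using eps' by (intro norm_mult_le) auto
  have "Cauchy T"
  proof (rule CauchyI)
    fix r :: real assume "0 < r"
    then obtain M where M: "\<forall>p\<ge>M. \<forall>q\<ge>M. norm (S p - S q) < r"
      using LIMSEQ_imp_Cauchy[OF S] unfolding Cauchy_iff by blast
    have "norm (T p - T q) < r" if "M \<le> p" "M \<le> q" for p q
    proof (cases "q \<le> p")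
      case True
      then show ?thesis using le[OF True] M that by (meson le_less_trans)
    next
      case False
      then have "norm (T q - T p) \<le> norm (S q - S p)" by (intro le) simp
      then show ?thesis using M that by (metis le_less_trans norm_minus_commute)
    qed
    then show "\<exists>M. \<forall>p\<ge>M. \<forall>q\<ge>M. norm (T p - T q) < r" by blast
  qed
  then obtain y where y: "T \<longlonglongrightarrow> y" using Cauchy_convergent unfolding convergent_def by blast
  have "norm (T n) \<le> norm (S n)" for n using le[of 0 n] by (simp add: T_def S_def)
  then have "norm y \<le> norm x" using tendsto_norm[OF y] tendsto_norm[OF S] by (intro LIMSEQ_le) auto
  then show "\<exists>y. expansion e (\<lambda>i. \<epsilon> i * a i) y \<and> norm y \<le> 1 * norm x"
    using y unfolding expansion_def T_def by (intro exI[of _ y]) simp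
qed

section \<open>Basis projections and existence of expansions\<close>

definition proj :: "nat \<Rightarrow> 'a \<Rightarrow> 'a" where
  "proj q x = (\<Sum>i\<in>{1..q}. coord i x *\<^sub>R e i)"

lemma proj_linear: "linear (proj q)"
  unfolding proj_def
  by (intro linearI)
    (simp_all add: linear_add[OF coord_linear] linear_scale[OF coord_linear] scaleR_left_distrib
      sum.distrib scaleR_sum_right)

lemma proj_span: "y \<in> span (e ` {1..}) \<Longrightarrow> \<exists>N. \<forall>q\<ge>N. proj q y = y"
proof (induction rule: span_induct_alt)
  case base
  then show ?case using linear_0[OF proj_linear] by simp
next
  case (step c b y)
  then obtain N where N: "\<forall>q\<ge>N. proj q y = y" by blast
  obtain i where i: "1 \<le> i" "b = e i" using step by auto
  have "proj q (e i) = e i" if "i \<le> q" for q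
  proof -
    have "proj q (e i) = (\<Sum>k\<in>{1..q}. if k = i then e k else 0)"
      unfolding proj_def using coord_e[OF _ i(1)] by (intro sum.cong) auto
    also have "\<dots> = e i" using that i(1) by simp
    finally show ?thesis .
  qed
  then have "proj q (c *\<^sub>R b + y) = c *\<^sub>R b + y" if "max N i \<le> q" for q
    using that N i(2) by (simp add: linear_add[OF proj_linear] linear_scale[OF proj_linear])
  then show ?case by blast
qed

text \<open>On the span, a large projection is the identity and \<open>proj q\<close> restricts its
  sum to an initial segment; continuity of the coordinates carries the bound to the closure.\<close>

lemma proj_le:
  assumes "x \<in> X"
  shows "norm (proj q x) \<le> norm x"
proof -
  obtain y where y: "\<And>k. y k \<in> span (e ` {1..})" "y \<longlonglongrightarrow> x"
    using assms unfolding closure_sequential by blast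
  have le: "norm (proj q (y k)) \<le> norm (y k)" for k
  proof -
    obtain N where N: "\<forall>q\<ge>N. proj q (y k) = y k" using proj_span[OF y(1)] by blast
    have "norm (proj q (y k)) \<le> norm (proj (max N q) (y k))"
      unfolding proj_def by (intro norm_restrict_le) auto
    then show ?thesis using N by simp
  qed
  have "(\<lambda>k. proj q (y k)) \<longlonglongrightarrow> proj q x"
    unfolding proj_def
    by (intro tendsto_sum tendsto_scaleR tendsto_const bounded_linear.tendsto[OF coord_bounded_linear] y) simp
  from LIMSEQ_le[OF tendsto_norm[OF this] tendsto_norm[OF y(2)]] show ?thesis using le by blast
qed

lemma X_diff:
  assumes "x \<in> X" "y \<in> X"
  shows "x - y \<in> X"
proof -
  obtain a where a: "\<And>k. a k \<in> span (e ` {1..})" "a \<longlonglongrightarrow> x"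
    using assms(1) unfolding closure_sequential by blast
  obtain b where b: "\<And>k. b k \<in> span (e ` {1..})" "b \<longlonglongrightarrow> y"
    using assms(2) unfolding closure_sequential by blast
  have "(\<lambda>k. a k - b k) \<longlonglongrightarrow> x - y" using a(2) b(2) by (rule tendsto_diff)
  moreover have "a k - b k \<in> span (e ` {1..})" for k using a(1) b(1) by (rule span_diff)
  ultimately show ?thesis unfolding closure_sequential by (intro exI[of _ "\<lambda>k. a k - b k"]) simp
qed

text \<open>Contractive projections that eventually fix each vector of a dense subspace converge
  pointwise.\<close>

lemma proj_tendsto:
  assumes x: "x \<in> X"
  shows "(\<lambda>q. proj q x) \<longlonglongrightarrow> x"
proof (rule LIMSEQ_I)
  fix r :: real assume r: "0 < r"
  then obtain y where y: "y \<in> span (e ` {1..})" "dist y x < r / 2"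
    using x unfolding closure_approachable by (meson half_gt_zero)
  then have d: "norm (x - y) < r / 2" by (simp add: dist_norm norm_minus_commute)
  obtain N where N: "\<forall>q\<ge>N. proj q y = y" using proj_span[OF y(1)] by blast
  have "norm (proj q x - x) < r" if "N \<le> q" for q
  proof -
    have "proj q x - x = proj q (x - y) - (x - y)"
      using N that by (simp add: linear_diff[OF proj_linear])
    also have "norm \<dots> \<le> norm (proj q (x - y)) + norm (x - y)" by (rule norm_triangle_ineq4)
    also have "\<dots> \<le> norm (x - y) + norm (x - y)"
      using proj_le[OF X_diff[OF x]] y(1) closure_subset by (intro add_right_mono) blast
    finally show ?thesis using d by simp
  qed
  then show "\<exists>N. \<forall>q\<ge>N. norm (proj q x - x) < r" by blast
qed

lemma schauder_basis_e: "schauder_basis X e"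
  unfolding schauder_basis_def
proof (intro conjI allI impI ballI)
  fix i :: nat assume "1 \<le> i"
  then have "e i \<in> span (e ` {1..})" by (intro span_base) simp
  then show "e i \<in> X" using closure_subset by blast
next
  fix x assume x: "x \<in> X"
  define a where "a i = (if i = 0 then 0 else coord i x)" for i
  have "(\<lambda>q. \<Sum>i\<in>{1..q}. a i *\<^sub>R e i) = (\<lambda>q. proj q x)"
    unfolding proj_def a_def by (intro ext sum.cong) auto
  then have a: "a 0 = 0 \<and> expansion e a x"
    using proj_tendsto[OF x] unfolding expansion_def by (simp add: a_def)
  moreover have "b = a" if "b 0 = 0 \<and> expansion e b x" for b
  proof
    fix i show "b i = a i"
    proof (cases "i = 0")
      case False
      then have "1 \<le> i" by simp
      then show ?thesis using expansion_coef that a by metis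
    qed (use that a in simp)
  qed
  ultimately show "\<exists>!a. a 0 = 0 \<and> expansion e a x" by blast
qed

end

context good_space
begin

section \<open>Spreading model estimates on blocks\<close>

lemma asymptotic: "1 \<le> j \<Longrightarrow> asymptotic_l1 (1 / real (m j)) (n j) e"
  unfolding asymptotic_l1_def
proof (intro allI impI)
  fix x assume j: "1 \<le> j" and x: "block_basis e x \<and> normalized x"
  obtain lo hi where bl: "blocks {1..} lo hi x"
    using block_basis_blocks x by blast
  have "1 / real (m j) * (\<Sum>i\<in>F. \<bar>a i\<bar>) \<le> norm (\<Sum>i\<in>F. a i *\<^sub>R x i)" if F: "F \<in> schreier (n j)" for F a
  proof -
    have F1: "F \<subseteq> {1..}" using schreier_pos[OF F] by auto
    have "(\<Sum>k\<in>F. \<bar>a k\<bar> * norm (x k)) / real (m j) \<le> norm (\<Sum>k\<in>F. a k *\<^sub>R x k)"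
      using F1 blocks_ge[OF bl] by (intro lower_l1[OF j F blocks_subset[OF bl F1]]) auto
    moreover have "(\<Sum>k\<in>F. \<bar>a k\<bar> * norm (x k)) = (\<Sum>k\<in>F. \<bar>a k\<bar>)"
      using x F1 unfolding normalized_def by (intro sum.cong) auto
    ultimately show ?thesis by simp
  qed
  then show "l1_spreading_model (1 / real (m j)) (n j) x"
    unfolding l1_spreading_model_def using m_pos[OF j] x by simp
qed

lemma block_basis_comb:
  assumes "\<And>k. finite (E k)" "\<And>k. E k \<noteq> {}" "\<And>k. E k \<subseteq> {1..}"
    "\<And>k l p q. k < l \<Longrightarrow> p \<in> E k \<Longrightarrow> q \<in> E l \<Longrightarrow> p < q"
    and "\<And>k. x k = (\<Sum>p\<in>E k. b p *\<^sub>R u p)" "\<And>k. x k \<noteq> 0"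
  shows "block_basis u x"
  unfolding block_basis_def
proof (intro exI allI impI)
  fix k :: nat
  have "Max (E k) \<in> E k" "Min (E (Suc k)) \<in> E (Suc k)" using assms(1,2) by simp_all
  then have "Max (E k) < Min (E (Suc k))" using assms(4)[of k "Suc k"] by simp
  moreover have "0 \<notin> E k" using assms(3)[of k] by auto
  ultimately show "finite (E k) \<and> E k \<noteq> {} \<and> 0 \<notin> E k \<and> Max (E k) < Min (E (Suc k)) \<and>
      x k = (\<Sum>p\<in>E k. b p *\<^sub>R u p) \<and> x k \<noteq> 0"
    using assms(1,2,5,6) by simp
qed

text \<open>A spreading model is only asked of some subsequence, so one sequence must have small
  averages along every \<open>s\<close>. This holds because an injective reindexing keeps at most
  one exception per weight.\<close>

lemma ris_spread:
  assumes j: "1 \<le> j" and bl: "blocks {1..} lo hi u" and u: "\<And>k. 1 \<le> k \<Longrightarrow> norm (u k) = 1"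
  obtains E :: "nat \<Rightarrow> nat set" and c where "\<And>k. finite (E k)" "\<And>k. E k \<noteq> {}" "\<And>k. E k \<subseteq> {1..}"
    "\<And>k l p q. k < l \<Longrightarrow> p \<in> E k \<Longrightarrow> q \<in> E l \<Longrightarrow> p < q" "\<And>k p. 0 \<le> c k p"
    "\<And>k. norm (\<Sum>p\<in>E k. c k p *\<^sub>R u p) = 1"
    "\<And>s :: nat \<Rightarrow> nat. strict_mono_on {1..} s \<Longrightarrow> \<exists>F a. F \<in> schreier (f j + 1) \<and> (\<forall>k. 0 \<le> a k) \<and>
      (\<Sum>k\<in>F. a k) = 1 \<and> norm (\<Sum>k\<in>F. a k *\<^sub>R (\<Sum>p\<in>E (s k). c (s k) p *\<^sub>R u p)) \<le> 4 / real (m j)"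
proof -
  obtain E :: "nat \<Rightarrow> nat set" and c where E: "\<And>k. finite (E k)" "\<And>k. E k \<noteq> {}" "\<And>k. E k \<subseteq> {1..}"
    "\<And>k l p q. k < l \<Longrightarrow> p \<in> E k \<Longrightarrow> q \<in> E l \<Longrightarrow> p < q" "\<And>k p. 0 \<le> c k p"
    "\<And>k. norm (\<Sum>p\<in>E k. c k p *\<^sub>R u p) = 1"
    and exc: "\<And>i. j \<le> i \<Longrightarrow> \<exists>k0. \<forall>k. k \<noteq> k0 \<longrightarrow>
      (\<forall>g. weighted m n i g \<longrightarrow> \<bar>\<phi> g (\<Sum>p\<in>E k. c k p *\<^sub>R u p)\<bar> \<le> 3 / real (m j))"
    by (rule rapidly_increasing[OF j bl u]) (assumption | rule that)+
  define x where "x k = (\<Sum>p\<in>E k. c k p *\<^sub>R u p)" for k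
  have "\<exists>F a. F \<in> schreier (f j + 1) \<and> (\<forall>k. 0 \<le> a k) \<and> (\<Sum>k\<in>F. a k) = 1 \<and>
      norm (\<Sum>k\<in>F. a k *\<^sub>R x (s k)) \<le> 4 / real (m j)" if s: "strict_mono_on {1..} s" for s :: "nat \<Rightarrow> nat"
  proof -
    have "blocks {1..} (\<lambda>k. lo (Min (E (s k)))) (\<lambda>k. hi (Max (E (s k)))) (\<lambda>k. x (s k))"
      unfolding x_def
    proof (rule blocks_comb[OF bl E(1,2,3)])
      show "p < q" if "k \<in> {1..}" "l \<in> {1..}" "k < l" "p \<in> E (s k)" "q \<in> E (s l)" for k l p q
        using E(4)[OF strict_mono_onD[OF s that(1,2,3)] that(4,5)] .
    qed
    moreover have "norm (x (s k)) \<le> 1" for k using E(6) unfolding x_def by simp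
    moreover have "\<exists>k0. \<forall>k\<ge>1. k \<noteq> k0 \<longrightarrow> (\<forall>g. weighted m n i g \<longrightarrow> \<bar>\<phi> g (x (s k))\<bar> \<le> 3 / real (m j))"
      if i: "j \<le> i" for i
    proof -
      obtain k0 where k0: "\<forall>k. k \<noteq> k0 \<longrightarrow> (\<forall>g. weighted m n i g \<longrightarrow> \<bar>\<phi> g (x k)\<bar> \<le> 3 / real (m j))"
        using exc[OF i] unfolding x_def by (elim exE)
      \<comment> \<open>The exceptional vector occurs at most once along \<open>s\<close>; if it
        does not occur, 0 is a harmless choice outside the index range.\<close>
      have inj: "inj_on s {1..}" using s by (rule strict_mono_on_imp_inj_on)
      show ?thesis
      proof (cases "\<exists>k1\<ge>1. s k1 = k0")
        case True
        then obtain k1 where k1: "1 \<le> k1" "s k1 = k0" by blast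
        have "s k \<noteq> k0" if "1 \<le> k" "k \<noteq> k1" for k
          using inj_onD[OF inj, of k k1] that k1 by auto
        then show ?thesis using k0 by (intro exI[of _ k1]) simp
      next
        case False
        then have "s k \<noteq> k0" if "1 \<le> k" for k using that by blast
        then show ?thesis using k0 by (intro exI[of _ 0]) simp
      qed
    qed
    ultimately obtain F a where "F \<in> schreier (f j + 1)" "F \<noteq> {}" "\<And>k. 0 \<le> a k" "(\<Sum>k\<in>F. a k) = 1"
      "norm (\<Sum>k\<in>F. a k *\<^sub>R x (s k)) \<le> 4 / real (m j)"
      by (rule blocks_upper[OF j]) (assumption | rule that)+
    then show ?thesis by (intro exI[of _ F] exI[of _ a]) simp
  qed
  note avg = this[unfolded x_def]
  show ?thesis
  proof (rule that[of E c])
    show "p < q" if "k < l" "p \<in> E k" "q \<in> E l" for k l p q using that by (rule E(4))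
  qed (fact E | erule avg)+
qed

text \<open>One normalized block sequence defeats all orders above \<open>f j\<close>: each of its
  subsequences has an average of order \<open>f j + 1\<close> and norm at most
  \<open>4 / m j\<close>, below the required \<open>6 / m j\<close>. So the supremum is at most
  \<open>f j\<close>.\<close>

lemma tau_less:
  assumes j: "1 \<le> j" and u: "block_basis e u"
  shows "tau u (6 / real (m j)) < enat (f j + 2)"
proof -
  have mj: "0 < real (m j)" using m_pos[OF j] .
  obtain lo hi where bl: "blocks {1..} lo hi u" and nz: "\<And>k. 1 \<le> k \<Longrightarrow> u k \<noteq> 0"
    using u by (rule block_basis_blocks) (assumption | rule that)+
  \<comment> \<open>The generating block basis may have any norms, whereas the averaging argument
    starts from normalized blocks; the factors return in \<open>b\<close>.\<close>
  define w where "w k = (1 / norm (u k)) *\<^sub>R u k" for k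
  have blw: "blocks {1..} lo hi w" unfolding w_def using bl by (rule blocks_scale)
  have nw: "norm (w k) = 1" if "1 \<le> k" for k unfolding w_def using nz[OF that] by simp
  obtain E :: "nat \<Rightarrow> nat set" and c where E: "\<And>k. finite (E k)" "\<And>k. E k \<noteq> {}" "\<And>k. E k \<subseteq> {1..}"
    "\<And>k l p q. k < l \<Longrightarrow> p \<in> E k \<Longrightarrow> q \<in> E l \<Longrightarrow> p < q" "\<And>k p. 0 \<le> c k p"
    "\<And>k. norm (\<Sum>p\<in>E k. c k p *\<^sub>R w p) = 1"
    and low: "\<And>s :: nat \<Rightarrow> nat. strict_mono_on {1..} s \<Longrightarrow> \<exists>F a. F \<in> schreier (f j + 1) \<and> (\<forall>k. 0 \<le> a k) \<and>
      (\<Sum>k\<in>F. a k) = 1 \<and> norm (\<Sum>k\<in>F. a k *\<^sub>R (\<Sum>p\<in>E (s k). c (s k) p *\<^sub>R w p)) \<le> 4 / real (m j)"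
    by (rule ris_spread[OF j blw nw]) (assumption | rule that)+
  define x where "x k = (\<Sum>p\<in>E k. c k p *\<^sub>R w p)" for k
  \<comment> \<open>\<open>block_basis\<close> wants one coefficient sequence for all blocks. The
    sets \<open>E k\<close> are disjoint, so \<open>p\<close> determines its block.\<close>
  define b where "b p = c (THE k. p \<in> E k) p / norm (u p)" for p
  have the: "(THE k. p \<in> E k) = k" if "p \<in> E k" for p k
  proof (rule the_equality)
    show "p \<in> E k" by (rule that)
    fix l assume l: "p \<in> E l"
    show "l = k"
    proof (rule ccontr)
      assume "l \<noteq> k"
      then consider "l < k" | "k < l" by linarith
      then show False using E(4)[OF _ l that] E(4)[OF _ that l] by cases blast+
    qed
  qed
  have x_b: "x k = (\<Sum>p\<in>E k. b p *\<^sub>R u p)" for k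
    unfolding x_def b_def w_def by (intro sum.cong) (simp_all add: the)
  have nx: "norm (x k) = 1" for k unfolding x_def using E(6) .
  have bbx: "block_basis u x"
  proof (rule block_basis_comb[OF E(1,2,3,4) x_b])
    show "x k \<noteq> 0" for k using nx[of k] by auto
  qed
  have "\<zeta> \<le> f j" if \<zeta>: "\<forall>x. block_basis u x \<and> normalized x \<longrightarrow>
      (\<exists>y. subseq_of x y \<and> l1_spreading_model (6 / real (m j)) \<zeta> y)" for \<zeta>
  proof (rule ccontr)
    assume "\<not> \<zeta> \<le> f j"
    then have z: "f j + 1 \<le> \<zeta>" by simp
    have "normalized x" unfolding normalized_def using nx by simp
    then obtain y where y: "subseq_of x y" "l1_spreading_model (6 / real (m j)) \<zeta> y"
      using \<zeta> bbx by blast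
    obtain s :: "nat \<Rightarrow> nat" where s: "strict_mono_on {1..} s" "\<forall>k\<ge>1. s k \<ge> 1 \<and> y k = x (s k)"
      using y(1) unfolding subseq_of_def by blast
    obtain F a where F: "F \<in> schreier (f j + 1)" "\<forall>k. 0 \<le> a k" "(\<Sum>k\<in>F. a k) = 1"
      "norm (\<Sum>k\<in>F. a k *\<^sub>R x (s k)) \<le> 4 / real (m j)"
      using low[OF s(1)] unfolding x_def by (elim exE conjE)
    have "F \<in> schreier \<zeta>" using F(1) z by (rule schreier_mono)
    then have "6 / real (m j) * (\<Sum>k\<in>F. \<bar>a k\<bar>) \<le> norm (\<Sum>k\<in>F. a k *\<^sub>R y k)"
      using y(2) unfolding l1_spreading_model_def by blast
    also have "(\<Sum>k\<in>F. a k *\<^sub>R y k) = (\<Sum>k\<in>F. a k *\<^sub>R x (s k))"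
      using s(2) schreier_pos[OF F(1)] by (intro sum.cong) simp_all
    also have "(\<Sum>k\<in>F. \<bar>a k\<bar>) = 1" using F(2,3) by simp
    finally have "6 / real (m j) \<le> 4 / real (m j)" using F(4) by simp
    then show False using mj by (simp add: divide_le_cancel)
  qed
  then have "tau u (6 / real (m j)) \<le> enat (f j)"
    unfolding tau_def by (intro Sup_least) auto
  then show ?thesis by (rule le_less_trans) simp
qed

section \<open>Shrinking\<close>

lemma functional_sum:
  assumes f: "bounded_functional_on X \<psi>" and x: "\<And>k. k \<in> A \<Longrightarrow> x k \<in> span (e ` {1..})"
  shows "\<psi> (\<Sum>k\<in>A. a k *\<^sub>R x k) = (\<Sum>k\<in>A. a k * \<psi> (x k))"
proof -
  have X: "y \<in> X" if "y \<in> span (e ` {1..})" for y using that closure_subset by blast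
  have add: "\<psi> (y + z) = \<psi> y + \<psi> z" if "y \<in> span (e ` {1..})" "z \<in> span (e ` {1..})" for y z
    using f X[OF that(1)] X[OF that(2)] unfolding bounded_functional_on_def by simp
  have sc: "\<psi> (r *\<^sub>R y) = r * \<psi> y" if "y \<in> span (e ` {1..})" for r y
    using f X[OF that] unfolding bounded_functional_on_def by simp
  have zero: "\<psi> 0 = 0" using sc[OF span_zero, of 0] by simp
  show ?thesis using x
  proof (induction A rule: infinite_finite_induct)
    case (insert k A)
    have "(\<Sum>k\<in>A. a k *\<^sub>R x k) \<in> span (e ` {1..})" using insert by (intro span_sum span_scale) simp
    moreover have "a k *\<^sub>R x k \<in> span (e ` {1..})" using insert by (intro span_scale) simp
    ultimately show ?case using insert add sc by simp
  qed (simp_all add: zero)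
qed

text \<open>Averages of a rapidly increasing sequence with nonnegative coefficients tend to 0 in norm,
  although a functional that is bounded below on \<open>w\<close> is bounded below on them.\<close>

lemma no_l1_blocks:
  assumes f: "bounded_functional_on X \<psi>" and bl: "blocks {1..} lo hi w"
    and w: "\<And>k. 1 \<le> k \<Longrightarrow> norm (w k) = 1" and \<delta>: "0 < \<delta>"
  shows "\<exists>k\<ge>1. \<psi> (w k) < \<delta>"
proof (rule ccontr)
  assume "\<not> ?thesis"
  then have low: "\<delta> \<le> \<psi> (w k)" if "1 \<le> k" for k using that by (meson not_le)
  obtain K where K: "\<forall>x\<in>X. \<bar>\<psi> x\<bar> \<le> K * norm x" using f unfolding bounded_functional_on_def by blast
  define K' where "K' = max K 0"
  have K': "\<bar>\<psi> x\<bar> \<le> K' * norm x" if "x \<in> span (e ` {1..})" for x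
  proof -
    have "x \<in> X" using that closure_subset by blast
    then have "\<bar>\<psi> x\<bar> \<le> K * norm x" using K by blast
    also have "\<dots> \<le> K' * norm x" unfolding K'_def by (intro mult_right_mono) simp_all
    finally show ?thesis .
  qed
  \<comment> \<open>Makes \<open>m j \<ge> j\<close> exceed \<open>4 * K' / \<delta>\<close>, so
    that an average of norm \<open>4 / m j\<close> is too short for the functional to reach
    \<open>\<delta>\<close>.\<close>
  define j where "j = nat \<lceil>4 * K' / \<delta>\<rceil> + 1"
  have j: "1 \<le> j" unfolding j_def by simp
  have "4 * K' / \<delta> < real j" unfolding j_def by linarith
  also have "real j \<le> real (m j)" using m_unbounded[OF j] by simp
  finally have big: "4 * K' < \<delta> * real (m j)" using \<delta> by (simp add: divide_less_eq mult.commute)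
  obtain E :: "nat \<Rightarrow> nat set" and c where E: "\<And>k. finite (E k)" "\<And>k. E k \<noteq> {}" "\<And>k. E k \<subseteq> {1..}"
    "\<And>k l p q. k < l \<Longrightarrow> p \<in> E k \<Longrightarrow> q \<in> E l \<Longrightarrow> p < q" "\<And>k p. 0 \<le> c k p"
    "\<And>k. norm (\<Sum>p\<in>E k. c k p *\<^sub>R w p) = 1"
    and avg: "\<And>s :: nat \<Rightarrow> nat. strict_mono_on {1..} s \<Longrightarrow> \<exists>F a. F \<in> schreier (f j + 1) \<and> (\<forall>k. 0 \<le> a k) \<and>
      (\<Sum>k\<in>F. a k) = 1 \<and> norm (\<Sum>k\<in>F. a k *\<^sub>R (\<Sum>p\<in>E (s k). c (s k) p *\<^sub>R w p)) \<le> 4 / real (m j)"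
    by (rule ris_spread[OF j bl w]) (assumption | rule that)+
  define x where "x k = (\<Sum>p\<in>E k. c k p *\<^sub>R w p)" for k
  have wX: "w k \<in> span (e ` {1..})" if "1 \<le> k" for k
    using span_mono1[OF blocksD(3,1)[OF bl, of k]] that by simp
  have wE: "w p \<in> span (e ` {1..})" "1 \<le> p" if "p \<in> E k" for p k
    using wX[of p] E(3)[of k] that by auto
  have xX: "x k \<in> span (e ` {1..})" for k unfolding x_def using wE by (intro span_sum span_scale)
  \<comment> \<open>A norm-one combination of unit vectors with nonnegative coefficients has
    coefficient sum at least 1, so the lower bound on \<open>\<psi>\<close> is inherited.\<close>
  have \<psi>x: "\<delta> \<le> \<psi> (x k)" for k
  proof -
    have "1 \<le> (\<Sum>p\<in>E k. c k p)"
      using norm_sum_le[of "E k" "c k" w] E(5,6) w wE(2) by (metis order_refl)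
    then have "\<delta> * 1 \<le> \<delta> * (\<Sum>p\<in>E k. c k p)" using \<delta> by (intro mult_left_mono) simp_all
    also have "\<dots> = (\<Sum>p\<in>E k. c k p * \<delta>)" by (simp add: sum_distrib_left mult.commute)
    also have "\<dots> \<le> (\<Sum>p\<in>E k. c k p * \<psi> (w p))"
    proof (rule sum_mono)
      fix p assume "p \<in> E k"
      then show "c k p * \<delta> \<le> c k p * \<psi> (w p)" using low wE(2) E(5) by (intro mult_left_mono) blast+
    qed
    also have "\<dots> = \<psi> (x k)" unfolding x_def using wE(1) by (rule functional_sum[OF f, symmetric])
    finally show ?thesis by simp
  qed
  have "strict_mono_on {1..} (\<lambda>k::nat. k)" by (simp add: strict_mono_on_def)
  from avg[OF this] obtain F a where F: "\<forall>k. 0 \<le> a k" "(\<Sum>k\<in>F. a k) = 1"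
    "norm (\<Sum>k\<in>F. a k *\<^sub>R x k) \<le> 4 / real (m j)"
    unfolding x_def by (elim exE conjE)
  have "\<delta> = (\<Sum>k\<in>F. a k * \<delta>)" using F(2) by (simp add: sum_distrib_right[symmetric])
  also have "\<dots> \<le> (\<Sum>k\<in>F. a k * \<psi> (x k))" using F(1) \<psi>x by (intro sum_mono mult_left_mono) simp_all
  also have "\<dots> = \<psi> (\<Sum>k\<in>F. a k *\<^sub>R x k)" using xX by (rule functional_sum[OF f, symmetric])
  also have "\<dots> \<le> K' * norm (\<Sum>k\<in>F. a k *\<^sub>R x k)"
    using K'[of "\<Sum>k\<in>F. a k *\<^sub>R x k"] xX by (simp add: span_sum span_scale abs_le_iff)
  also have "\<dots> \<le> K' * (4 / real (m j))" using F(3) by (intro mult_left_mono) (simp_all add: K'_def)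
  finally show False using big m_pos[OF j] by (simp add: field_simps)
qed

lemma span_finite_interval:
  assumes "x \<in> span (e ` {N<..})"
  shows "\<exists>N'>N. x \<in> span (e ` {N+1..N'})"
  using assms
proof (induction rule: span_induct_alt)
  case base
  show ?case by (intro exI[of _ "N + 1"]) (simp add: span_zero)
next
  case (step c b y)
  then obtain N' where N': "N < N'" "y \<in> span (e ` {N+1..N'})" by blast
  obtain i where i: "N < i" "b = e i" using step by auto
  have "y \<in> span (e ` {N+1..max N' i})"
    using N'(2) by (rule subsetD[OF span_mono, rotated]) auto
  moreover have "b \<in> span (e ` {N+1..max N' i})" unfolding i(2) using i(1) by (intro span_base) auto
  ultimately have "c *\<^sub>R b + y \<in> span (e ` {N+1..max N' i})" by (intro span_add span_scale)
  then show ?case using N'(1) by (intro exI[of _ "max N' i"]) simp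
qed

text \<open>Approximation by a finite combination keeps half of
  \<open>\<bar>\<psi> x\<bar> > r\<close>, normalizing a vector of norm at most 2 keeps half of
  that, and a sign makes the value positive.\<close>

lemma large_tail_vector:
  assumes f: "bounded_functional_on X \<psi>" and r: "0 < r"
    and x: "x \<in> closure (span (e ` {N<..}))" "norm x \<le> 1" "r < \<bar>\<psi> x\<bar>"
  shows "\<exists>y \<in> span (e ` {N<..}). norm y = 1 \<and> r / 4 \<le> \<psi> y"
proof -
  have sub: "span (e ` {N<..}) \<subseteq> span (e ` {1..})" by (intro span_mono image_mono) auto
  have subX: "closure (span (e ` {N<..})) \<subseteq> X" using sub by (rule closure_mono)
  obtain K where K: "\<forall>x\<in>X. \<bar>\<psi> x\<bar> \<le> K * norm x" using f unfolding bounded_functional_on_def by blast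
  have add: "\<psi> (y + z) = \<psi> y + \<psi> z" if "y \<in> X" "z \<in> X" for y z
    using f that unfolding bounded_functional_on_def by simp
  have sc: "\<psi> (t *\<^sub>R y) = t * \<psi> y" if "y \<in> X" for t y
    using f that unfolding bounded_functional_on_def by simp
  \<comment> \<open>The first bound keeps the approximant of norm at most 2, the second changes
    \<open>\<psi>\<close> by at most \<open>r / 2\<close>; \<open>\<bar>K\<bar> + 1\<close> is
    positive whatever \<open>K\<close> is.\<close>
  define \<eta> where "\<eta> = min 1 (r / (2 * (\<bar>K\<bar> + 1)))"
  have \<eta>: "0 < \<eta>" "\<eta> \<le> 1" "\<eta> \<le> r / (2 * (\<bar>K\<bar> + 1))" unfolding \<eta>_def using r by simp_all
  obtain y where y: "y \<in> span (e ` {N<..})" "dist y x < \<eta>"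
    using x(1) \<eta>(1) unfolding closure_approachable by blast
  have d: "norm (x - y) < \<eta>" using y(2) by (simp add: dist_norm norm_minus_commute)
  have xX: "x \<in> X" using x(1) subX by blast
  have yX: "y \<in> X" using y(1) sub closure_subset by blast
  have "\<bar>\<psi> (x - y)\<bar> \<le> K * norm (x - y)" using K X_diff[OF xX yX] by blast
  also have "\<dots> \<le> \<bar>K\<bar> * \<eta>" using d \<eta>(1) by (intro mult_mono) simp_all
  also have "\<dots> \<le> \<bar>K\<bar> * (r / (2 * (\<bar>K\<bar> + 1)))" using \<eta>(3) by (intro mult_left_mono) simp_all
  also have "\<dots> \<le> r / 2" using r by (simp add: field_simps)
  finally have "\<bar>\<psi> (x - y)\<bar> \<le> r / 2" .
  moreover have "\<psi> x = \<psi> (x - y) + \<psi> y" using add[OF X_diff[OF xX yX] yX] by simp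
  ultimately have \<psi>y: "r / 2 \<le> \<bar>\<psi> y\<bar>" using x(3) by linarith
  have ny: "norm y \<le> 2"
  proof -
    have "norm y \<le> norm x + norm (x - y)" by (metis norm_minus_commute norm_triangle_sub)
    then show ?thesis using d \<eta>(2) x(2) by linarith
  qed
  have ny0: "0 < norm y"
  proof (rule ccontr)
    assume "\<not> 0 < norm y"
    then have "y = 0" by simp
    then show False using \<psi>y sc[OF yX, of 0] r by simp
  qed
  define z where "z = (sgn (\<psi> y) / norm y) *\<^sub>R y"
  have "\<psi> y \<noteq> 0" using \<psi>y r by auto
  then have "norm z = 1" unfolding z_def using ny0 by (simp add: abs_sgn_eq)
  moreover have "z \<in> span (e ` {N<..})" unfolding z_def using y(1) by (rule span_scale)
  moreover have "r / 4 \<le> \<psi> z"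
  proof -
    have "r / 4 * norm y \<le> r / 4 * 2" using ny r by (intro mult_left_mono) simp_all
    also have "\<dots> \<le> \<bar>\<psi> y\<bar>" using \<psi>y by simp
    finally have "r / 4 \<le> \<bar>\<psi> y\<bar> / norm y" using ny0 by (simp add: le_divide_eq)
    moreover have "\<psi> z = \<bar>\<psi> y\<bar> / norm y" unfolding z_def sc[OF yX] by (simp add: abs_sgn)
    ultimately show ?thesis by simp
  qed
  ultimately show ?thesis by blast
qed

text \<open>The tail norms decrease, so a failure leaves them above some \<open>r\<close>. Picking
  vectors from ever later tails then gives normalized blocks on which the functional is bounded
  below, against \<open>no_l1_blocks\<close>.\<close>

lemma shrinking_e: "shrinking X e"
  unfolding shrinking_def
proof (intro allI impI)
  fix \<psi> assume f: "bounded_functional_on X \<psi>"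
  define B where "B N = {x \<in> closure (span (e ` {N<..})). norm x \<le> 1}" for N
  define S where "S N = (SUP x\<in>B N. \<bar>\<psi> x\<bar>)" for N
  obtain K where K: "\<forall>x\<in>X. \<bar>\<psi> x\<bar> \<le> K * norm x" using f unfolding bounded_functional_on_def by blast
  have BX: "B N \<subseteq> X" for N
  proof -
    have "span (e ` {N<..}) \<subseteq> span (e ` {1..})" by (intro span_mono image_mono) auto
    then show ?thesis unfolding B_def using closure_mono by blast
  qed
  have B0: "0 \<in> B N" for N
    unfolding B_def using subsetD[OF closure_subset span_zero] by simp
  have bdd: "bdd_above ((\<lambda>x. \<bar>\<psi> x\<bar>) ` B N)" for N
  proof (rule bdd_aboveI2)
    fix x assume x: "x \<in> B N"
    then have "\<bar>\<psi> x\<bar> \<le> K * norm x" using K BX by blast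
    also have "\<dots> \<le> \<bar>K\<bar> * 1" using x unfolding B_def by (intro mult_mono) simp_all
    finally show "\<bar>\<psi> x\<bar> \<le> \<bar>K\<bar>" by simp
  qed
  have S0: "0 \<le> S N" for N
    unfolding S_def using cSUP_upper[OF B0 bdd] abs_ge_zero order.trans by blast
  have mono: "S N' \<le> S N" if "N \<le> N'" for N N'
  proof -
    have "span (e ` {N'<..}) \<subseteq> span (e ` {N<..})" using that by (intro span_mono image_mono) auto
    then have "B N' \<subseteq> B N" unfolding B_def using closure_mono by blast
    then show ?thesis unfolding S_def using B0 bdd by (intro cSUP_subset_mono) auto
  qed
  have "S \<longlonglongrightarrow> 0"
  proof (rule ccontr)
    assume "\<not> S \<longlonglongrightarrow> 0"
    then obtain r where r: "0 < r" "\<And>N. \<exists>N'\<ge>N. r \<le> norm (S N' - 0)"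
      unfolding LIMSEQ_iff by (meson not_le)
    have Sr: "r \<le> S N" for N
    proof -
      obtain N' where "N \<le> N'" "r \<le> S N'" using r(2)[of N] S0 by auto
      then show ?thesis using mono[of N N'] by simp
    qed
    have tail: "\<exists>y N'. N < N' \<and> y \<in> span (e ` {N+1..N'}) \<and> norm y = 1 \<and> r / 8 \<le> \<psi> y" for N
    proof -
      \<comment> \<open>The supremum may not be attained, which costs a factor 2; the passage to a
        finitely supported unit vector costs 4, whence \<open>r / 8\<close>.\<close>
      have "r / 2 < S N" using Sr[of N] r(1) by simp
      then obtain x where x: "x \<in> B N" "r / 2 < \<bar>\<psi> x\<bar>"
        unfolding S_def using less_cSUP_iff[OF _ bdd] B0 by (metis empty_iff)
      have "0 < r / 2" using r(1) by simp
      from large_tail_vector[OF f this _ _ x(2)] x(1)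
      obtain y where y: "y \<in> span (e ` {N<..})" "norm y = 1" "r / 2 / 4 \<le> \<psi> y"
        unfolding B_def by blast
      then show ?thesis using span_finite_interval[OF y(1)] by auto
    qed
    \<comment> \<open>The triples are start, end and vector; \<open>Q\<close> lets each interval
      begin where the previous one ended.\<close>
    define P where "P i Z \<longleftrightarrow> fst Z < fst (snd Z) \<and> snd (snd Z) \<in> span (e ` {fst Z + 1..fst (snd Z)}) \<and>
        norm (snd (snd Z)) = 1 \<and> r / 8 \<le> \<psi> (snd (snd Z))" for i :: nat and Z :: "nat \<times> nat \<times> 'a"
    define Q where "Q i Z Z' \<longleftrightarrow> fst Z' = fst (snd Z)" for i :: nat and Z Z' :: "nat \<times> nat \<times> 'a"
    have "\<exists>Z. \<forall>i. P i (Z i) \<and> Q i (Z i) (Z (Suc i))"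
    proof (rule dependent_nat_choice)
      obtain y N' where "0 < N'" "y \<in> span (e ` {0+1..N'})" "norm y = 1" "r / 8 \<le> \<psi> y"
        using tail[of 0] by (elim exE conjE)
      then show "\<exists>Z. P 0 Z" unfolding P_def by (intro exI[of _ "(0, N', y)"]) simp
    next
      fix Z :: "nat \<times> nat \<times> 'a" and i
      obtain y N' where "fst (snd Z) < N'" "y \<in> span (e ` {fst (snd Z)+1..N'})" "norm y = 1" "r / 8 \<le> \<psi> y"
        using tail[of "fst (snd Z)"] by (elim exE conjE)
      then show "\<exists>Z'. P (Suc i) Z' \<and> Q i Z Z'" unfolding P_def Q_def
        by (intro exI[of _ "(fst (snd Z), N', y)"]) simp
    qed
    then obtain Z where Z: "\<And>i. P i (Z i)" "\<And>i. Q i (Z i) (Z (Suc i))" by blast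
    have bl: "blocks {1..} (\<lambda>i. fst (Z i) + 1) (\<lambda>i. fst (snd (Z i))) (\<lambda>i. snd (snd (Z i)))"
    proof (rule blocks_SucI)
      fix k
      show "1 \<le> fst (Z k) + 1 \<and> fst (Z k) + 1 \<le> fst (snd (Z k)) \<and>
          snd (snd (Z k)) \<in> span (e ` {fst (Z k) + 1..fst (snd (Z k))}) \<and>
          fst (snd (Z k)) < fst (Z (Suc k)) + 1"
        using Z(1)[of k] Z(2)[of k] unfolding P_def Q_def by simp
    qed
    have nw: "norm (snd (snd (Z k))) = 1" and low: "r / 8 \<le> \<psi> (snd (snd (Z k)))" for k
      using Z(1)[of k] unfolding P_def by simp_all
    have "0 < r / 8" using r(1) by simp
    from no_l1_blocks[OF f bl nw this] low show False by (meson not_le)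
  qed
  then show "(\<lambda>N. SUP x\<in>{x \<in> closure (span (e ` {N<..})). norm x \<le> 1}. \<bar>\<psi> x\<bar>) \<longlonglongrightarrow> 0"
    unfolding S_def B_def .
qed

end

section \<open>The set of measures\<close>

lemma elt_less: "inf_pos_set A \<Longrightarrow> 1 \<le> i \<Longrightarrow> i < j \<Longrightarrow> elt A i < elt A j"
  unfolding elt_def inf_pos_set_def by (intro enumerate_mono) auto

text \<open>The set \<open>P\<close> of the distortion property is given as an image; this recovers
  its elements in order.\<close>

lemma enumerate_range:
  fixes g :: "nat \<Rightarrow> nat"
  assumes g: "strict_mono g"
  shows "enumerate (range g) i = g i"
proof (induction i)
  case 0
  have "(LEAST y. y \<in> range g) = g 0"
    using strict_mono_less_eq[OF g] by (intro Least_equality) auto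
  then show ?case by (simp add: enumerate_0)
next
  case (Suc i)
  have inf: "infinite (range g)"
    using range_inj_infinite[OF strict_mono_imp_inj_on[OF g]] .
  have "(LEAST y. y \<in> range g \<and> g i < y) = g (Suc i)"
  proof (rule Least_equality)
    show "g (Suc i) \<in> range g \<and> g i < g (Suc i)" using g by (simp add: strict_mono_less)
    fix y assume y: "y \<in> range g \<and> g i < y"
    then obtain k where k: "y = g k" by blast
    then have "i < k" using y strict_mono_less[OF g] by simp
    then show "g (Suc i) \<le> y" using k strict_mono_less_eq[OF g] by simp
  qed
  then show ?case unfolding enumerate_Suc''[OF inf] Suc.IH .
qed

definition norming_set :: "(nat \<Rightarrow> nat) \<Rightarrow> (nat \<Rightarrow> nat) \<Rightarrow> (nat \<Rightarrow>\<^sub>0 real) set" where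
  "norming_set m n = {\<mu>. meas m n (lk \<mu>)}"

lemma admissible_norming_set:
  assumes m: "\<And>i. 1 \<le> i \<Longrightarrow> 1 \<le> m i"
  shows "admissible (norming_set m n)"
  unfolding admissible_def
proof (intro conjI ballI allI impI)
  fix \<mu> assume "\<mu> \<in> norming_set m n"
  then have mu: "meas m n (lk \<mu>)" unfolding norming_set_def by simp
  show "0 \<notin> Poly_Mapping.keys \<mu>" using meas_finite[OF mu] by (simp add: in_keys_iff)
  have "meas m n (\<lambda>k. (- 1) * lk \<mu> k)" using mu by (rule meas_mult) simp
  moreover have "lk (- \<mu>) = (\<lambda>k. (- 1) * lk \<mu> k)" by (rule ext) simp
  ultimately show "- \<mu> \<in> norming_set m n" unfolding norming_set_def by simp
  show "lk \<mu> k \<le> 1" for k using meas_bound[OF mu m, of k] by (simp add: abs_le_iff)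
  show "restr \<mu> {1..N} \<in> norming_set m n" for N
  proof -
    have "meas m n (\<lambda>k. (if k \<in> {1..N} then 1 else 0) * lk \<mu> k)" using mu by (rule meas_mult) simp
    moreover have "lk (restr \<mu> {1..N}) = (\<lambda>k. (if k \<in> {1..N} then 1 else 0) * lk \<mu> k)"
      by (rule ext) (simp add: restr_lookup)
    ultimately show ?thesis unfolding norming_set_def by simp
  qed
next
  fix i :: nat assume "1 \<le> i"
  then have "meas m n (\<lambda>k. if k = i then 1 else 0)" by (intro meas.point) simp_all
  moreover have "lk (unit_vec i) = (\<lambda>k. if k = i then 1 else 0)"
    by (rule ext) (auto simp: unit_vec_def lookup_single when_def)
  ultimately show "unit_vec i \<in> norming_set m n" unfolding norming_set_def by simp
qed

section \<open>The completion as a closed span\<close>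

lemma pairing_unit_vec: "pairing \<mu> (unit_vec i) = lk \<mu> i"
  by (simp add: pairing_def unit_vec_def)

text \<open>Lets the closure that defines \<open>X_space\<close> be read as the closed span
  \<open>X\<close> of the basis.\<close>

lemma embed_c00_eq_span:
  assumes A: "admissible \<M>"
  shows "embed \<M> ` c00 = span (X_basis \<M> ` {1..})"
proof
  show "embed \<M> ` c00 \<subseteq> span (X_basis \<M> ` {1..})"
  proof
    fix x assume "x \<in> embed \<M> ` c00"
    then obtain y where y: "y \<in> c00" "x = embed \<M> y" by blast
    have "embed \<M> y = (\<Sum>k\<in>Poly_Mapping.keys y. lk y k *\<^sub>R X_basis \<M> k)"
    proof (rule bcontfun_eqI)
      fix \<mu>
      have lin: "linear (\<lambda>x::ambient. apply_bcontfun x \<mu>)"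
        by (intro linearI) (simp_all add: plus_bcontfun.rep_eq scaleR_bcontfun.rep_eq)
      have "apply_bcontfun (\<Sum>k\<in>Poly_Mapping.keys y. lk y k *\<^sub>R X_basis \<M> k) \<mu>
          = (\<Sum>k\<in>Poly_Mapping.keys y. lk y k * apply_bcontfun (X_basis \<M> k) \<mu>)"
        using linear_sum[OF lin, of "\<lambda>k. lk y k *\<^sub>R X_basis \<M> k"] by (simp add: scaleR_bcontfun.rep_eq)
      also have "\<dots> = apply_bcontfun (embed \<M> y) \<mu>"
        unfolding X_basis_def embed_apply[OF A] pairing_unit_vec by (simp add: pairing_def)
      finally show "apply_bcontfun (embed \<M> y) \<mu>
        = apply_bcontfun (\<Sum>k\<in>Poly_Mapping.keys y. lk y k *\<^sub>R X_basis \<M> k) \<mu>" by simp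
    qed
    moreover have "X_basis \<M> k \<in> span (X_basis \<M> ` {1..})" if "k \<in> Poly_Mapping.keys y" for k
    proof -
      have "k \<noteq> 0" using y(1) that unfolding c00_def by (metis mem_Collect_eq)
      then show ?thesis by (intro span_base) simp
    qed
    ultimately show "x \<in> span (X_basis \<M> ` {1..})"
      unfolding y(2) by (simp add: span_sum span_scale)
  qed
next
  show "span (X_basis \<M> ` {1..}) \<subseteq> embed \<M> ` c00"
  proof
    fix x assume "x \<in> span (X_basis \<M> ` {1..})"
    then show "x \<in> embed \<M> ` c00"
    proof (induction rule: span_induct_alt)
      case base
      have "embed \<M> 0 = 0"
        by (rule bcontfun_eqI) (simp add: embed_apply[OF A] pairing_def zero_bcontfun.rep_eq)
      moreover have "0 \<in> c00" by (simp add: c00_def)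
      ultimately show ?case by (metis imageI)
    next
      case (step c b y)
      obtain y' where y': "y' \<in> c00" "y = embed \<M> y'" using step by blast
      obtain i where i: "1 \<le> i" "b = X_basis \<M> i" using step by auto
      let ?z = "Poly_Mapping.map ((*) c) (unit_vec i) + y'"
      have "c *\<^sub>R b + y = embed \<M> ?z"
        unfolding embed_add[OF A] embed_scale[OF A] i(2) y'(2) X_basis_def ..
      moreover have "lk ?z 0 = 0"
        using i(1) y'(1) by (simp add: lookup_add Poly_Mapping.map.rep_eq unit_vec_def lookup_single c00_def in_keys_iff)
      then have "?z \<in> c00" by (simp add: c00_def in_keys_iff)
      ultimately show ?case by blast
    qed
  qed
qed

text \<open>A vector of the ambient space is a function on measures, so the functional of a measure
  is evaluation at it. \<open>Abs_poly_mapping g\<close> is meaningful for finitely supported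
  \<open>g\<close>, which \<open>meas_finite\<close> provides.\<close>

definition evaluation :: "(nat \<Rightarrow> real) \<Rightarrow> ambient \<Rightarrow> real" where
  "evaluation g x = apply_bcontfun x (discrete (Abs_poly_mapping g))"

lemma tree_space_norming_set:
  assumes ge: "\<And>i. 1 \<le> i \<Longrightarrow> 2 \<le> m i" and less: "\<And>i j. 1 \<le> i \<Longrightarrow> i < j \<Longrightarrow> m i < m j"
  shows "tree_space m n (X_basis (norming_set m n)) evaluation"
proof (rule tree_space.intro)
  let ?M = "norming_set m n"
  have "1 \<le> m i" if "1 \<le> i" for i using ge[OF that] by simp
  then have A: "admissible ?M" by (rule admissible_norming_set)
  show "2 \<le> m i" if "1 \<le> i" for i using ge that .
  show "m i < m j" if "1 \<le> i" "i < j" for i j using less that .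
  show "linear (evaluation g)" if "meas m n g" for g unfolding evaluation_def
    by (intro linearI) (simp_all add: plus_bcontfun.rep_eq scaleR_bcontfun.rep_eq)
  show "\<bar>evaluation g x\<bar> \<le> norm x" if "meas m n g" for g x unfolding evaluation_def
    using norm_bounded[of x "discrete (Abs_poly_mapping g)"] by simp
  show "evaluation g (X_basis ?M i) = g i" if g: "meas m n g" "1 \<le> i" for g i
  proof -
    have lk: "lk (Abs_poly_mapping g) = g" using meas_finite[OF g(1)] by simp
    then have "Abs_poly_mapping g \<in> ?M" using g(1) by (simp add: norming_set_def)
    then show ?thesis using lk
      by (simp add: evaluation_def X_basis_def embed_apply[OF A] discrete_inverse pairing_unit_vec)
  qed
  show "\<exists>g. meas m n g \<and> c < evaluation g x" if x: "x \<in> span (X_basis ?M ` {1..})" "c < norm x" for x c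
  proof (rule ccontr)
    assume no: "\<not> ?thesis"
    obtain y where y: "x = embed ?M y" using x(1) unfolding embed_c00_eq_span[OF A, symmetric] by blast
    have "pairing \<mu> y \<le> c" if mu: "\<mu> \<in> ?M" for \<mu>
    proof -
      have "evaluation (lk \<mu>) x = pairing \<mu> y"
        using mu by (simp add: evaluation_def y embed_apply[OF A] discrete_inverse lookup_inverse)
      moreover have "meas m n (lk \<mu>)" using mu by (simp add: norming_set_def)
      ultimately show ?thesis using no by (metis not_le)
    qed
    moreover have "?M \<noteq> {}" using A unfolding admissible_def by blast
    ultimately have "norm_of ?M y \<le> c" unfolding norm_of_def by (intro cSUP_least) simp_all
    then show False using x(2) unfolding y norm_embed[OF A] by simp
  qed
qed

text \<open>\<open>Max\<close> bounds its members only on a finite set. Since all weights are at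
  least 2, each exponent is below the product, hence below \<open>elt M j ^ 3\<close>.\<close>

lemma good_f_ge:
  assumes j: "2 \<le> j" and ge: "\<And>i. 1 \<le> i \<Longrightarrow> 2 \<le> elt M i"
    and \<rho>: "(\<Prod>i\<in>{1..<j}. elt M i ^ \<rho> i) < elt M j ^ 3"
  shows "(\<Sum>i\<in>{1..<j}. \<rho> i * elt N i) \<le> good_f M N j"
proof -
  let ?S = "{(\<Sum>i\<in>{1..<j}. \<rho> i * elt N i) | \<rho> :: nat \<Rightarrow> nat.
                  (\<Prod>i\<in>{1..<j}. elt M i ^ \<rho> i) < elt M j ^ 3}"
  have "(\<Sum>i\<in>{1..<j}. \<rho> i * elt N i) \<le> (\<Sum>i\<in>{1..<j}. elt M j ^ 3 * elt N i)"
    if r: "(\<Prod>i\<in>{1..<j}. elt M i ^ \<rho> i) < elt M j ^ 3" for \<rho>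
  proof (rule sum_mono)
    fix i assume i: "i \<in> {1..<j}"
    have "0 < elt M k" if "k \<in> {1..<j}" for k using ge[of k] that by simp
    then have pos: "0 < (\<Prod>i\<in>{1..<j}. elt M i ^ \<rho> i)" by (intro prod_pos) simp
    have "\<rho> i < 2 ^ \<rho> i" by (rule less_exp)
    also have "\<dots> \<le> elt M i ^ \<rho> i" using ge[of i] i by (intro power_mono) simp_all
    also have "\<dots> \<le> (\<Prod>i\<in>{1..<j}. elt M i ^ \<rho> i)"
      using i pos by (intro dvd_imp_le dvd_prodI) simp_all
    finally show "\<rho> i * elt N i \<le> elt M j ^ 3 * elt N i" using r by (intro mult_right_mono) simp_all
  qed
  then have "?S \<subseteq> {..(\<Sum>i\<in>{1..<j}. elt M j ^ 3 * elt N i)}" by blast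
  then have "finite ?S" using finite_subset by blast
  moreover have "(\<Sum>i\<in>{1..<j}. \<rho> i * elt N i) \<in> ?S" using \<rho> by blast
  ultimately have "(\<Sum>i\<in>{1..<j}. \<rho> i * elt N i) \<le> Max ?S" by (rule Max_ge)
  then show ?thesis unfolding good_f_def using j by simp
qed

theorem theorem4p1:
  fixes M L N :: "nat set"
  assumes "inf_pos_set M" and "inf_pos_set L"
    and "elt M 1 > 6" and "\<forall>i\<ge>1. (elt M i)^2 < elt M (i + 1)"
    and "elt L 1 > 4" and "\<forall>i\<ge>1. 2 ^ elt L i > elt M i"
    and "inf_pos_set N" and "good_set M L N"
  shows "\<exists>\<M> :: (nat \<Rightarrow>\<^sub>0 real) set. admissible \<M> \<and>
     (schauder_basis (X_space \<M>) (X_basis \<M>) \<and> unconditional 1 (X_basis \<M>) \<and>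
      shrinking (X_space \<M>) (X_basis \<M>) \<and> bimonotone (X_basis \<M>)) \<and>
     distortion_property 6 N ((\<lambda>i. good_f M N i + 2) ` {1..}) (\<lambda>i. 1 / real (elt M i))
       (X_space \<M>) (X_basis \<M>)"
proof -
  let ?m = "elt M" and ?n = "elt N" and ?f = "good_f M N"
  let ?M = "norming_set ?m ?n"
  have m_ge: "2 \<le> ?m i" if "1 \<le> i" for i
  proof (cases "i = 1")
    case False
    then have "?m 1 < ?m i" using elt_less[OF assms(1), of 1 i] that by simp
    then show ?thesis using assms(3) by simp
  qed (use assms(3) in simp)
  have l_ge: "5 \<le> elt L i" if "1 \<le> i" for i
  proof (cases "i = 1")
    case False
    then have "elt L 1 < elt L i" using elt_less[OF assms(2), of 1 i] that by simp
    then show ?thesis using assms(5) by simp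
  qed (use assms(5) in simp)
  have good: "elt L j * (?f j + 1) < ?n j" if "1 \<le> j" for j
    using assms(8) that unfolding good_set_def by simp
  have A: "admissible ?M"
  proof (rule admissible_norming_set)
    show "1 \<le> ?m i" if "1 \<le> i" for i using m_ge[OF that] by simp
  qed
  have ts: "tree_space ?m ?n (X_basis ?M) evaluation"
    using m_ge elt_less[OF assms(1)] by (rule tree_space_norming_set)
  interpret good_space ?m ?n "X_basis ?M" evaluation "elt L" ?f
  proof (intro good_space.intro ts good_space_axioms.intro)
    fix j :: nat assume j: "1 \<le> j"
    show "tree_space.cost ?n j \<rho> \<le> ?f j" if "tree_space.branch_weight ?m j \<rho> < ?m j ^ 3" for \<rho>
    \<comment> \<open>For \<open>j = 1\<close> there are no lighter weights and the cost is 0,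
      whereas \<open>good_f\<close> is set to 1 by convention.\<close>
    proof (cases "j = 1")
      case True
      then show ?thesis unfolding tree_space.cost_def[OF ts] by simp
    next
      case False
      then show ?thesis using that j m_ge
        unfolding tree_space.cost_def[OF ts] tree_space.branch_weight_def[OF ts] by (intro good_f_ge) simp_all
    qed
    show "elt L j * (?f j + 1) < ?n j" using good[OF j] .
    show "?m j < 2 ^ elt L j" using assms(6) j by simp
  qed
  have XX: "X_space ?M = X" unfolding X_space_def embed_c00_eq_span[OF A] ..
  \<comment> \<open>Since \<open>f i + 1 < n i \<le> f (Suc i)\<close>, the values defining
    \<open>P\<close> increase strictly; the first inequality is also the required interlacing of
    \<open>N\<close> and \<open>P\<close>.\<close>
  have f_Suc: "?n i \<le> ?f (Suc i)" "?f i < ?f (Suc i)" if i: "1 \<le> i" for i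
  proof -
    show n: "?n i \<le> ?f (Suc i)" using i by (intro n_le_f) simp_all
    show "?f i < ?f (Suc i)" using f_less_n[OF i] n by simp
  qed
  \<comment> \<open>\<open>enumerate\<close> counts from 0, so position \<open>i\<close> of the
    range carries index \<open>Suc i\<close>.\<close>
  define p where "p i = ?f (Suc i) + 2" for i
  have p: "strict_mono p" unfolding p_def strict_mono_Suc_iff using f_Suc(2) by simp
  have range_p: "(\<lambda>i. ?f i + 2) ` {1..} = range p"
  proof -
    have "{1::nat..} = range Suc" by (auto simp: image_iff Suc_le_D)
    then show ?thesis unfolding p_def by (simp add: image_image)
  qed
  have elt_p: "elt (range p) i = ?f i + 2" if "1 \<le> i" for i
    unfolding elt_def enumerate_range[OF p] p_def using that by simp
  have "distortion_property 6 N (range p) (\<lambda>i. 1 / real (?m i)) X (X_basis ?M)"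
    unfolding distortion_property_def
  proof (intro conjI allI impI)
    show "inf_pos_set (range p)" unfolding inf_pos_set_def
      using range_inj_infinite[OF strict_mono_imp_inj_on[OF p]] by (auto simp: p_def)
    show "real (elt (range p) i) < real (?n i) / 2" if i: "1 \<le> i" for i
    proof -
      \<comment> \<open>Here \<open>l i \<ge> 5\<close> is used:
        \<open>2 * (f i + 2) < 5 * (f i + 1) < n i\<close>.\<close>
      have "5 * (?f i + 1) \<le> elt L i * (?f i + 1)" using l_ge[OF i] by (intro mult_right_mono) simp_all
      then have "5 * (?f i + 1) < ?n i" using good[OF i] by simp
      then show ?thesis unfolding elt_p[OF i] by simp
    qed
    show "?n (i - 1) \<le> elt (range p) i" if "2 \<le> i" for i
    proof -
      have "?n (i - 1) \<le> ?f (Suc (i - 1))" using that by (intro f_Suc(1)) simp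
      then show ?thesis using elt_p[of i] that by simp
    qed
    show "0 < 1 / real (?m i)" if "1 \<le> i" for i using m_pos[OF that] by simp
    show "1 / real (?m (Suc i)) < 1 / real (?m i)" if "1 \<le> i" for i
      using m_less[OF that, of "Suc i"] m_pos[OF that] by (intro divide_strict_left_mono) simp_all
    show "(\<lambda>i. 1 / real (?m i)) \<longlonglongrightarrow> 0"
    proof (rule tendsto_sandwich[where f = "\<lambda>_. 0" and h = "\<lambda>i. 1 / real i"])
      show "(\<lambda>i. 1 / real i) \<longlonglongrightarrow> 0" by (rule lim_1_over_n)
      have "1 / real (?m i) \<le> 1 / real i" if "1 \<le> i" for i
        using m_unbounded[OF that] that by (intro divide_left_mono) simp_all
      then show "\<forall>\<^sub>F i in sequentially. 1 / real (?m i) \<le> 1 / real i"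
        unfolding eventually_sequentially by blast
    qed simp_all
    show "asymptotic_l1 (1 / real (?m j)) (?n j) (X_basis ?M)" if "1 \<le> j" for j
      using asymptotic[OF that] .
    show "tau u (6 * (1 / real (?m j))) < enat (elt (range p) j)"
      if "1 \<le> j" "block_basis (X_basis ?M) u" for j u
      using tau_less[OF that] elt_p[OF that(1)] by simp
  qed (use assms(7) schauder_basis_e in simp_all)
  then show ?thesis
    unfolding range_p using A schauder_basis_e unconditional_e shrinking_e bimonotone_e
    by (intro exI[of _ ?M] conjI) (simp_all only: XX)
qed

end
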